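(* Let $\mu$ be a Borel probability measure on $[0,1)^2$, and let $\mu(dx\,dy)=\rho^y(dx)\,\mu_2(dy)$ be a Rokhlin disintegration of $\mu$. Suppose that $\mu$ is $y$-singular-fibered (that is, $\rho^y$ is singular with respect to Lebesgue measure for $\mu_2$-almost every $y$) and that the $y$-marginal $\mu_2$ is essentially equivalent to Lebesgue measure. Then every $f\in L^2(\mu)$ possesses a Fourier series expansion of the form $$f(x,y)=\sum_{n=0}^{\infty}\sum_{m=-\infty}^{\infty}d_{nm}e^{2\pi i(nx+my)},\qquad d_{nm}=d_{nm}(f)\in\mathbb{C},$$ where the sum converges conditionally in the norm of $L^2(\mu)$. Furthermore, the coefficients can be chosen so that for each $n\in\mathbb{N}_0$, $m\in\mathbb{Z}$ the mapping $f\mapsto d_{nm}(f)$ is a continuous linear functional on $L^2(\mu)$, and the mapping $f\mapsto\{d_{nm}(f)\}$ takes $L^2(\mu)$ into $\ell^2(\mathbb{N}_0\times\mathbb{Z})$ and has a bounded left inverse.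
   Context: Rokhlin disintegration: for a Borel probability measure $\mu$ on $[0,1)^2$, the $y$-marginal measure is $\mu_2=\mu\circ\pi_y^{-1}$, where $\pi_y(x,y)=y$, and there is a $\mu_2$-almost-everywhere unique family $\{\rho^y\}$ of Borel probability measures on $[0,1)$ (the slice measures) such that for every $f\in L^1(\mu)$, $f(\cdot,y)\in L^1(\rho^y)$ for $\mu_2$-a.e. $y$, the function $y\mapsto\int f(x,y)\,\rho^y(dx)$ is in $L^1(\mu_2)$, and $\int f\,d\mu=\int\int f(x,y)\,\rho^y(dx)\,\mu_2(dy)$. This is written $\mu(dx\,dy)=\rho^y(dx)\,\mu_2(dy)$. An absolutely continuous finite Borel measure $\nu$ on $[0,1)$ with Radon–Nikodym derivative $h$ with respect to Lebesgue measure is called essentially equivalent to Lebesgue measure if $h,\frac1h\in L^\infty(\nu)$. Conditional convergence in norm: the double sum is an iterated sum (for each $n$ the inner bi-infinite sum over $m$ converges in $L^2(\mu)$, and then the outer sum over $n$ converges in $L^2(\mu)$); unconditional convergence is not claimed. $\mathbb{N}_0=\{0,1,2,\dots\}$. A bounded left inverse of $V:L^2(\mu)\to\ell^2(\mathbb{N}_0\times\mathbb{Z})$ is a bounded linear operator $L:\ell^2(\mathbb{N}_0\times\mathbb{Z})\to L^2(\mu)$ with $LV=I$. *)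

theory Defs
  imports "HOL-Probability.Probability"
begin

abbreviation unit_borel :: "real measure" where
  "unit_borel \<equiv> restrict_space borel {0..<1}"

abbreviation unit_square_borel :: "(real \<times> real) measure" where
  "unit_square_borel \<equiv> restrict_space borel ({0..<1} \<times> {0..<1})"

abbreviation unit_lebesgue :: "real measure" where
  "unit_lebesgue \<equiv> restrict_space lborel {0..<1}"

definition y_marginal :: "(real \<times> real) measure \<Rightarrow> real measure" where
  "y_marginal \<mu> = distr \<mu> unit_borel snd"

text \<open>
  Membership in \<open>L\<^sup>1\<close> of the marginal concerns a function determined only almost everywhere, so
  the outer integral is taken over the completion: the slices are not required to depend on
  \<open>y\<close> in a strictly Borel measurable way.
\<close>

definition rokhlin_disintegration ::
    "(real \<times> real) measure \<Rightarrow> (real \<Rightarrow> real measure) \<Rightarrow> bool" where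
  "rokhlin_disintegration \<mu> \<rho> \<longleftrightarrow>
     (\<forall>y\<in>{0..<1}. prob_space (\<rho> y) \<and> sets (\<rho> y) = sets unit_borel) \<and>
     (\<forall>f :: real \<times> real \<Rightarrow> complex. integrable \<mu> f \<longrightarrow>
        (AE y in y_marginal \<mu>. integrable (\<rho> y) (\<lambda>x. f (x, y))) \<and>
        integrable (completion (y_marginal \<mu>)) (\<lambda>y. \<integral>x. f (x, y) \<partial>\<rho> y) \<and>
        (\<integral>z. f z \<partial>\<mu>) = (\<integral>y. (\<integral>x. f (x, y) \<partial>\<rho> y) \<partial>completion (y_marginal \<mu>)))"

definition mutually_singular :: "'a measure \<Rightarrow> 'a measure \<Rightarrow> bool" where
  "mutually_singular M N \<longleftrightarrow> sets M = sets N \<and>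
     (\<exists>A\<in>sets M. emeasure M A = 0 \<and> emeasure N (space N - A) = 0)"

definition y_singular_fibered ::
    "(real \<times> real) measure \<Rightarrow> (real \<Rightarrow> real measure) \<Rightarrow> bool" where
  "y_singular_fibered \<mu> \<rho> \<longleftrightarrow> (AE y in y_marginal \<mu>. mutually_singular (\<rho> y) unit_lebesgue)"

definition L_infinity :: "'a measure \<Rightarrow> ('a \<Rightarrow> real) set" where
  "L_infinity M = {f \<in> borel_measurable M. \<exists>C. AE x in M. \<bar>f x\<bar> \<le> C}"

text \<open>
  Both bounds below are almost everywhere with respect to \<open>\<nu>\<close>, not Lebesgue measure: the
  density may vanish on a set of positive Lebesgue measure, where \<open>1 / h x\<close> is irrelevant.
\<close>

definition essentially_equivalent_lebesgue :: "real measure \<Rightarrow> bool" where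
  "essentially_equivalent_lebesgue \<nu> \<longleftrightarrow>
     finite_measure \<nu> \<and> sets \<nu> = sets unit_borel \<and> absolutely_continuous unit_lebesgue \<nu> \<and>
     (let h = (\<lambda>x. enn2real (RN_deriv unit_lebesgue \<nu> x))
      in h \<in> L_infinity \<nu> \<and> (\<lambda>x. 1 / h x) \<in> L_infinity \<nu>)"

text \<open>
  Elements of \<open>L\<^sup>2\<close> are handled through representatives, so \<open>L2_norm\<close> is a seminorm
  and equality is equality almost everywhere.
\<close>

definition L2 :: "'a measure \<Rightarrow> ('a \<Rightarrow> complex) set" where
  "L2 M = {f \<in> borel_measurable M. integrable M (\<lambda>x. (norm (f x))\<^sup>2)}"

definition L2_norm :: "'a measure \<Rightarrow> ('a \<Rightarrow> complex) \<Rightarrow> real" where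
  "L2_norm M f = sqrt (\<integral>x. (norm (f x))\<^sup>2 \<partial>M)"

text \<open>
  The membership conditions matter: \<open>L2_norm\<close> is \<open>0\<close> on functions that are not square-integrable.
\<close>

definition L2_tendsto ::
    "'a measure \<Rightarrow> ('i \<Rightarrow> 'a \<Rightarrow> complex) \<Rightarrow> ('a \<Rightarrow> complex) \<Rightarrow> 'i filter \<Rightarrow> bool" where
  "L2_tendsto M u f F \<longleftrightarrow> (\<forall>i. u i \<in> L2 M) \<and> f \<in> L2 M \<and>
     ((\<lambda>i. L2_norm M (\<lambda>x. u i x - f x)) \<longlongrightarrow> 0) F"

definition L2_sums ::
    "'a measure \<Rightarrow> (nat \<Rightarrow> 'a \<Rightarrow> complex) \<Rightarrow> ('a \<Rightarrow> complex) \<Rightarrow> bool" where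
  "L2_sums M g f \<longleftrightarrow> L2_tendsto M (\<lambda>N x. \<Sum>n<N. g n x) f sequentially"

text \<open>The two ends of a bi-infinite sum tend to infinity independently of each other.\<close>

definition L2_bisums ::
    "'a measure \<Rightarrow> (int \<Rightarrow> 'a \<Rightarrow> complex) \<Rightarrow> ('a \<Rightarrow> complex) \<Rightarrow> bool" where
  "L2_bisums M g f \<longleftrightarrow>
     L2_tendsto M (\<lambda>(p, q) x. \<Sum>m = - int p..int q. g m x) f (sequentially \<times>\<^sub>F sequentially)"

definition continuous_linear_functional ::
    "'a measure \<Rightarrow> (('a \<Rightarrow> complex) \<Rightarrow> complex) \<Rightarrow> bool" where
  "continuous_linear_functional M \<phi> \<longleftrightarrow>
     (\<forall>f\<in>L2 M. \<forall>g\<in>L2 M. (AE x in M. f x = g x) \<longrightarrow> \<phi> f = \<phi> g) \<and>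
     (\<forall>f\<in>L2 M. \<forall>g\<in>L2 M. \<phi> (\<lambda>x. f x + g x) = \<phi> f + \<phi> g) \<and>
     (\<forall>c. \<forall>f\<in>L2 M. \<phi> (\<lambda>x. c * f x) = c * \<phi> f) \<and>
     (\<forall>f\<in>L2 M. \<forall>\<epsilon>>0. \<exists>\<delta>>0. \<forall>g\<in>L2 M.
        L2_norm M (\<lambda>x. g x - f x) < \<delta> \<longrightarrow> norm (\<phi> g - \<phi> f) < \<epsilon>)"

definition bounded_linear_L2 ::
    "'a measure \<Rightarrow> 'b measure \<Rightarrow> (('a \<Rightarrow> complex) \<Rightarrow> ('b \<Rightarrow> complex)) \<Rightarrow> bool" where
  "bounded_linear_L2 M N T \<longleftrightarrow>
     (\<forall>f\<in>L2 M. T f \<in> L2 N) \<and>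
     (\<forall>f\<in>L2 M. \<forall>g\<in>L2 M. (AE x in M. f x = g x) \<longrightarrow> (AE z in N. T f z = T g z)) \<and>
     (\<forall>f\<in>L2 M. \<forall>g\<in>L2 M. AE z in N. T (\<lambda>x. f x + g x) z = T f z + T g z) \<and>
     (\<forall>c. \<forall>f\<in>L2 M. AE z in N. T (\<lambda>x. c * f x) z = c * T f z) \<and>
     (\<exists>C. \<forall>f\<in>L2 M. L2_norm N (T f) \<le> C * L2_norm M f)"

text \<open>\<open>\<ell>\<^sup>2\<close> of a countable index set is \<open>L\<^sup>2\<close> of its counting measure.\<close>

abbreviation index_measure :: "(nat \<times> int) measure" where
  "index_measure \<equiv> count_space UNIV"

definition has_bounded_left_inverse ::
    "'a measure \<Rightarrow> 'b measure \<Rightarrow> (('a \<Rightarrow> complex) \<Rightarrow> ('b \<Rightarrow> complex)) \<Rightarrow> bool" where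
  "has_bounded_left_inverse M N V \<longleftrightarrow>
     (\<exists>T. bounded_linear_L2 N M T \<and> (\<forall>f\<in>L2 M. AE x in M. T (V f) x = f x))"

definition fourier_mode :: "nat \<Rightarrow> int \<Rightarrow> real \<times> real \<Rightarrow> complex" where
  "fourier_mode n m = (\<lambda>(x, y). exp (2 * of_real pi * \<i> * of_real (real n * x + of_int m * y)))"

definition fourier_expansion ::
    "(real \<times> real) measure \<Rightarrow> (nat \<Rightarrow> int \<Rightarrow> complex) \<Rightarrow> (real \<times> real \<Rightarrow> complex) \<Rightarrow> bool" where
  "fourier_expansion \<mu> c f \<longleftrightarrow>
     (\<exists>g. (\<forall>n. L2_bisums \<mu> (\<lambda>m z. c n m * fourier_mode n m z) (g n)) \<and> L2_sums \<mu> g f)"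

end

theory Submission
  imports Defs
begin

text \<open>
  The Kaczmarz coefficients \<open>c\<^sub>n\<close> of \<open>f\<close> along the unit vectors \<open>e\<^sub>n(x) = exp(2\<pi>inx)\<close>, \<open>n \<ge> 0\<close>, satisfy
  \<open>\<parallel>f - \<Sum>\<^sub>n\<^sub><\<^sub>N c\<^sub>n e\<^sub>n\<parallel>\<^sup>2 = \<parallel>f\<parallel>\<^sup>2 - \<Sum>\<^sub>n\<^sub><\<^sub>N \<bar>c\<^sub>n\<bar>\<^sup>2\<close> in \<open>L\<^sup>2\<close> of any probability measure on the circle. For a singular
  measure the right-hand side tends to zero (Kwapien and Mycielski): multiplication by \<open>e\<^sub>1\<close> and the
  density of trigonometric polynomials reduce this to \<open>f = e\<^sub>-\<^sub>1\<close>, whose coefficients have the generating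
  function \<open>(1 - 1/C(z))/z\<close> with \<open>C\<close> the Cauchy transform of the measure, and that function has \<open>H\<^sup>2\<close> norm one because the
  Poisson integrals of a singular measure tend to zero in measure.

  Applied to almost every slice \<open>\<rho>\<^sup>y\<close> this yields \<open>f(x,y) = \<Sum>\<^sub>n c\<^sub>n(y) e\<^sub>n(x)\<close> with \<open>\<Sum>\<^sub>n \<parallel>c\<^sub>n\<parallel>\<^sup>2 = \<parallel>f\<parallel>\<^sup>2\<close> in \<open>L\<^sup>2\<close>
  of the marginal. Since the marginal is comparable to Lebesgue measure on the set where its density does
  not vanish, each \<open>c\<^sub>n\<close>, extended by zero, has a Fourier series in \<open>y\<close>; its coefficients are the \<open>d\<^sub>n\<^sub>m\<close>.
  The map \<open>f \<mapsto> (d\<^sub>n\<^sub>m)\<close> is bounded above and below, so the orthogonal projection onto its range gives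
  a bounded left inverse.
\<close>

section \<open>The space of square-integrable functions\<close>

text \<open>The obstacle is that everything holds only almost everywhere, and for several measures.
  Functions on the square are representatives, so completeness and projection are proved for a
  seminorm, and linear maps are additive only almost everywhere. The disintegration makes c_n
  measurable only for the completion of the marginal and fixes it only up to null sets of the
  marginal, which may have positive Lebesgue measure. A Fourier series in y would see that
  ambiguity. Extending a Borel version of c_n by zero removes it: for functions vanishing where the
  density does, equality almost everywhere for the marginal implies equality almost everywhere for
  Lebesgue measure. Linearity of the coefficients d_nm rests on this. The Kaczmarz series is not an
  orthogonal expansion: the e_n need not be orthogonal on a slice, each c_n depends on its
  predecessors, and the order of the outer sum belongs to the construction. The function e_-1
  decides everything because it is the vector just before e_0, e_1, ...: once it is recovered from
  these, the shift recovers every e_k with k < 0.\<close>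

lemma L2_measurable: "f \<in> L2 M \<Longrightarrow> f \<in> borel_measurable M"
  by (simp add: L2_def)

lemma L2_integrable: "f \<in> L2 M \<Longrightarrow> integrable M (\<lambda>x. (norm (f x))\<^sup>2)"
  by (simp add: L2_def)

lemma L2I: "f \<in> borel_measurable M \<Longrightarrow> integrable M (\<lambda>x. (norm (f x))\<^sup>2) \<Longrightarrow> f \<in> L2 M"
  by (simp add: L2_def)

lemma borel_measurable_cnj [measurable (raw)]:
  assumes "f \<in> borel_measurable M" shows "(\<lambda>x. cnj (f x)) \<in> borel_measurable M"
  using borel_measurable_continuous_on[OF _ assms, of cnj] by (simp add: continuous_on_cnj)

lemma norm_add_sq_le: "(norm (a + b :: complex))\<^sup>2 \<le> 2 * (norm a)\<^sup>2 + 2 * (norm b)\<^sup>2"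
proof -
  have "(norm (a + b))\<^sup>2 \<le> (norm a + norm b)\<^sup>2"
    by (intro power_mono norm_triangle_ineq) auto
  also have "\<dots> \<le> 2 * (norm a)\<^sup>2 + 2 * (norm b)\<^sup>2"
    using sum_squares_bound[of "norm a" "norm b"] by (simp add: power2_sum)
  finally show ?thesis .
qed

lemma L2_dominated:
  assumes "g \<in> L2 M" "f \<in> borel_measurable M" "AE x in M. norm (f x) \<le> norm (g x)"
  shows "f \<in> L2 M"
proof (rule L2I[OF assms(2)])
  show "integrable M (\<lambda>x. (norm (f x))\<^sup>2)"
    by (rule Bochner_Integration.integrable_bound[OF L2_integrable[OF assms(1)]])
      (use assms in \<open>auto intro: power_mono\<close>)
qed

lemma L2_scale:
  assumes "f \<in> L2 M" shows "(\<lambda>x. c * f x) \<in> L2 M"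
  using assms by (auto simp: L2_def norm_mult power_mult_distrib)

lemma L2_add:
  assumes "f \<in> L2 M" "g \<in> L2 M" shows "(\<lambda>x. f x + g x) \<in> L2 M"
proof (rule L2I)
  have [measurable]: "f \<in> borel_measurable M" "g \<in> borel_measurable M"
    using assms by (auto simp: L2_def)
  show "(\<lambda>x. f x + g x) \<in> borel_measurable M" by measurable
  show "integrable M (\<lambda>x. (norm (f x + g x))\<^sup>2)"
    by (rule Bochner_Integration.integrable_bound[where f = "\<lambda>x. 2 * (norm (f x))\<^sup>2 + 2 * (norm (g x))\<^sup>2"])
      (use assms norm_add_sq_le in \<open>auto simp: L2_def\<close>)
qed

lemma L2_zero: "(\<lambda>x. 0) \<in> L2 M"
  by (simp add: L2_def)

lemma L2_uminus: "f \<in> L2 M \<Longrightarrow> (\<lambda>x. - f x) \<in> L2 M"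
  using L2_scale[of f M "- 1"] by simp

lemma L2_diff:
  assumes "f \<in> L2 M" "g \<in> L2 M" shows "(\<lambda>x. f x - g x) \<in> L2 M"
  using L2_add[OF assms(1) L2_uminus[OF assms(2)]] by simp

lemma L2_sum:
  assumes "\<And>i. i \<in> I \<Longrightarrow> f i \<in> L2 M" shows "(\<lambda>x. \<Sum>i\<in>I. f i x) \<in> L2 M"
  using assms
proof (induction I rule: infinite_finite_induct)
  case (insert i I)
  then show ?case using L2_add[of "f i" M "\<lambda>x. \<Sum>i\<in>I. f i x"] by auto
qed (auto intro: L2_zero)

lemma (in finite_measure) L2_bounded:
  assumes "f \<in> borel_measurable M" "\<And>x. norm (f x) \<le> B"
  shows "f \<in> L2 M"
proof (rule L2I[OF assms(1)])
  show "integrable M (\<lambda>x. (norm (f x))\<^sup>2)"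
    using assms by (intro integrable_const_bound[where B = "B\<^sup>2"]) (auto intro!: AE_I2 power_mono)
qed

lemma L2_integrable_mult_cnj:
  assumes "f \<in> L2 M" "g \<in> L2 M" shows "integrable M (\<lambda>x. f x * cnj (g x))"
proof (rule Bochner_Integration.integrable_bound[where f = "\<lambda>x. (norm (f x))\<^sup>2 + (norm (g x))\<^sup>2"])
  have [measurable]: "f \<in> borel_measurable M" "g \<in> borel_measurable M"
    using assms by (auto simp: L2_def)
  show "(\<lambda>x. f x * cnj (g x)) \<in> borel_measurable M" by measurable
  have "norm (f x * cnj (g x)) \<le> (norm (f x))\<^sup>2 + (norm (g x))\<^sup>2" for x
    using sum_squares_bound[of "norm (f x)" "norm (g x)"]
      mult_nonneg_nonneg[OF norm_ge_zero[of "f x"] norm_ge_zero[of "g x"]]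
    unfolding norm_mult complex_mod_cnj by linarith
  then show "AE x in M. norm (f x * cnj (g x)) \<le> norm ((norm (f x))\<^sup>2 + (norm (g x))\<^sup>2)"
    by auto
qed (use assms in \<open>auto simp: L2_def\<close>)

section \<open>The inner product and the seminorm\<close>

definition L2_inner :: "'a measure \<Rightarrow> ('a \<Rightarrow> complex) \<Rightarrow> ('a \<Rightarrow> complex) \<Rightarrow> complex" where
  "L2_inner M f g = (\<integral>x. f x * cnj (g x) \<partial>M)"

lemma L2_inner_add_left:
  "f \<in> L2 M \<Longrightarrow> g \<in> L2 M \<Longrightarrow> k \<in> L2 M \<Longrightarrow>
    L2_inner M (\<lambda>x. f x + g x) k = L2_inner M f k + L2_inner M g k"
  by (simp add: L2_inner_def distrib_right L2_integrable_mult_cnj)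

lemma L2_inner_diff_left:
  "f \<in> L2 M \<Longrightarrow> g \<in> L2 M \<Longrightarrow> k \<in> L2 M \<Longrightarrow>
    L2_inner M (\<lambda>x. f x - g x) k = L2_inner M f k - L2_inner M g k"
  by (simp add: L2_inner_def left_diff_distrib L2_integrable_mult_cnj)

lemma L2_inner_scale_left: "L2_inner M (\<lambda>x. c * f x) g = c * L2_inner M f g"
  by (simp add: L2_inner_def mult.assoc)

lemma L2_inner_commute: "L2_inner M g f = cnj (L2_inner M f g)"
  unfolding L2_inner_def by (subst Bochner_Integration.integral_cnj[symmetric]) (simp add: mult.commute)

lemma L2_inner_scale_right: "L2_inner M f (\<lambda>x. c * g x) = cnj c * L2_inner M f g"
  by (metis L2_inner_commute L2_inner_scale_left complex_cnj_mult)

lemma L2_inner_sum_left: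
  "(\<And>i. i \<in> I \<Longrightarrow> f i \<in> L2 M) \<Longrightarrow> k \<in> L2 M \<Longrightarrow>
    L2_inner M (\<lambda>x. \<Sum>i\<in>I. f i x) k = (\<Sum>i\<in>I. L2_inner M (f i) k)"
  by (simp add: L2_inner_def sum_distrib_right L2_integrable_mult_cnj)

lemma L2_inner_cong_AE:
  assumes "f \<in> L2 M" "f' \<in> L2 M" "g \<in> L2 M" "AE x in M. f x = f' x"
  shows "L2_inner M f g = L2_inner M f' g"
  unfolding L2_inner_def
  using assms L2_integrable_mult_cnj by (intro integral_cong_AE) (auto intro: borel_measurable_integrable)

lemma L2_norm_nonneg [simp]: "0 \<le> L2_norm M f"
  by (simp add: L2_norm_def)

lemma L2_norm_sq: "(L2_norm M f)\<^sup>2 = (\<integral>x. (norm (f x))\<^sup>2 \<partial>M)"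
  by (simp add: L2_norm_def)

lemma L2_inner_self: "L2_inner M f f = of_real ((L2_norm M f)\<^sup>2)"
  unfolding L2_inner_def L2_norm_sq complex_norm_square[symmetric] integral_complex_of_real ..

lemma L2_norm_add_sq:
  assumes "f \<in> L2 M" "g \<in> L2 M"
  shows "(L2_norm M (\<lambda>x. f x + g x))\<^sup>2 = (L2_norm M f)\<^sup>2 + 2 * Re (L2_inner M f g) + (L2_norm M g)\<^sup>2"
proof -
  have eq: "(norm (f x + g x))\<^sup>2 = (norm (f x))\<^sup>2 + 2 * Re (f x * cnj (g x)) + (norm (g x))\<^sup>2" for x
    unfolding cmod_power2 by (simp add: power2_sum algebra_simps)
  show ?thesis
    unfolding L2_norm_sq eq L2_inner_def
    using assms L2_integrable_mult_cnj[OF assms]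
    by (simp add: L2_integrable integrable_Re del: times_complex.sel flip: integral_Re)
qed

lemma L2_norm_scale: "L2_norm M (\<lambda>x. c * f x) = norm c * L2_norm M f"
  by (simp add: L2_norm_def norm_mult power_mult_distrib real_sqrt_mult)

lemma L2_norm_uminus: "L2_norm M (\<lambda>x. - f x) = L2_norm M f"
  by (simp add: L2_norm_def)

lemma L2_norm_minus_commute: "L2_norm M (\<lambda>x. f x - g x) = L2_norm M (\<lambda>x. g x - f x)"
  by (simp add: L2_norm_def norm_minus_commute)

lemma L2_norm_zero [simp]: "L2_norm M (\<lambda>x. 0) = 0"
  by (simp add: L2_norm_def)

lemma L2_norm_diff_sq:
  assumes "f \<in> L2 M" "g \<in> L2 M"
  shows "(L2_norm M (\<lambda>x. f x - g x))\<^sup>2 = (L2_norm M f)\<^sup>2 - 2 * Re (L2_inner M f g) + (L2_norm M g)\<^sup>2"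
  using L2_norm_add_sq[OF assms(1) L2_scale[OF assms(2), of "- 1"]]
    L2_inner_scale_right[of M f "- 1" g]
  by (simp add: L2_norm_uminus)

lemma L2_norm_cong_AE:
  assumes "f \<in> borel_measurable M" "g \<in> borel_measurable M" "AE x in M. f x = g x"
  shows "L2_norm M f = L2_norm M g"
  unfolding L2_norm_def using assms by (intro arg_cong[where f = sqrt] integral_cong_AE) auto

lemma L2_norm_eq_0_iff:
  assumes "f \<in> L2 M" shows "L2_norm M f = 0 \<longleftrightarrow> (AE x in M. f x = 0)"
  using integral_nonneg_eq_0_iff_AE[OF L2_integrable[OF assms]] by (simp add: L2_norm_def)

text \<open>The squared norm of \<open>b f - c g\<close> with \<open>b\<close> the squared norm of
  \<open>g\<close> and \<open>c\<close> the inner product is nonnegative; this is the component of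
  \<open>f\<close> orthogonal to \<open>g\<close>, scaled to avoid a division. A seminorm can vanish
  on a nonzero representative, hence the separate case.\<close>

lemma L2_Cauchy_Schwarz:
  assumes "f \<in> L2 M" "g \<in> L2 M"
  shows "norm (L2_inner M f g) \<le> L2_norm M f * L2_norm M g"
proof (cases "L2_norm M g = 0")
  case True
  then have "AE x in M. g x = 0" using assms L2_norm_eq_0_iff by blast
  then have "L2_inner M g f = L2_inner M (\<lambda>x. 0) f"
    by (intro L2_inner_cong_AE assms L2_zero) auto
  then have "L2_inner M g f = 0" by (simp add: L2_inner_def)
  then show ?thesis using L2_inner_commute[of M f g] by simp
next
  case False
  define b where "b = (L2_norm M g)\<^sup>2"
  define c where "c = L2_inner M f g"
  have b: "b > 0" using False by (simp add: b_def)
  have "0 \<le> (L2_norm M (\<lambda>x. of_real b * f x - c * g x))\<^sup>2" by simp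
  also have "\<dots> = b\<^sup>2 * (L2_norm M f)\<^sup>2 - 2 * Re (of_real b * (cnj c * c)) + (norm c)\<^sup>2 * b"
    by (subst L2_norm_diff_sq)
      (use assms in \<open>simp_all add: L2_scale L2_norm_scale L2_inner_scale_left L2_inner_scale_right
        power_mult_distrib norm_power b_def c_def\<close>)
  also have "cnj c * c = of_real ((norm c)\<^sup>2)"
    by (simp only: complex_norm_square mult.commute)
  finally have "0 \<le> b * (b * (L2_norm M f)\<^sup>2 - (norm c)\<^sup>2)"
    by (simp add: algebra_simps power2_eq_square)
  with b have "(norm c)\<^sup>2 \<le> b * (L2_norm M f)\<^sup>2"
    by (simp add: zero_le_mult_iff)
  then have "(norm c)\<^sup>2 \<le> (L2_norm M f * L2_norm M g)\<^sup>2"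
    by (simp add: b_def power_mult_distrib mult.commute)
  then show ?thesis unfolding c_def by (rule power2_le_imp_le) simp
qed

lemma L2_norm_triangle:
  assumes "f \<in> L2 M" "g \<in> L2 M"
  shows "L2_norm M (\<lambda>x. f x + g x) \<le> L2_norm M f + L2_norm M g"
proof (rule power2_le_imp_le)
  have "Re (L2_inner M f g) \<le> L2_norm M f * L2_norm M g"
    using complex_Re_le_cmod[of "L2_inner M f g"] L2_Cauchy_Schwarz[OF assms] by linarith
  then show "(L2_norm M (\<lambda>x. f x + g x))\<^sup>2 \<le> (L2_norm M f + L2_norm M g)\<^sup>2"
    unfolding L2_norm_add_sq[OF assms] by (simp add: power2_sum)
qed simp

lemma L2_norm_triangle_diff:
  assumes "f \<in> L2 M" "g \<in> L2 M" "k \<in> L2 M"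
  shows "L2_norm M (\<lambda>x. f x - k x) \<le> L2_norm M (\<lambda>x. f x - g x) + L2_norm M (\<lambda>x. g x - k x)"
  using L2_norm_triangle[OF L2_diff[OF assms(1,2)] L2_diff[OF assms(2,3)]] by simp

lemma L2_norm_diff_abs_le:
  assumes "f \<in> L2 M" "g \<in> L2 M"
  shows "\<bar>L2_norm M f - L2_norm M g\<bar> \<le> L2_norm M (\<lambda>x. f x - g x)"
  using L2_norm_triangle[OF assms(2) L2_diff[OF assms]]
    L2_norm_triangle[OF assms(1) L2_diff[OF assms(2,1)]]
  by (simp add: L2_norm_minus_commute[of M g f])

section \<open>Nonnegative integrals and completeness\<close>

lemma L2_nn_integral:
  assumes "f \<in> L2 M"
  shows "(\<integral>\<^sup>+x. ennreal ((norm (f x))\<^sup>2) \<partial>M) = ennreal ((L2_norm M f)\<^sup>2)"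
  unfolding L2_norm_sq using L2_integrable[OF assms] by (intro nn_integral_eq_integral) auto

lemma L2_I_nn_integral:
  assumes "f \<in> borel_measurable M" "(\<integral>\<^sup>+x. ennreal ((norm (f x))\<^sup>2) \<partial>M) < \<infinity>"
  shows "f \<in> L2 M"
  using assms by (intro L2I integrableI_bounded) auto

lemma L2_tendsto_norm:
  assumes "\<And>k. u k \<in> L2 M" "f \<in> L2 M" "((\<lambda>k. L2_norm M (\<lambda>x. u k x - f x)) \<longlongrightarrow> 0) F"
  shows "((\<lambda>k. L2_norm M (u k)) \<longlongrightarrow> L2_norm M f) F"
  by (rule Lim_null_comparison[THEN LIM_zero_cancel, OF _ assms(3)])
    (use L2_norm_diff_abs_le[OF assms(1,2)] in auto)

text \<open>The Riesz-Fischer argument: a subsequence with increments of norm at most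
  \<open>(1/4) ^ k\<close> converges almost everywhere, and Fatou's lemma shows that its pointwise
  limit is the norm limit of the whole sequence.\<close>

theorem L2_complete:
  assumes u: "\<And>k. u k \<in> L2 M"
    and Cauchy: "\<And>e. e > 0 \<Longrightarrow> \<exists>N. \<forall>m\<ge>N. \<forall>n\<ge>N. L2_norm M (\<lambda>x. u m x - u n x) < e"
  obtains f where "f \<in> L2 M" "(\<lambda>k. L2_norm M (\<lambda>x. u k x - f x)) \<longlonglongrightarrow> 0"
proof -
  have [measurable]: "u k \<in> borel_measurable M" for k using u L2_measurable by blast
  have "\<forall>k. \<exists>s. \<forall>m\<ge>s. \<forall>n\<ge>s. L2_norm M (\<lambda>x. u m x - u n x) < (1/4) ^ k"
    by (intro allI Cauchy) simp
  from choice[OF this] obtain s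
    where s: "\<And>k m n. m \<ge> s k \<Longrightarrow> n \<ge> s k \<Longrightarrow> L2_norm M (\<lambda>x. u m x - u n x) < (1/4) ^ k"
    by blast
  \<comment> \<open>The sum puts \<open>t k\<close> above every \<open>s i\<close> with
    \<open>i \<le> k\<close>, whether or not \<open>s\<close> increases; the summand
    \<open>k\<close> sends \<open>t k\<close> to infinity.\<close>
  define t where "t k = (\<Sum>i\<le>k. s i) + k" for k
  have t: "t k \<ge> s i" "t k \<ge> k" if "i \<le> k" for i k
    using that member_le_sum[of i "{..k}" s] by (auto simp: t_def)
  define v where "v k = u (t k)" for k
  have [measurable]: "v k \<in> borel_measurable M" for k by (simp add: v_def)
  have dv: "L2_norm M (\<lambda>x. v (Suc k) x - v k x) \<le> (1/4) ^ k" for k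
    unfolding v_def using s[of k "t (Suc k)" "t k"] t(1)[of k "Suc k"] t(1)[of k k] by simp
  \<comment> \<open>The squared norms of the increments decay like 16^(-k). The weight
    \<open>4 ^ k\<close> spends half of that decay: the integrals stay summable, and where the
    weighted sum is finite the increments are bounded by a multiple of
    \<open>(1/2) ^ k\<close>.\<close>
  define D where "D k x = ennreal (4 ^ k * (norm (v (Suc k) x - v k x))\<^sup>2)" for k x
  have [measurable]: "D k \<in> borel_measurable M" for k unfolding D_def by measurable
  have "(\<integral>\<^sup>+x. D k x \<partial>M) \<le> ennreal ((1/4) ^ k)" for k
  proof -
    have "(\<integral>\<^sup>+x. D k x \<partial>M) = ennreal (4 ^ k) * ennreal ((L2_norm M (\<lambda>x. v (Suc k) x - v k x))\<^sup>2)"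
      unfolding D_def
      by (subst L2_nn_integral[symmetric]) (auto simp: v_def ennreal_mult nn_integral_cmult u intro!: L2_diff)
    also have "\<dots> = ennreal (4 ^ k * (L2_norm M (\<lambda>x. v (Suc k) x - v k x))\<^sup>2)"
      by (simp add: ennreal_mult)
    also have "\<dots> \<le> ennreal (4 ^ k * ((1/4) ^ k)\<^sup>2)"
      by (intro ennreal_leI mult_left_mono power_mono dv) auto
    also have "4 ^ k * ((1/4) ^ k)\<^sup>2 = (1/4 :: real) ^ k"
      by (simp add: power2_eq_square power_divide)
    finally show ?thesis .
  qed
  then have "(\<integral>\<^sup>+x. (\<Sum>k. D k x) \<partial>M) \<le> (\<Sum>k. ennreal ((1/4) ^ k))"
    by (subst nn_integral_suminf) (auto intro!: suminf_le)
  also have "\<dots> < \<infinity>"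
    by (subst suminf_ennreal2) (auto intro: summable_geometric)
  finally have "AE x in M. (\<Sum>k. D k x) \<noteq> \<infinity>"
    by (intro nn_integral_noteq_infinite) auto
  then have conv: "AE x in M. convergent (\<lambda>k. v k x)"
  proof eventually_elim
    case (elim x)
    then obtain B where B: "B \<ge> 0" "(\<Sum>k. D k x) = ennreal B"
      by (cases "\<Sum>k. D k x") auto
    have le: "norm (v (Suc k) x - v k x) \<le> sqrt B * (1/2) ^ k" for k
    proof -
      have "D k x \<le> (\<Sum>k. D k x)"
        using sum_le_suminf[of "\<lambda>k. D k x" "{k}"] by simp
      then have "4 ^ k * (norm (v (Suc k) x - v k x))\<^sup>2 \<le> B"
        using B by (simp add: D_def)
      then have "(norm (v (Suc k) x - v k x))\<^sup>2 \<le> B * (1/4) ^ k"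
        by (simp add: power_divide field_simps)
      also have "\<dots> = (sqrt B * (1/2) ^ k)\<^sup>2"
      proof -
        have "((1/2) ^ k)\<^sup>2 = (1/4 :: real) ^ k"
          by (simp add: power2_eq_square flip: power_mult_distrib)
        then show ?thesis using B(1) by (simp only: power_mult_distrib real_sqrt_pow2)
      qed
      finally show ?thesis by (rule power2_le_imp_le) (simp add: B(1))
    qed
    have "summable (\<lambda>k. v (Suc k) x - v k x)"
      by (rule summable_comparison_test'[OF summable_mult[OF summable_geometric] le]) simp
    then have "convergent (\<lambda>n. \<Sum>k<n. v (Suc k) x - v k x)"
      by (simp add: summable_iff_convergent)
    then have "convergent (\<lambda>n. v n x - v 0 x)"
      using sum_lessThan_telescope[of "\<lambda>k. v k x"] by simp
    then show ?case
      using convergent_add[OF _ convergent_const[of "v 0 x"]] by fastforce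
  qed
  define f where "f x = lim (\<lambda>k. v k x)" for x
  have [measurable]: "f \<in> borel_measurable M" unfolding f_def by measurable
  have lim: "AE x in M. (\<lambda>k. v k x) \<longlonglongrightarrow> f x"
    using conv by eventually_elim (simp add: f_def convergent_LIMSEQ_iff)
  \<comment> \<open>Used with \<open>e = 1\<close> to get \<open>f\<close> into \<open>L2\<close>,
    and with arbitrarily small \<open>e\<close> to get convergence.\<close>
  have Fatou: "(\<integral>\<^sup>+x. ennreal ((norm (u m x - f x))\<^sup>2) \<partial>M) \<le> ennreal (e\<^sup>2)"
    if e: "e \<ge> 0" "\<And>n. n \<ge> N \<Longrightarrow> L2_norm M (\<lambda>x. u m x - u n x) < e" for e m N
  proof -
    have "(\<integral>\<^sup>+x. ennreal ((norm (u m x - f x))\<^sup>2) \<partial>M)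
        = (\<integral>\<^sup>+x. liminf (\<lambda>k. ennreal ((norm (u m x - v k x))\<^sup>2)) \<partial>M)"
    proof (rule nn_integral_cong_AE, use lim in eventually_elim)
      case (elim x)
      then have "(\<lambda>k. ennreal ((norm (u m x - v k x))\<^sup>2)) \<longlonglongrightarrow> ennreal ((norm (u m x - f x))\<^sup>2)"
        by (intro tendsto_intros)
      then show ?case by (metis lim_imp_Liminf sequentially_bot)
    qed
    also have "\<dots> \<le> liminf (\<lambda>k. \<integral>\<^sup>+x. ennreal ((norm (u m x - v k x))\<^sup>2) \<partial>M)"
      by (intro nn_integral_liminf) measurable
    also have "\<dots> \<le> limsup (\<lambda>k. \<integral>\<^sup>+x. ennreal ((norm (u m x - v k x))\<^sup>2) \<partial>M)"
      by (simp add: Liminf_le_Limsup)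
    also have "\<dots> \<le> ennreal (e\<^sup>2)"
    proof (intro Limsup_bounded eventually_sequentiallyI[of N])
      fix k assume "N \<le> k"
      then have "L2_norm M (\<lambda>x. u m x - v k x) < e" using t(2)[of k k] e(2)[of "t k"] by (simp add: v_def)
      then show "(\<integral>\<^sup>+x. ennreal ((norm (u m x - v k x))\<^sup>2) \<partial>M) \<le> ennreal (e\<^sup>2)"
        by (subst L2_nn_integral) (auto simp: v_def intro!: L2_diff u ennreal_leI power_mono)
    qed
    finally show ?thesis .
  qed
  have uf: "(\<lambda>x. u m x - f x) \<in> L2 M"
    if "e \<ge> 0" "\<And>n. n \<ge> N \<Longrightarrow> L2_norm M (\<lambda>x. u m x - u n x) < e" for e m N
    using Fatou[of e N m] that by (intro L2_I_nn_integral) (auto intro: le_less_trans)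
  have f: "f \<in> L2 M"
    using L2_diff[OF u[of "s 0"] uf[of 1 "s 0" "s 0"]] s[of 0 "s 0"] by simp
  have "(\<lambda>k. L2_norm M (\<lambda>x. u k x - f x)) \<longlonglongrightarrow> 0"
  proof (rule LIMSEQ_I)
    fix r :: real assume "r > 0"
    then obtain N where N: "\<And>m n. m \<ge> N \<Longrightarrow> n \<ge> N \<Longrightarrow> L2_norm M (\<lambda>x. u m x - u n x) < r / 2"
      using Cauchy[of "r / 2"] by auto
    have "L2_norm M (\<lambda>x. u m x - f x) < r" if "m \<ge> N" for m
    proof -
      have "ennreal ((L2_norm M (\<lambda>x. u m x - f x))\<^sup>2) \<le> ennreal ((r/2)\<^sup>2)"
        using Fatou[of "r / 2" N m] N that \<open>r > 0\<close> L2_nn_integral[OF L2_diff[OF u f]] by simp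
      then have "L2_norm M (\<lambda>x. u m x - f x) \<le> r / 2"
        using \<open>r > 0\<close> by (simp only: ennreal_le_iff zero_le_power2) (rule power2_le_imp_le, auto)
      with \<open>r > 0\<close> show ?thesis by simp
    qed
    then show "\<exists>N. \<forall>m\<ge>N. norm (L2_norm M (\<lambda>x. u m x - f x) - 0) < r" by auto
  qed
  with f show ?thesis by (rule that)
qed

section \<open>Orthogonal projection and bounded left inverses\<close>

lemma L2_parallelogram:
  assumes "f \<in> L2 M" "g \<in> L2 M"
  shows "(L2_norm M (\<lambda>x. f x - g x))\<^sup>2 = 2 * (L2_norm M f)\<^sup>2 + 2 * (L2_norm M g)\<^sup>2 - (L2_norm M (\<lambda>x. f x + g x))\<^sup>2"
  using L2_norm_add_sq[OF assms] L2_norm_diff_sq[OF assms] by simp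

text \<open>If the inner product \<open>p\<close> were nonzero, a short step from \<open>r\<close>
  in the direction of \<open>- p * w\<close> would decrease the norm.\<close>

lemma L2_norm_minimal_orthogonal:
  assumes "r \<in> L2 M" "w \<in> L2 M" and min: "\<And>c. L2_norm M r \<le> L2_norm M (\<lambda>x. r x + c * w x)"
  shows "L2_inner M r w = 0"
proof -
  define p where "p = L2_inner M r w"
  \<comment> \<open>The optimal step length is the inverse of the squared norm of \<open>w\<close>;
    the added \<open>1\<close> keeps it defined when that norm vanishes and still leaves the product
    below one.\<close>
  define t where "t = 1 / ((L2_norm M w)\<^sup>2 + 1)"
  have t: "t > 0" "t * (L2_norm M w)\<^sup>2 < 1"
    using zero_le_power2[of "L2_norm M w"] by (auto simp: t_def field_simps add_pos_nonneg simp del: zero_le_power2)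
  have "(L2_norm M r)\<^sup>2 \<le> (L2_norm M (\<lambda>x. r x + (- of_real t * p) * w x))\<^sup>2"
    by (intro power_mono min) simp
  also have "\<dots> = (L2_norm M r)\<^sup>2 - 2 * t * Re (cnj p * p) + t\<^sup>2 * (norm p)\<^sup>2 * (L2_norm M w)\<^sup>2"
    by (subst L2_norm_add_sq[OF assms(1) L2_scale[OF assms(2)]])
      (simp only: L2_inner_scale_right L2_norm_scale, simp add: p_def[symmetric] norm_mult power_mult_distrib algebra_simps)
  also have "cnj p * p = of_real ((norm p)\<^sup>2)"
    by (simp only: complex_norm_square mult.commute)
  finally have "t * ((norm p)\<^sup>2 * (2 - t * (L2_norm M w)\<^sup>2)) \<le> 0"
    by (simp add: algebra_simps power2_eq_square)
  with t have "(norm p)\<^sup>2 \<le> 0"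
    by (auto simp: mult_le_0_iff)
  then show ?thesis by (simp add: p_def)
qed

text \<open>The lower bound makes a minimising sequence for the distance from \<open>d\<close> to
  the range of \<open>V\<close> Cauchy already in the domain, so its limit is a preimage of the
  projection of \<open>d\<close>. The left inverse sends \<open>d\<close> to that preimage, which is
  unique up to null sets.\<close>

theorem has_bounded_left_inverseI:
  assumes V: "bounded_linear_L2 M N V"
    and below: "\<And>f. f \<in> L2 M \<Longrightarrow> L2_norm M f \<le> A * L2_norm N (V f)"
  shows "has_bounded_left_inverse M N V"
proof -
  from V obtain C where VL2: "\<And>f. f \<in> L2 M \<Longrightarrow> V f \<in> L2 N"
    and Vadd: "\<And>f g. f \<in> L2 M \<Longrightarrow> g \<in> L2 M \<Longrightarrow> AE z in N. V (\<lambda>x. f x + g x) z = V f z + V g z"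
    and Vscale: "\<And>f c. f \<in> L2 M \<Longrightarrow> AE z in N. V (\<lambda>x. c * f x) z = c * V f z"
    and bound: "\<And>f. f \<in> L2 M \<Longrightarrow> L2_norm N (V f) \<le> C * L2_norm M f"
    unfolding bounded_linear_L2_def by blast
  have Vdiff: "AE z in N. V (\<lambda>x. f x - g x) z = V f z - V g z" if "f \<in> L2 M" "g \<in> L2 M" for f g
    using Vadd[OF that(1) L2_scale[OF that(2), of "- 1"]] Vscale[OF that(2), of "- 1"]
    by eventually_elim simp
  have below': "L2_norm M f \<le> \<bar>A\<bar> * L2_norm N (V f)" if "f \<in> L2 M" for f
    using below[OF that] mult_right_mono[OF abs_ge_self[of A] L2_norm_nonneg[of N "V f"]] by linarith
  have meas: "V f \<in> borel_measurable N" if "f \<in> L2 M" for f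
    using VL2[OF that] by (rule L2_measurable)
  have dist: "L2_norm N (V (\<lambda>x. f x - g x)) = L2_norm N (\<lambda>z. V f z - V g z)" if "f \<in> L2 M" "g \<in> L2 M" for f g
    by (rule L2_norm_cong_AE[OF _ _ Vdiff]) (use that in \<open>auto intro!: L2_measurable VL2 L2_diff\<close>)

  \<comment> \<open>The normal equation: the residual is orthogonal to the range. Unlike minimality
    of the distance it is linear in the pair \<open>d\<close>, \<open>f\<close>, so additivity and
    homogeneity of the left inverse follow from uniqueness.\<close>
  define P where "P d f \<longleftrightarrow> f \<in> L2 M \<and> (\<forall>g\<in>L2 M. L2_inner N (\<lambda>z. V f z - d z) (V g) = 0)" for d f
  have ex: "\<exists>f. P d f" if d: "d \<in> L2 N" for d
  proof -
    define J where "J f = L2_norm N (\<lambda>z. V f z - d z)" for f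
    define \<delta> where "\<delta> = (INF f\<in>L2 M. J f)"
    have bdd: "bdd_below (J ` L2 M)" by (rule bdd_belowI[of _ 0]) (auto simp: J_def)
    have \<delta>: "\<delta> \<le> J f" if "f \<in> L2 M" for f
      unfolding \<delta>_def by (rule cINF_lower[OF bdd that])
    have \<delta>0: "\<delta> \<ge> 0"
      unfolding \<delta>_def by (rule cINF_greatest) (use L2_zero in \<open>auto simp: J_def\<close>)
    have "\<exists>f\<in>L2 M. J f < \<delta> + 1 / Suc k" for k
      using cINF_less_iff[of "L2 M" J "\<delta> + 1 / Suc k"] L2_zero[of M] bdd by (auto simp: \<delta>_def)
    then obtain u where u: "\<And>k. u k \<in> L2 M" "\<And>k. J (u k) < \<delta> + 1 / Suc k" by metis
    \<comment> \<open>Parallelogram law: the image of the midpoint \<open>m\<close> lies at distance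
      at least \<open>\<delta>\<close> from \<open>d\<close>, which forces the images of two
      near-minimisers to be close.\<close>
    have close: "(L2_norm N (V (\<lambda>x. u j x - u k x)))\<^sup>2 \<le> 4 * ((\<delta> + 1 / Suc n)\<^sup>2 - \<delta>\<^sup>2)" if "j \<ge> n" "k \<ge> n" for j k n
    proof -
      define m where "m x = (1/2) * (u j x + u k x)" for x
      have m: "m \<in> L2 M" unfolding m_def by (intro L2_scale L2_add u)
      have "AE z in N. V m z = (1/2) * (V (u j) z + V (u k) z)"
        using Vadd[OF u(1) u(1), of j k] Vscale[OF L2_add[OF u(1) u(1)], of "1/2" j k]
        by eventually_elim (simp add: m_def[abs_def])
      then have "AE z in N. (V (u j) z - d z) + (V (u k) z - d z) = 2 * (V m z - d z)"
        by eventually_elim (simp add: algebra_simps)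
      then have "L2_norm N (\<lambda>z. (V (u j) z - d z) + (V (u k) z - d z)) = L2_norm N (\<lambda>z. 2 * (V m z - d z))"
        by (intro L2_norm_cong_AE L2_measurable L2_add L2_diff L2_scale VL2 u m d)
      also have "\<dots> = 2 * J m" unfolding L2_norm_scale J_def by simp
      finally have sum: "L2_norm N (\<lambda>z. (V (u j) z - d z) + (V (u k) z - d z)) \<ge> 2 * \<delta>"
        using \<delta>[OF m] by simp
      have Jle: "J (u i) \<le> \<delta> + 1 / Suc n" if "i \<ge> n" for i
        using u(2)[of i] that frac_le[of 1 1 "real (Suc n)" "real (Suc i)"] by simp
      have "(L2_norm N (V (\<lambda>x. u j x - u k x)))\<^sup>2 = (L2_norm N (\<lambda>z. (V (u j) z - d z) - (V (u k) z - d z)))\<^sup>2"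
        by (simp add: dist u)
      also have "\<dots> = 2 * (J (u j))\<^sup>2 + 2 * (J (u k))\<^sup>2 - (L2_norm N (\<lambda>z. (V (u j) z - d z) + (V (u k) z - d z)))\<^sup>2"
        unfolding J_def by (intro L2_parallelogram L2_diff VL2 u d)
      also have "\<dots> \<le> 2 * (\<delta> + 1 / Suc n)\<^sup>2 + 2 * (\<delta> + 1 / Suc n)\<^sup>2 - (2 * \<delta>)\<^sup>2"
        using Jle[OF that(1)] Jle[OF that(2)] sum \<delta>0
        by (intro diff_mono add_mono mult_left_mono power_mono) (auto simp: J_def)
      finally show ?thesis by (simp add: power_mult_distrib)
    qed
    have small: "(\<lambda>n. \<bar>A\<bar> * sqrt (4 * ((\<delta> + 1 / Suc n)\<^sup>2 - \<delta>\<^sup>2))) \<longlonglongrightarrow> \<bar>A\<bar> * sqrt (4 * ((\<delta> + 0)\<^sup>2 - \<delta>\<^sup>2))"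
      by (intro tendsto_intros) (use LIMSEQ_inverse_real_of_nat in \<open>simp add: inverse_eq_divide\<close>)
    have "\<exists>n. \<forall>j\<ge>n. \<forall>k\<ge>n. L2_norm M (\<lambda>x. u j x - u k x) < e" if "e > 0" for e
    proof -
      from small that have "eventually (\<lambda>n. \<bar>A\<bar> * sqrt (4 * ((\<delta> + 1 / Suc n)\<^sup>2 - \<delta>\<^sup>2)) < e) sequentially"
        by (intro order_tendstoD(2)[OF small]) simp
      then obtain n where n: "\<bar>A\<bar> * sqrt (4 * ((\<delta> + 1 / Suc n)\<^sup>2 - \<delta>\<^sup>2)) < e"
        by (auto simp: eventually_sequentially)
      have "L2_norm M (\<lambda>x. u j x - u k x) < e" if "j \<ge> n" "k \<ge> n" for j k
      proof -
        have "L2_norm M (\<lambda>x. u j x - u k x) \<le> \<bar>A\<bar> * L2_norm N (V (\<lambda>x. u j x - u k x))"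
          by (intro below' L2_diff u)
        also have "\<dots> \<le> \<bar>A\<bar> * sqrt (4 * ((\<delta> + 1 / Suc n)\<^sup>2 - \<delta>\<^sup>2))"
          using close[OF that] by (intro mult_left_mono real_le_rsqrt) auto
        finally show ?thesis using n by simp
      qed
      then show ?thesis by blast
    qed
    from L2_complete[OF u(1) this] obtain f
      where f: "f \<in> L2 M" "(\<lambda>k. L2_norm M (\<lambda>x. u k x - f x)) \<longlonglongrightarrow> 0" by blast
    have "J f \<le> (\<delta> + 1 / Suc k) + C * L2_norm M (\<lambda>x. u k x - f x)" for k
    proof -
      have "J f \<le> L2_norm N (\<lambda>z. V f z - V (u k) z) + J (u k)"
        unfolding J_def by (intro L2_norm_triangle_diff VL2 u f d)
      also have "L2_norm N (\<lambda>z. V f z - V (u k) z) \<le> C * L2_norm M (\<lambda>x. u k x - f x)"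
        using bound[OF L2_diff[OF f(1) u(1)[of k]]] by (simp add: dist u f L2_norm_minus_commute[of M f])
      finally show ?thesis using u(2)[of k] by simp
    qed
    moreover have "(\<lambda>k. (\<delta> + 1 / Suc k) + C * L2_norm M (\<lambda>x. u k x - f x)) \<longlonglongrightarrow> (\<delta> + 0) + C * 0"
      by (intro tendsto_intros f) (use LIMSEQ_inverse_real_of_nat in \<open>simp add: inverse_eq_divide\<close>)
    ultimately have Jf: "J f \<le> \<delta>"
      by (intro LIMSEQ_le_const[where X = "\<lambda>k. (\<delta> + 1 / Suc k) + C * L2_norm M (\<lambda>x. u k x - f x)"]) auto
    have "L2_inner N (\<lambda>z. V f z - d z) (V g) = 0" if g: "g \<in> L2 M" for g
    proof (rule L2_norm_minimal_orthogonal)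
      fix c
      have "L2_norm N (\<lambda>z. V f z - d z) \<le> J (\<lambda>x. f x + c * g x)"
        using Jf \<delta>[OF L2_add[OF f(1) L2_scale[OF g, of c]]] unfolding J_def[of f] by linarith
      also have "\<dots> = L2_norm N (\<lambda>z. (V f z - d z) + c * V g z)"
        unfolding J_def
      proof (rule L2_norm_cong_AE)
        show "AE z in N. V (\<lambda>x. f x + c * g x) z - d z = V f z - d z + c * V g z"
          using Vadd[OF f(1) L2_scale[OF g, of c]] Vscale[OF g, of c] by eventually_elim simp
      qed (intro L2_measurable L2_add L2_diff L2_scale VL2 f g d)+
      finally show "L2_norm N (\<lambda>z. V f z - d z) \<le> \<dots>" .
    qed (intro L2_diff VL2 f g d)+
    with f show ?thesis unfolding P_def by blast
  qed
  \<comment> \<open>The image \<open>?w\<close> of the difference of two solutions lies in the range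
    and is orthogonal to it, hence vanishes; the lower bound carries this back to the
    domain.\<close>
  have uniq: "AE x in M. f x = f' x"
    if "d \<in> L2 N" "d' \<in> L2 N" "P d f" "P d' f'" "AE z in N. d z = d' z" for d d' f f'
  proof -
    have f: "f \<in> L2 M" "f' \<in> L2 M" using that by (auto simp: P_def)
    have ff: "(\<lambda>x. f x - f' x) \<in> L2 M" by (intro L2_diff f)
    let ?w = "V (\<lambda>x. f x - f' x)"
    have "AE z in N. ?w z = (V f z - d z) - (V f' z - d' z)"
      using Vdiff[OF f] that(5) by eventually_elim simp
    then have "L2_inner N ?w ?w = L2_inner N (\<lambda>z. (V f z - d z) - (V f' z - d' z)) ?w"
      by (intro L2_inner_cong_AE L2_diff VL2 f that ff)
    also have "\<dots> = L2_inner N (\<lambda>z. V f z - d z) ?w - L2_inner N (\<lambda>z. V f' z - d' z) ?w"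
      by (intro L2_inner_diff_left L2_diff VL2 f that ff)
    also have "\<dots> = 0" using that(3,4) ff by (simp add: P_def)
    finally have "L2_norm N ?w = 0" by (simp add: L2_inner_self)
    then have "L2_norm M (\<lambda>x. f x - f' x) = 0"
      using below'[OF ff] L2_norm_nonneg[of M "\<lambda>x. f x - f' x"] by simp
    then show ?thesis using L2_norm_eq_0_iff[OF ff] by simp
  qed
  have Padd: "P (\<lambda>z. d z + d' z) (\<lambda>x. f x + f' x)"
    if d: "d \<in> L2 N" "d' \<in> L2 N" "P d f" "P d' f'" for d d' f f'
  proof -
    have f: "f \<in> L2 M" "f' \<in> L2 M" using that by (auto simp: P_def)
    have "L2_inner N (\<lambda>z. V (\<lambda>x. f x + f' x) z - (d z + d' z)) (V g) = 0" if g: "g \<in> L2 M" for g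
    proof -
      have "AE z in N. V (\<lambda>x. f x + f' x) z - (d z + d' z) = (V f z - d z) + (V f' z - d' z)"
        using Vadd[OF f] by eventually_elim simp
      then have "L2_inner N (\<lambda>z. V (\<lambda>x. f x + f' x) z - (d z + d' z)) (V g)
          = L2_inner N (\<lambda>z. (V f z - d z) + (V f' z - d' z)) (V g)"
        by (intro L2_inner_cong_AE L2_diff L2_add VL2 f g d(1,2))
      also have "\<dots> = L2_inner N (\<lambda>z. V f z - d z) (V g) + L2_inner N (\<lambda>z. V f' z - d' z) (V g)"
        by (intro L2_inner_add_left L2_diff VL2 f g d(1,2))
      finally show ?thesis using d(3,4) g by (simp add: P_def)
    qed
    then show ?thesis using f by (auto simp: P_def L2_add)
  qed
  have Pscale: "P (\<lambda>z. c * d z) (\<lambda>x. c * f x)" if d: "d \<in> L2 N" "P d f" for c d f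
  proof -
    have f: "f \<in> L2 M" using that by (auto simp: P_def)
    have "L2_inner N (\<lambda>z. V (\<lambda>x. c * f x) z - c * d z) (V g) = 0" if g: "g \<in> L2 M" for g
    proof -
      have "AE z in N. V (\<lambda>x. c * f x) z - c * d z = c * (V f z - d z)"
        using Vscale[OF f, of c] by eventually_elim (simp add: algebra_simps)
      then have "L2_inner N (\<lambda>z. V (\<lambda>x. c * f x) z - c * d z) (V g) = L2_inner N (\<lambda>z. c * (V f z - d z)) (V g)"
        by (intro L2_inner_cong_AE L2_diff L2_scale VL2 f g d(1))
      then show ?thesis using d(2) g by (simp add: P_def L2_inner_scale_left)
    qed
    then show ?thesis using f by (auto simp: P_def L2_scale)
  qed

  define T where "T d = (SOME f. P d f)" for d
  have T: "P d (T d)" if "d \<in> L2 N" for d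
    unfolding T_def using ex[OF that] by (rule someI_ex)
  have T_eq: "AE x in M. T d x = f x" if "d \<in> L2 N" "P d f" for d f
    using uniq[OF that(1) that(1) T[OF that(1)] that(2)] by simp
  have TL2: "T d \<in> L2 M" if "d \<in> L2 N" for d using T[OF that] by (simp add: P_def)
  \<comment> \<open>Since the residual is orthogonal to \<open>?w\<close>, the squared norm of
    \<open>?w\<close> is the inner product of \<open>d\<close> with \<open>?w\<close>, and
    Cauchy-Schwarz makes the projection a contraction.\<close>
  have "L2_norm M (T d) \<le> \<bar>A\<bar> * L2_norm N d" if d: "d \<in> L2 N" for d
  proof -
    let ?w = "V (T d)"
    have w: "?w \<in> L2 N" by (intro VL2 TL2 d)
    have "L2_inner N ?w ?w - L2_inner N d ?w = 0"
      using T[OF d] TL2[OF d] L2_inner_diff_left[OF w d w] by (simp add: P_def)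
    then have "(L2_norm N ?w)\<^sup>2 = norm (L2_inner N d ?w)"
      unfolding L2_inner_self by (metis abs_of_nonneg eq_iff_diff_eq_0 norm_of_real zero_le_power2)
    also have "\<dots> \<le> L2_norm N d * L2_norm N ?w" by (rule L2_Cauchy_Schwarz[OF d w])
    finally have "L2_norm N ?w \<le> L2_norm N d"
      using L2_norm_nonneg[of N d] L2_norm_nonneg[of N ?w]
      by (cases "L2_norm N ?w = 0") (auto simp: power2_eq_square simp del: L2_norm_nonneg)
    then show ?thesis
      using below'[OF TL2[OF d]] mult_left_mono[of "L2_norm N ?w" "L2_norm N d" "\<bar>A\<bar>"] by simp
  qed
  then have "bounded_linear_L2 N M T"
    unfolding bounded_linear_L2_def
  proof (intro conjI ballI allI impI exI[of _ "\<bar>A\<bar>"])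
    fix d d' assume d: "d \<in> L2 N" "d' \<in> L2 N"
    show "AE z in M. T d z = T d' z" if "AE z in N. d z = d' z"
      by (rule uniq[OF d T[OF d(1)] T[OF d(2)] that])
    show "AE z in M. T (\<lambda>z. d z + d' z) z = T d z + T d' z"
      by (rule T_eq[OF L2_add[OF d] Padd[OF d T[OF d(1)] T[OF d(2)]]])
  next
    fix c d assume d: "d \<in> L2 N"
    show "AE z in M. T (\<lambda>z. c * d z) z = c * T d z"
      by (rule T_eq[OF L2_scale[OF d] Pscale[OF d T[OF d]]])
  qed (use TL2 in auto)
  \<comment> \<open>\<open>f\<close> itself solves the normal equation for \<open>V f\<close>, with
    residual zero.\<close>
  moreover have "AE x in M. T (V f) x = f x" if "f \<in> L2 M" for f
    using that by (intro T_eq VL2) (auto simp: P_def L2_inner_def)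
  ultimately show ?thesis unfolding has_bounded_left_inverse_def by blast
qed

section \<open>Fourier series on the circle\<close>

definition circ :: "int \<Rightarrow> real \<Rightarrow> complex" where
  "circ n x = cis (2 * pi * of_int n * x)"

lemma circ_0 [simp]: "circ 0 x = 1"
  by (simp add: circ_def)

lemma circ_mult: "circ m x * circ n x = circ (m + n) x"
  by (simp add: circ_def cis_mult algebra_simps)

lemma cnj_circ [simp]: "cnj (circ n x) = circ (- n) x"
  by (simp add: circ_def cis_cnj)

lemma norm_circ [simp]: "norm (circ n x) = 1"
  by (simp add: circ_def)

lemma continuous_on_circ [continuous_intros]: "continuous_on S (circ n)"
  unfolding circ_def[abs_def] by (intro continuous_intros)

lemma measurable_circ_borel [measurable]: "circ n \<in> borel_measurable borel"
  by (intro borel_measurable_continuous_onI continuous_intros)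

text \<open>The half-open interval contains no two distinct points at integer distance. Injectivity
  allows a subset of the interval to be recognised from its image on the circle.\<close>

lemma circ_inj:
  assumes "circ 1 x = circ 1 y" "x \<in> {0..<1}" "y \<in> {0..<1}"
  shows "x = y"
proof -
  have "exp (\<i> * of_real (2 * pi * x)) = exp (\<i> * of_real (2 * pi * y))"
    using assms(1) by (simp add: circ_def cis_conv_exp)
  then obtain n :: int where "\<i> * of_real (2 * pi * x) = \<i> * of_real (2 * pi * y) + of_int (2 * n) * of_real pi * \<i>"
    unfolding exp_eq by (auto simp: algebra_simps)
  then have "of_real (2 * pi * x) = (of_real (2 * pi * (y + n)) :: complex)"
    by (auto simp: algebra_simps complex_eq_iff)
  then have "x = y + of_int n" by (simp only: of_real_eq_iff) simp
  with assms(2,3) show ?thesis by auto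
qed

lemma continuous_on_cmod_bound:
  fixes g :: "complex \<Rightarrow> real"
  assumes "continuous_on (sphere 0 1) g"
  obtains B where "\<And>z. z \<in> sphere 0 1 \<Longrightarrow> \<bar>g z\<bar> \<le> B"
proof -
  have "bounded (g ` sphere 0 1)"
    using compact_imp_bounded[OF compact_continuous_image[OF assms compact_sphere]] .
  then obtain B where "\<forall>z\<in>sphere 0 1. \<bar>g z\<bar> \<le> B" by (auto simp: bounded_iff)
  then show ?thesis by (intro that[of B]) blast
qed

text \<open>The span of the characters as an inductive predicate, whose rules match the cases
  \<open>mode\<close>, \<open>add\<close> and \<open>scale\<close> of the density principle
  \<open>L2_trig_induct\<close>.\<close>

inductive trig_poly :: "(real \<Rightarrow> complex) \<Rightarrow> bool" where
  mode: "trig_poly (circ n)"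
| add: "trig_poly f \<Longrightarrow> trig_poly g \<Longrightarrow> trig_poly (\<lambda>x. f x + g x)"
| scale: "trig_poly f \<Longrightarrow> trig_poly (\<lambda>x. c * f x)"

lemma trig_poly_mult:
  assumes "trig_poly f" "trig_poly g" shows "trig_poly (\<lambda>x. f x * g x)"
  using assms(1)
proof induction
  case (mode m)
  show ?case using assms(2)
  proof induction
    case (mode n)
    then show ?case by (simp add: circ_mult trig_poly.mode)
  next
    case (add f g)
    then show ?case using trig_poly.add by (simp add: distrib_left)
  next
    case (scale f c)
    then show ?case using trig_poly.scale[of _ c] by (simp add: mult.left_commute)
  qed
next
  case (add f g)
  then show ?case using trig_poly.add by (simp add: distrib_right)
next
  case (scale f c)
  then show ?case using trig_poly.scale[of _ c] by (simp add: mult.assoc)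
qed

text \<open>Turns Stone-Weierstrass approximants into trigonometric polynomials. A real linear
  functional of \<open>circ 1 x\<close> combines a cosine and a sine, hence \<open>circ 1\<close>
  and \<open>circ (-1)\<close>; the products are handled by \<open>trig_poly_mult\<close>.\<close>

lemma trig_poly_real_polynomial:
  assumes "real_polynomial_function p"
  shows "trig_poly (\<lambda>x. of_real (p (circ 1 x)))"
  using assms
proof induction
  case (linear f)
  interpret bounded_linear f by fact
  have f: "f z = Re z * f 1 + Im z * f \<i>" for z
  proof -
    have "f (Re z *\<^sub>R 1 + Im z *\<^sub>R \<i>) = Re z * f 1 + Im z * f \<i>"
      by (simp only: add scaleR) simp
    moreover have "Re z *\<^sub>R 1 + Im z *\<^sub>R \<i> = z" by (simp add: complex_eq_iff)
    ultimately show ?thesis by simp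
  qed
  have "complex_of_real (f (circ 1 x)) = Complex (f 1 / 2) (- f \<i> / 2) * circ 1 x + Complex (f 1 / 2) (f \<i> / 2) * circ (-1) x" for x
  proof -
    have "Re (circ (-1) x) = Re (circ 1 x)" "Im (circ (-1) x) = - Im (circ 1 x)"
      by (simp_all add: circ_def)
    then show ?thesis using f[of "circ 1 x"] by (simp add: complex_eq_iff field_simps)
  qed
  then show ?case by (simp only:) (intro trig_poly.intros)
next
  case (const c)
  have "trig_poly (\<lambda>x. of_real c * circ 0 x)" by (intro trig_poly.intros)
  then show ?case by simp
next
  case (add f g)
  then show ?case by (simp add: trig_poly.add)
next
  case (mult f g)
  then show ?case by (simp add: trig_poly_mult)
qed

section \<open>Density of the trigonometric polynomials for a finite measure on the circle\<close>

lemma L2_norm_dominated_convergence: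
  assumes u: "\<And>k. u k \<in> borel_measurable M" and f: "f \<in> borel_measurable M" and g: "g \<in> L2 M"
    and lim: "AE x in M. (\<lambda>k. u k x) \<longlonglongrightarrow> f x"
    and bound: "\<And>k. AE x in M. norm (u k x) \<le> norm (g x)"
  shows "(\<lambda>k. L2_norm M (\<lambda>x. u k x - f x)) \<longlonglongrightarrow> 0"
proof -
  have [measurable]: "u k \<in> borel_measurable M" "f \<in> borel_measurable M" for k
    using u f by auto
  have f_le: "AE x in M. norm (f x) \<le> norm (g x)"
  proof -
    have "AE x in M. \<forall>k. norm (u k x) \<le> norm (g x)"
      using bound by (simp add: AE_all_countable)
    with lim show ?thesis
      by eventually_elim (rule Lim_bounded[OF tendsto_norm, where M = 0], auto)
  qed
  have "(\<lambda>k. \<integral>x. (norm (u k x - f x))\<^sup>2 \<partial>M) \<longlonglongrightarrow> (\<integral>x. 0 \<partial>M)"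
  proof (rule integral_dominated_convergence)
    show "integrable M (\<lambda>x. 4 * (norm (g x))\<^sup>2)" using g by (simp add: L2_integrable)
    show "AE x in M. (\<lambda>k. (norm (u k x - f x))\<^sup>2) \<longlonglongrightarrow> 0"
      using lim
    proof eventually_elim
      case (elim x)
      then have "(\<lambda>k. (norm (u k x - f x))\<^sup>2) \<longlonglongrightarrow> (norm (f x - f x))\<^sup>2" by (intro tendsto_intros)
      then show ?case by simp
    qed
    show "AE x in M. norm ((norm (u k x - f x))\<^sup>2) \<le> 4 * (norm (g x))\<^sup>2" for k
      using f_le bound[of k]
    proof eventually_elim
      case (elim x)
      then have "norm (u k x - f x) \<le> 2 * norm (g x)" using norm_triangle_ineq4[of "u k x" "f x"] by simp
      then have "(norm (u k x - f x))\<^sup>2 \<le> (2 * norm (g x))\<^sup>2" by (intro power_mono) auto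
      then show ?case by (simp add: power_mult_distrib)
    qed
  qed measurable
  then have "(\<lambda>k. sqrt (\<integral>x. (norm (u k x - f x))\<^sup>2 \<partial>M)) \<longlonglongrightarrow> sqrt 0"
    by (intro tendsto_real_sqrt) simp
  then show ?thesis by (simp add: L2_norm_def)
qed

text \<open>A common setting for Lebesgue measure on the interval, the slices and the
  marginal.\<close>

locale circle_measure = finite_measure M for M :: "real measure" +
  assumes sets_M [measurable_cong]: "sets M = sets unit_borel"
begin

lemma space_M: "space M = {0..<1}"
  using sets_eq_imp_space_eq[OF sets_M] by (simp add: space_restrict_space)

lemma borel_measurable_M [measurable (raw)]: "f \<in> borel_measurable borel \<Longrightarrow> f \<in> borel_measurable M"
  by (subst measurable_cong_sets[OF sets_M refl]) (rule measurable_restrict_space1)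

lemma sets_M_iff: "A \<in> sets M \<longleftrightarrow> A \<in> sets borel \<and> A \<subseteq> {0..<1}"
  unfolding sets_M by (subst sets_restrict_space_iff) auto

lemma circ_L2 [simp]: "circ n \<in> L2 M"
  by (rule L2_bounded[where B = 1]) auto

text \<open>Inner regularity of finite Borel measures, applied to the push-forward to the whole
  line; Borel sets within the interval keep their measure.\<close>

lemma inner_regular_compact:
  assumes "A \<in> sets M" "e > 0"
  obtains K where "compact K" "K \<subseteq> A" "measure M (A - K) < e"
proof -
  define M' where "M' = distr M borel (\<lambda>x. x)"
  have id: "(\<lambda>x. x) \<in> M \<rightarrow>\<^sub>M borel" by (rule borel_measurable_M) simp
  interpret M': finite_measure M'
    unfolding M'_def using id by (rule finite_measure_distr)
  have A: "A \<in> sets borel" "A \<subseteq> {0..<1}" using assms(1) by (auto simp: sets_M_iff)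
  have em: "emeasure M' B = emeasure M B" if "B \<in> sets borel" "B \<subseteq> {0..<1}" for B
    using that id by (simp add: M'_def emeasure_distr space_M Int_absorb2)
  have "measure M A - e < measure M A" using assms(2) by simp
  have "\<exists>K. compact K \<and> K \<subseteq> A \<and> measure M A < measure M K + e"
  \<comment> \<open>If \<open>A\<close> has measure below \<open>e\<close>, the empty set serves;
    otherwise \<open>measure M A - e\<close> is nonnegative and \<open>ennreal\<close> represents it
    faithfully.\<close>
  proof (cases "measure M A < e")
    case True
    then show ?thesis by (intro exI[of _ "{}"]) auto
  next
    case False
    have "ennreal (measure M A - e) < emeasure M' A"
      unfolding em[OF A] emeasure_eq_measure using assms(2) False by (simp add: ennreal_less_iff)
    also have "emeasure M' A = (SUP K\<in>{K. K \<subseteq> A \<and> compact K}. emeasure M' K)"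
      using A(1) M'.emeasure_finite by (intro inner_regular) (auto simp: M'_def)
    finally obtain K where K: "K \<subseteq> A" "compact K" "ennreal (measure M A - e) < emeasure M' K"
      by (auto simp: less_SUP_iff)
    then have "emeasure M' K = emeasure M K" using A by (intro em) (auto simp: borel_compact)
    with K False have "measure M A - e < measure M K"
      by (simp add: emeasure_eq_measure ennreal_less_iff)
    with K show ?thesis by auto
  qed
  then obtain K where K: "compact K" "K \<subseteq> A" "measure M A < measure M K + e" by blast
  then have "K \<in> sets M" using A by (auto simp: sets_M_iff borel_compact)
  then have "measure M (A - K) < e"
    using K assms(1) by (subst finite_measure_Diff) auto
  with K show ?thesis using that by blast
qed

text \<open>Density as an induction principle, since the properties it serves are closed under
  linear combinations and norm limits. They pass from trigonometric polynomials to continuous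
  functions on the circle by Stone-Weierstrass, to indicators of compact sets by cutoffs, to
  indicators of measurable sets by inner regularity, and on to simple functions and their
  limits.\<close>

theorem L2_trig_induct [consumes 1, case_names mode add scale lim]:
  assumes f: "f \<in> L2 M"
    and mode: "\<And>n. Q (circ n)"
    and add: "\<And>f g. f \<in> L2 M \<Longrightarrow> g \<in> L2 M \<Longrightarrow> Q f \<Longrightarrow> Q g \<Longrightarrow> Q (\<lambda>x. f x + g x)"
    and scale: "\<And>f c. f \<in> L2 M \<Longrightarrow> Q f \<Longrightarrow> Q (\<lambda>x. c * f x)"
    and lim: "\<And>u f. (\<And>k :: nat. u k \<in> L2 M) \<Longrightarrow> (\<And>k. Q (u k)) \<Longrightarrow> f \<in> L2 M \<Longrightarrow>
      (\<lambda>k. L2_norm M (\<lambda>x. u k x - f x)) \<longlonglongrightarrow> 0 \<Longrightarrow> Q f"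
  shows "Q f"
proof -
  \<comment> \<open>Recasts the hypothesis on norm limits for bounded pointwise limits, the form in
    which both the polynomials and the cutoffs below arrive.\<close>
  have lim_bdd: "Q f" if u: "\<And>k. u k \<in> borel_measurable M" "\<And>k x. x \<in> space M \<Longrightarrow> norm (u k x) \<le> B" "\<And>k. Q (u k)"
    and f: "f \<in> L2 M" "\<And>x. x \<in> space M \<Longrightarrow> (\<lambda>k. u k x) \<longlonglongrightarrow> f x" for u :: "nat \<Rightarrow> real \<Rightarrow> complex" and f B
  proof (rule lim)
    have B: "(\<lambda>_. of_real B) \<in> L2 M" by (rule L2_bounded[where B = "\<bar>B\<bar>"]) auto
    have B_le: "norm (u k x) \<le> norm (complex_of_real B)" if "x \<in> space M" for k x
      using u(2)[OF that, of k] by simp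
    show "u k \<in> L2 M" for k by (rule L2_dominated[OF B u(1)]) (use B_le in auto)
    show "(\<lambda>k. L2_norm M (\<lambda>x. u k x - f x)) \<longlonglongrightarrow> 0"
      by (rule L2_norm_dominated_convergence[OF u(1) L2_measurable[OF f(1)] B]) (use f(2) B_le in auto)
  qed fact+

  have trig: "f \<in> L2 M \<and> Q f" if "trig_poly f" for f
    using that by induction (auto intro: mode add scale L2_add L2_scale)

  have cont: "Q (\<lambda>x. of_real (g (circ 1 x)))" if g: "continuous_on (sphere 0 1) g"
    and gm: "(\<lambda>x. complex_of_real (g (circ 1 x))) \<in> borel_measurable M" for g :: "complex \<Rightarrow> real"
  proof -
    obtain B where B: "\<And>z. z \<in> sphere 0 1 \<Longrightarrow> \<bar>g z\<bar> \<le> B" using continuous_on_cmod_bound[OF g] by blast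
    have "\<exists>p. real_polynomial_function p \<and> (\<forall>z\<in>sphere 0 1. \<bar>g z - p z\<bar> < 1 / Suc k)" for k :: nat
      by (rule Stone_Weierstrass_real_polynomial_function[OF compact_sphere g, of "1 / Suc k"]) auto
    then obtain p where p: "\<And>k. real_polynomial_function (p k)" "\<And>k z. z \<in> sphere 0 1 \<Longrightarrow> \<bar>g z - p k z\<bar> < 1 / Suc k"
      by metis
    have c: "circ 1 x \<in> sphere 0 1" for x by simp
    show ?thesis
    proof (rule lim_bdd[where u = "\<lambda>k x. of_real (p k (circ 1 x))" and B = "B + 1"])
      fix k x
      have "1 / real (Suc k) \<le> 1" by simp
      then show "norm (complex_of_real (p k (circ 1 x))) \<le> B + 1"
        using B[OF c[of x]] p(2)[OF c[of x], of k] unfolding norm_of_real by linarith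
    next
      fix x
      have "(\<lambda>k. p k (circ 1 x)) \<longlonglongrightarrow> g (circ 1 x)"
      proof (rule LIM_zero_cancel, rule Lim_null_comparison)
        show "eventually (\<lambda>k. norm (p k (circ 1 x) - g (circ 1 x)) \<le> 1 / Suc k) sequentially"
          using p(2)[OF c[of x]] by (intro always_eventually) (auto simp: abs_minus_commute intro: less_imp_le)
        show "(\<lambda>k. 1 / real (Suc k)) \<longlonglongrightarrow> 0"
          using LIMSEQ_inverse_real_of_nat by (simp add: inverse_eq_divide)
      qed
      then show "(\<lambda>k. complex_of_real (p k (circ 1 x))) \<longlonglongrightarrow> of_real (g (circ 1 x))"
        by (rule tendsto_of_real)
    next
      show "(\<lambda>x. complex_of_real (g (circ 1 x))) \<in> L2 M"
        by (rule L2_bounded[OF gm, where B = B]) (use B[OF c] in auto)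
    qed (use trig trig_poly_real_polynomial[OF p(1)] L2_measurable in blast)+
  qed

  have ind_L2: "(\<lambda>x. indicator A x) \<in> L2 M" if "A \<in> sets M" for A
    by (rule L2_bounded[where B = 1]) (use that in \<open>auto simp: indicator_def[abs_def] of_bool_def\<close>)

  have compact: "Q (\<lambda>x. indicator K x)" if K: "compact K" "K \<subseteq> {0..<1}" for K
  proof (cases "K = {}")
    case True
    then show ?thesis using scale[OF circ_L2 mode, of 0 0] by simp
  next
    case False
    define E where "E = circ 1 ` K"
    have E: "closed E" "E \<noteq> {}"
      using False compact_continuous_image[OF continuous_on_circ K(1)] by (auto simp: E_def compact_imp_closed)
    have KE: "x \<in> K \<longleftrightarrow> circ 1 x \<in> E" if "x \<in> space M" for x
      using that K(2) circ_inj unfolding E_def space_M by blast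
    \<comment> \<open>A cutoff equal to 1 on \<open>E\<close> and, for positive \<open>k\<close>,
      zero at distance 1/k and beyond; since \<open>E\<close> is closed, it tends pointwise to the
      indicator of \<open>E\<close>.\<close>
    define g where "g k z = max 0 (1 - real k * infdist z E)" for k z
    have gc: "continuous_on S (g k)" for S k unfolding g_def[abs_def] by (intro continuous_intros)
    have gb: "\<bar>g k z\<bar> \<le> 1" for k z using infdist_nonneg[of z E] by (auto simp: g_def)
    have gm: "(\<lambda>x. complex_of_real (g k (circ 1 x))) \<in> borel_measurable M" for k
      by (intro borel_measurable_M borel_measurable_continuous_onI continuous_intros
          continuous_on_compose2[OF gc[of UNIV]]) auto
    show ?thesis
    proof (rule lim_bdd[where u = "\<lambda>k x. of_real (g k (circ 1 x))" and B = 1])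
      show "Q (\<lambda>x. complex_of_real (g k (circ 1 x)))" for k by (rule cont[OF gc gm])
      show "(\<lambda>x. indicator K x) \<in> L2 M" using K by (intro ind_L2) (auto simp: sets_M_iff borel_compact)
    next
      fix x assume x: "x \<in> space M"
      have "(\<lambda>k. g k (circ 1 x)) \<longlonglongrightarrow> indicator K x"
      proof (cases "x \<in> K")
        case True
        then have "g k (circ 1 x) = 1" for k using KE[OF x] by (simp add: g_def)
        with True show ?thesis by simp
      next
        case False
        then have pos: "infdist (circ 1 x) E > 0"
          using KE[OF x] E infdist_pos_not_in_closed by blast
        obtain N :: nat where N: "real N * infdist (circ 1 x) E > 1"
          using reals_Archimedean3[OF pos] by blast
        have "g k (circ 1 x) = 0" if "k \<ge> N" for k
        proof -
          have "real N * infdist (circ 1 x) E \<le> real k * infdist (circ 1 x) E"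
            using that pos by (intro mult_right_mono) auto
          with N show ?thesis by (simp add: g_def)
        qed
        then have "(\<lambda>k. g k (circ 1 x)) \<longlonglongrightarrow> 0"
          by (intro tendsto_eventually eventually_sequentiallyI[of N])
        with False show ?thesis by simp
      qed
      from tendsto_of_real[OF this, where 'a = complex]
      show "(\<lambda>k. complex_of_real (g k (circ 1 x))) \<longlonglongrightarrow> indicator K x"
        by (simp add: indicator_def of_bool_def split: if_splits)
    qed (use gb gm in auto)
  qed

  have ind: "Q (\<lambda>x. indicator A x)" if A: "A \<in> sets M" for A
  proof -
    have "\<exists>K. compact K \<and> K \<subseteq> A \<and> measure M (A - K) < inverse (real (Suc k))" for k
      by (rule inner_regular_compact[OF A, of "inverse (real (Suc k))"]) auto
    then obtain K where K: "\<And>k. compact (K k)" "\<And>k. K k \<subseteq> A" "\<And>k. measure M (A - K k) < inverse (real (Suc k))"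
      by metis
    have KM: "K k \<in> sets M" for k using K(1,2)[of k] A by (auto simp: sets_M_iff borel_compact)
    show ?thesis
    proof (rule lim[where u = "\<lambda>k x. indicator (K k) x"])
      show "Q (\<lambda>x. indicator (K k) x)" for k
        using K(1,2)[of k] A by (intro compact) (auto simp: sets_M_iff)
      have "L2_norm M (\<lambda>x. indicator (K k) x - indicator A x) = sqrt (measure M (A - K k))" for k
      proof -
        have "(norm (indicator (K k) x - indicator A x :: complex))\<^sup>2 = indicator (A - K k) x" for x
          using K(2)[of k] by (auto simp: indicator_def)
        then show ?thesis
          unfolding L2_norm_def using A KM by (simp add: measure_restrict_space sets.Int_space_eq1)
      qed
      moreover have "(\<lambda>k. sqrt (measure M (A - K k))) \<longlonglongrightarrow> sqrt 0"
      proof (rule tendsto_real_sqrt, rule tendsto_sandwich[OF _ _ tendsto_const LIMSEQ_inverse_real_of_nat])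
      qed (use K(3) in \<open>auto intro!: always_eventually less_imp_le\<close>)
      ultimately show "(\<lambda>k. L2_norm M (\<lambda>x. indicator (K k) x - indicator A x)) \<longlonglongrightarrow> 0" by simp
    qed (use ind_L2 A KM in auto)
  qed

  have sums: "Q (\<lambda>x. \<Sum>i\<in>I. c i * indicator (A i) x)"
    if "finite I" "\<And>i. i \<in> I \<Longrightarrow> A i \<in> sets M" for c :: "complex \<Rightarrow> complex" and A I
    using that
  proof (induction I)
    case empty
    then show ?case using scale[OF circ_L2 mode, of 0 0] by simp
  next
    case (insert i I)
    then have "Q (\<lambda>x. c i * indicator (A i) x + (\<Sum>i\<in>I. c i * indicator (A i) x))"
      by (intro add L2_scale L2_sum ind_L2 scale ind) auto
    then show ?case unfolding sum.insert[OF insert(1,2)] .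
  qed

  have fm: "f \<in> borel_measurable M" using f by (rule L2_measurable)
  obtain F where F: "\<And>i :: nat. simple_function M (F i)" "\<And>x. x \<in> space M \<Longrightarrow> (\<lambda>i. F i x) \<longlonglongrightarrow> f x"
    "\<And>i x. x \<in> space M \<Longrightarrow> norm (F i x) \<le> 2 * norm (f x)"
    using borel_measurable_implies_sequence_metric[OF fm, of 0] by (simp add: dist_norm) blast
  define u where "u i x = (\<Sum>y\<in>F i ` space M. y * indicator (F i -` {y} \<inter> space M) x)" for i x
  have uF: "u i x = F i x" if "x \<in> space M" for i x
  proof -
    have "u i x = (\<Sum>y\<in>F i ` space M. if y = F i x then y else 0)"
      unfolding u_def using that by (intro sum.cong) (auto simp: indicator_def)
    then show ?thesis using that simple_functionD(1)[OF F(1)[of i]] by (simp add: sum.delta)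
  qed
  have Qu: "Q (u i)" for i
    unfolding u_def[abs_def] using simple_functionD[OF F(1)] by (intro sums) auto
  have um: "u i \<in> borel_measurable M" for i
    using borel_measurable_simple_function[OF F(1)[of i]] uF by (simp cong: measurable_cong)
  have g: "(\<lambda>x. 2 * f x) \<in> L2 M" by (rule L2_scale[OF f])
  show ?thesis
  proof (rule lim[OF _ Qu f])
    show "u k \<in> L2 M" for k
      by (rule L2_dominated[OF g um]) (use uF F(3) in \<open>auto simp: norm_mult\<close>)
    show "(\<lambda>k. L2_norm M (\<lambda>x. u k x - f x)) \<longlonglongrightarrow> 0"
      by (rule L2_norm_dominated_convergence[OF um fm g]) (use uF F(2,3) in \<open>auto simp: norm_mult\<close>)
  qed
qed

end

section \<open>Fourier series with respect to Lebesgue measure\<close>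

interpretation lebesgue: circle_measure unit_lebesgue
proof (intro circle_measure.intro finite_measureI circle_measure_axioms.intro)
  show "emeasure unit_lebesgue (space unit_lebesgue) \<noteq> \<infinity>"
    by (simp add: emeasure_restrict_space space_restrict_space)
  show "sets unit_lebesgue = sets unit_borel"
    by (simp add: sets_restrict_space)
qed

lemma integral_circ: "(\<integral>x. circ k x \<partial>unit_lebesgue) = of_bool (k = 0)"
proof -
  \<comment> \<open>The fundamental theorem of calculus is applied on the closed interval; the added
    endpoint is a null set.\<close>
  have AE: "AE x in lborel. indicator {0..<1} x *\<^sub>R circ k x = indicator {0..1} x *\<^sub>R circ k x"
    using AE_lborel_singleton[of 1] by eventually_elim (auto simp: indicator_def)
  have "(\<integral>x. circ k x \<partial>unit_lebesgue) = (\<integral>x. indicator {0..<1} x *\<^sub>R circ k x \<partial>lborel)"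
    by (subst integral_restrict_space) auto
  also have "\<dots> = (\<integral>x. indicator {0..1} x *\<^sub>R circ k x \<partial>lborel)"
    by (intro integral_cong_AE AE) measurable
  also have "\<dots> = of_bool (k = 0)"
  proof (cases "k = 0")
    case True
    then show ?thesis by (simp add: scaleR_conv_of_real flip: integral_complex_of_real)
  next
    case False
    define c where "c = 2 * of_real pi * \<i> * of_int k"
    have c: "c \<noteq> 0" using False by (simp add: c_def)
    have circ: "circ k x = exp (c * of_real x)" for x
      by (simp add: circ_def cis_conv_exp c_def mult_ac)
    have "(\<integral>x. indicator {0..1} x *\<^sub>R circ k x \<partial>lborel) = exp (c * of_real 1) / c - exp (c * of_real 0) / c"
    proof (rule integral_FTC_atLeastAtMost)
      fix x :: real
      have "((\<lambda>z. exp (c * z) / c) has_field_derivative exp (c * of_real x)) (at (of_real x))"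
        using c by (auto intro!: derivative_eq_intros)
      from has_vector_derivative_real_field[OF this]
      show "((\<lambda>x. exp (c * of_real x) / c) has_vector_derivative circ k x) (at x within {0..1})"
        by (simp add: circ)
    qed (auto intro: continuous_intros)
    also have "exp (c * of_real 1) = 1"
      unfolding circ[symmetric] by (simp add: circ_def cis_multiple_2pi[of "of_int k", simplified])
    finally show ?thesis using False by simp
  qed
  finally show ?thesis .
qed

lemma circ_orthonormal: "L2_inner unit_lebesgue (circ m) (circ n) = of_bool (m = n)"
  by (simp add: L2_inner_def circ_mult integral_circ)

definition fourier_coeff :: "(real \<Rightarrow> complex) \<Rightarrow> int \<Rightarrow> complex" where
  "fourier_coeff g n = L2_inner unit_lebesgue g (circ n)"

text \<open>Kept general in \<open>a\<close>: for \<open>g = 0\<close> it gives the norm of a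
  trigonometric sum, and for \<open>a\<close> the Fourier coefficients of \<open>g\<close> the
  identity behind Bessel's inequality.\<close>

lemma L2_norm_diff_trig_sum:
  assumes g: "g \<in> L2 unit_lebesgue" and A: "finite A"
  shows "(L2_norm unit_lebesgue (\<lambda>x. g x - (\<Sum>n\<in>A. a n * circ n x)))\<^sup>2
    = (L2_norm unit_lebesgue g)\<^sup>2 - 2 * Re (\<Sum>n\<in>A. cnj (a n) * fourier_coeff g n) + (\<Sum>n\<in>A. (norm (a n))\<^sup>2)"
proof -
  let ?S = "\<lambda>x. \<Sum>n\<in>A. a n * circ n x"
  have S: "?S \<in> L2 unit_lebesgue" by (intro L2_sum L2_scale) simp
  have inner: "L2_inner unit_lebesgue f ?S = (\<Sum>n\<in>A. cnj (a n) * fourier_coeff f n)" if f: "f \<in> L2 unit_lebesgue" for f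
  proof -
    have "L2_inner unit_lebesgue f ?S = cnj (\<Sum>n\<in>A. L2_inner unit_lebesgue (\<lambda>x. a n * circ n x) f)"
      unfolding L2_inner_commute[of _ f ?S]
      by (subst L2_inner_sum_left) (auto intro: L2_scale f)
    then show ?thesis
      by (simp add: L2_inner_scale_left fourier_coeff_def L2_inner_commute[of _ f "circ _"])
  qed
  have "fourier_coeff ?S n = a n" if "n \<in> A" for n
    unfolding fourier_coeff_def
    by (subst L2_inner_sum_left) (use A that in \<open>auto intro: L2_scale simp: L2_inner_scale_left circ_orthonormal\<close>)
  then have "L2_inner unit_lebesgue ?S ?S = (\<Sum>n\<in>A. cnj (a n) * a n)"
    using inner[OF S] by simp
  also have "\<dots> = of_real (\<Sum>n\<in>A. (norm (a n))\<^sup>2)"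
    by (simp add: complex_norm_square mult.commute del: of_real_power)
  finally have "(L2_norm unit_lebesgue ?S)\<^sup>2 = (\<Sum>n\<in>A. (norm (a n))\<^sup>2)"
    unfolding L2_inner_self of_real_eq_iff .
  then show ?thesis
    unfolding L2_norm_diff_sq[OF g S] inner[OF g] by simp
qed

lemma L2_norm_trig_sum:
  assumes "finite A"
  shows "(L2_norm unit_lebesgue (\<lambda>x. \<Sum>n\<in>A. a n * circ n x))\<^sup>2 = (\<Sum>n\<in>A. (norm (a n))\<^sup>2)"
  using L2_norm_diff_trig_sum[OF L2_zero assms, of a]
  by (simp add: L2_norm_uminus fourier_coeff_def L2_inner_def)

lemma fourier_remainder:
  assumes "g \<in> L2 unit_lebesgue" "finite A"
  shows "(L2_norm unit_lebesgue (\<lambda>x. g x - (\<Sum>n\<in>A. fourier_coeff g n * circ n x)))\<^sup>2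
    = (L2_norm unit_lebesgue g)\<^sup>2 - (\<Sum>n\<in>A. (norm (fourier_coeff g n))\<^sup>2)"
  unfolding L2_norm_diff_trig_sum[OF assms]
  by (simp add: cmod_power2 flip: power2_eq_square sum_distrib_left)

text \<open>By density: the remainder of \<open>circ n\<close> is zero as soon as \<open>A\<close>
  contains \<open>n\<close>, and taking the remainder never increases the norm, uniformly in
  \<open>A\<close>, so norm limits are harmless. Convergence along finite subsets serves both the
  bi-infinite sums and Parseval's identity.\<close>

theorem fourier_L2_convergence:
  assumes "g \<in> L2 unit_lebesgue"
  shows "((\<lambda>A. L2_norm unit_lebesgue (\<lambda>x. g x - (\<Sum>n\<in>A. fourier_coeff g n * circ n x))) \<longlongrightarrow> 0)
    (finite_subsets_at_top UNIV)"
  using assms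
proof (induction rule: lebesgue.L2_trig_induct)
  case (mode n)
  have "L2_norm unit_lebesgue (\<lambda>x. circ n x - (\<Sum>m\<in>A. fourier_coeff (circ n) m * circ m x)) = 0"
    if "finite A" "n \<in> A" for A
  proof -
    have "(\<Sum>m\<in>A. fourier_coeff (circ n) m * circ m x) = circ n x" for x
      using that by (simp add: fourier_coeff_def circ_orthonormal of_bool_def if_distrib[of "\<lambda>c. c * _"] cong: if_cong)
    then show ?thesis by simp
  qed
  then show ?case
    by (intro tendsto_eventually) (auto simp: eventually_finite_subsets_at_top intro!: exI[of _ "{n}"])
next
  case (add f g)
  have eq: "(\<lambda>x. f x + g x - (\<Sum>n\<in>A. fourier_coeff (\<lambda>x. f x + g x) n * circ n x))
    = (\<lambda>x. (f x - (\<Sum>n\<in>A. fourier_coeff f n * circ n x)) + (g x - (\<Sum>n\<in>A. fourier_coeff g n * circ n x)))" for A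
    using add by (simp add: fourier_coeff_def L2_inner_add_left sum.distrib algebra_simps fun_eq_iff)
  show ?case unfolding eq
    by (rule Lim_null_comparison[OF _ tendsto_add_zero[OF add(3,4)]])
      (use add in \<open>auto intro!: always_eventually L2_norm_triangle L2_diff L2_sum L2_scale\<close>)
next
  case (scale f c)
  have eq: "(\<lambda>x. c * f x - (\<Sum>n\<in>A. fourier_coeff (\<lambda>x. c * f x) n * circ n x))
    = (\<lambda>x. c * (f x - (\<Sum>n\<in>A. fourier_coeff f n * circ n x)))" for A
    by (simp add: fourier_coeff_def L2_inner_scale_left algebra_simps sum_distrib_left fun_eq_iff)
  show ?case unfolding eq L2_norm_scale using tendsto_mult_left[OF scale(2), of "norm c"] by simp
next
  case (lim u f)
  let ?R = "\<lambda>h A. L2_norm unit_lebesgue (\<lambda>x. h x - (\<Sum>n\<in>A. fourier_coeff h n * circ n x))"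
  have R: "?R h A \<le> L2_norm unit_lebesgue h" if "h \<in> L2 unit_lebesgue" "finite A" for h A
    by (rule power2_le_imp_le) (auto simp: fourier_remainder[OF that] intro: sum_nonneg)
  have le: "?R f A \<le> L2_norm unit_lebesgue (\<lambda>x. u k x - f x) + ?R (u k) A" if "finite A" for k A
  proof -
    have eq: "(\<lambda>x. f x - (\<Sum>n\<in>A. fourier_coeff f n * circ n x)) =
      (\<lambda>x. ((f x - u k x) - (\<Sum>n\<in>A. fourier_coeff (\<lambda>x. f x - u k x) n * circ n x))
        + (u k x - (\<Sum>n\<in>A. fourier_coeff (u k) n * circ n x)))"
      using lim by (simp add: fourier_coeff_def L2_inner_diff_left sum_subtractf algebra_simps fun_eq_iff)
    have "?R f A \<le> ?R (\<lambda>x. f x - u k x) A + ?R (u k) A"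
      unfolding eq by (intro L2_norm_triangle L2_diff L2_sum L2_scale lim) simp_all
    also have "?R (\<lambda>x. f x - u k x) A \<le> L2_norm unit_lebesgue (\<lambda>x. u k x - f x)"
      using R[OF L2_diff[OF lim.hyps(2) lim.hyps(1)[of k]] that] by (simp add: L2_norm_minus_commute[of _ f])
    finally show ?thesis by simp
  qed
  show ?case
  proof (rule tendstoI)
    fix e :: real assume "e > 0"
    then obtain k where k: "L2_norm unit_lebesgue (\<lambda>x. u k x - f x) < e / 2"
      using order_tendstoD(2)[OF lim.hyps(3), of "e / 2"] by (auto simp: eventually_sequentially)
    have "eventually (\<lambda>A. ?R (u k) A < e / 2) (finite_subsets_at_top UNIV)"
      using order_tendstoD(2)[OF lim.IH, of "e / 2"] \<open>e > 0\<close> by simp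
    moreover have "eventually finite (finite_subsets_at_top (UNIV :: int set))"
      by (rule eventually_finite_subsets_at_top_weakI)
    ultimately show "eventually (\<lambda>A. dist (?R f A) 0 < e) (finite_subsets_at_top UNIV)"
    proof eventually_elim
      case (elim A)
      with le[of A k] k have "?R f A < e" by linarith
      then show ?case by (simp add: dist_norm)
    qed
  qed
qed

text \<open>Carries convergence along finite subsets over to intervals whose two ends grow
  independently.\<close>

lemma filterlim_int_intervals:
  "filterlim (\<lambda>(p, q). {- int p..int q}) (finite_subsets_at_top UNIV) (sequentially \<times>\<^sub>F sequentially)"
  unfolding filterlim_iff
proof (intro allI impI)
  fix P :: "int set \<Rightarrow> bool" assume "eventually P (finite_subsets_at_top UNIV)"
  then obtain X where X: "finite X" "\<And>Y. finite Y \<Longrightarrow> X \<subseteq> Y \<Longrightarrow> P Y"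
    by (auto simp: eventually_finite_subsets_at_top)
  define N where "N = nat (Max (insert 0 (abs ` X)))"
  have N: "\<bar>x\<bar> \<le> int N" if "x \<in> X" for x
  proof -
    have "\<bar>x\<bar> \<le> Max (insert 0 (abs ` X))" using that X(1) by (intro Max_ge) auto
    then show ?thesis unfolding N_def using abs_ge_zero[of x] by linarith
  qed
  have "eventually (\<lambda>(p, q). p \<ge> N \<and> q \<ge> N) (sequentially \<times>\<^sub>F sequentially)"
    by (subst eventually_prod_sequentially) auto
  then show "eventually (\<lambda>z. P (case z of (p, q) \<Rightarrow> {- int p..int q})) (sequentially \<times>\<^sub>F sequentially)"
  proof eventually_elim
    case (elim z)
    obtain p q where z: "z = (p, q)" by (cases z)
    have "X \<subseteq> {- int p..int q}"
    proof
      fix x assume "x \<in> X"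
      from N[OF this] elim show "x \<in> {- int p..int q}" by (simp add: z abs_le_iff)
    qed
    then show ?case by (simp add: z X(2))
  qed
qed

theorem fourier_bisum_convergence:
  assumes "g \<in> L2 unit_lebesgue"
  shows "((\<lambda>(p, q). L2_norm unit_lebesgue (\<lambda>x. g x - (\<Sum>m = - int p..int q. fourier_coeff g m * circ m x))) \<longlongrightarrow> 0)
    (sequentially \<times>\<^sub>F sequentially)"
  using filterlim_compose[OF fourier_L2_convergence[OF assms] filterlim_int_intervals]
  by (simp add: case_prod_unfold)

text \<open>The limit of \<open>fourier_remainder\<close> along finite subsets. Nonnegative
  integrals are used so that the identity can later be summed over a further index without
  summability conditions.\<close>

theorem fourier_Parseval:
  assumes g: "g \<in> L2 unit_lebesgue"
  shows "(\<integral>\<^sup>+n. ennreal ((norm (fourier_coeff g n))\<^sup>2) \<partial>count_space UNIV)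
    = (\<integral>\<^sup>+x. ennreal ((norm (g x))\<^sup>2) \<partial>unit_lebesgue)"
proof -
  let ?c = "\<lambda>n. (norm (fourier_coeff g n))\<^sup>2"
  have ev: "eventually finite (finite_subsets_at_top (UNIV :: int set))"
    by (rule eventually_finite_subsets_at_top_weakI)
  have "((\<lambda>A. (L2_norm unit_lebesgue g)\<^sup>2 - (L2_norm unit_lebesgue (\<lambda>x. g x - (\<Sum>n\<in>A. fourier_coeff g n * circ n x)))\<^sup>2)
    \<longlongrightarrow> (L2_norm unit_lebesgue g)\<^sup>2 - 0\<^sup>2) (finite_subsets_at_top UNIV)"
    by (intro tendsto_intros fourier_L2_convergence g)
  then have hs: "(?c has_sum (L2_norm unit_lebesgue g)\<^sup>2) UNIV"
    unfolding has_sum_def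
    unfolding power_zero_numeral diff_zero
    by (rule Lim_transform_eventually) (use ev in eventually_elim, auto simp: fourier_remainder[OF g])
  then have "?c summable_on UNIV" by (auto simp: summable_on_def)
  then have "Infinite_Sum.abs_summable_on ?c UNIV" by simp
  then have s: "Infinite_Set_Sum.abs_summable_on ?c UNIV" by (simp only: abs_summable_equivalent)
  have "(\<integral>n. ?c n \<partial>count_space UNIV) = (L2_norm unit_lebesgue g)\<^sup>2"
    using infsetsum_infsum[OF s] infsumI[OF hs] by (simp add: infsetsum_def)
  moreover have "integrable (count_space UNIV) ?c"
    using s by (simp add: Infinite_Set_Sum.abs_summable_on_def)
  ultimately show ?thesis
    unfolding L2_nn_integral[OF g] by (subst nn_integral_eq_integral) auto
qed

section \<open>The Kaczmarz algorithm for a singular measure\<close>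

text \<open>
  For unit vectors \<open>e\<^sub>n\<close> whose Gram matrix \<open>\<langle>e\<^sub>i, e\<^sub>n\<rangle> = b (n - i)\<close> is Toeplitz and \<open>a n = \<langle>f, e\<^sub>n\<rangle>\<close>, the recursion
  reads \<open>c\<^sub>n = \<langle>f - \<Sum>\<^sub>i\<^sub><\<^sub>n c\<^sub>i e\<^sub>i, e\<^sub>n\<rangle>\<close>.
\<close>

fun kaczmarz :: "(nat \<Rightarrow> complex) \<Rightarrow> (nat \<Rightarrow> complex) \<Rightarrow> nat \<Rightarrow> complex" where
  "kaczmarz a b n = a n - (\<Sum>i<n. kaczmarz a b i * b (n - i))"

declare kaczmarz.simps [simp del]

lemma kaczmarz_add: "kaczmarz (\<lambda>n. a n + a' n) b n = kaczmarz a b n + kaczmarz a' b n"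
proof (induction n rule: less_induct)
  case (less n)
  then show ?case
    by (subst (1 2 3) kaczmarz.simps) (simp add: sum.distrib distrib_right algebra_simps)
qed

lemma kaczmarz_scale: "kaczmarz (\<lambda>n. c * a n) b n = c * kaczmarz a b n"
proof (induction n rule: less_induct)
  case (less n)
  then show ?case
    by (subst (1 2) kaczmarz.simps) (simp add: sum_distrib_left algebra_simps)
qed

text \<open>After the first step a problem of the same kind remains, with the data of f - a_0 e_0
  read from index one on; the Toeplitz form leaves \<open>b\<close> unchanged under this
  shift.\<close>

lemma kaczmarz_Suc:
  "kaczmarz a b (Suc n) = kaczmarz (\<lambda>n. a (Suc n) - a 0 * b (Suc n)) b n"
proof (induction n rule: less_induct)
  case (less n)
  have a0: "kaczmarz a b 0 = a 0" by (subst kaczmarz.simps) simp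
  show ?case
    using less by (subst (1 2) kaczmarz.simps) (simp add: sum.lessThan_Suc_shift a0 del: sum.lessThan_Suc)
qed

text \<open>The Gram entries \<open>b\<close> of the recursion: the inner product of e_i and e_n is
  the moment of index \<open>n - i\<close> for i \<le> n. The sign comes from conjugating the second
  argument.\<close>

definition moment :: "real measure \<Rightarrow> nat \<Rightarrow> complex" where
  "moment M n = (\<integral>x. circ (- int n) x \<partial>M)"

definition kcoeff :: "real measure \<Rightarrow> (real \<Rightarrow> complex) \<Rightarrow> nat \<Rightarrow> complex" where
  "kcoeff M f = kaczmarz (\<lambda>n. L2_inner M f (circ (int n))) (moment M)"

definition kremainder :: "real measure \<Rightarrow> (real \<Rightarrow> complex) \<Rightarrow> nat \<Rightarrow> real \<Rightarrow> complex" where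
  "kremainder M f N x = f x - (\<Sum>n<N. kcoeff M f n * circ (int n) x)"

lemma kremainder_Suc: "kremainder M f (Suc N) x = kremainder M f N x - kcoeff M f N * circ (int N) x"
  by (simp add: kremainder_def)

lemma kremainder_0 [simp]: "kremainder M f 0 = f"
  by (simp add: kremainder_def fun_eq_iff)

section \<open>Kaczmarz remainders for a probability measure on the circle\<close>

locale circle_prob = circle_measure M + prob_space M for M
begin

lemma circ_norm: "L2_norm M (circ n) = 1"
  by (simp add: L2_norm_def prob_space)

lemma circ_integrable [simp]: "integrable M (circ n)"
  using L2_integrable_mult_cnj[OF circ_L2[of n] circ_L2[of 0]] by simp

lemma moment_0: "moment M 0 = 1"
  by (simp add: moment_def prob_space)

lemma inner_circ: "L2_inner M (circ i) (circ j) = (\<integral>x. circ (i - j) x \<partial>M)"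
  by (simp add: L2_inner_def circ_mult)

lemma kcoeff_add:
  "f \<in> L2 M \<Longrightarrow> g \<in> L2 M \<Longrightarrow> kcoeff M (\<lambda>x. f x + g x) n = kcoeff M f n + kcoeff M g n"
  by (simp add: kcoeff_def L2_inner_add_left kaczmarz_add)

lemma kcoeff_scale: "kcoeff M (\<lambda>x. c * f x) n = c * kcoeff M f n"
  by (simp add: kcoeff_def L2_inner_scale_left kaczmarz_scale)

lemma kremainder_add:
  "f \<in> L2 M \<Longrightarrow> g \<in> L2 M \<Longrightarrow> kremainder M (\<lambda>x. f x + g x) N x = kremainder M f N x + kremainder M g N x"
  by (simp add: kremainder_def kcoeff_add sum.distrib algebra_simps)

lemma kremainder_scale: "kremainder M (\<lambda>x. c * f x) N x = c * kremainder M f N x"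
  by (simp add: kremainder_def kcoeff_scale sum_distrib_left algebra_simps)

lemma kremainder_L2: "f \<in> L2 M \<Longrightarrow> kremainder M f N \<in> L2 M"
  unfolding kremainder_def[abs_def] by (intro L2_diff L2_sum L2_scale) auto

text \<open>The Kaczmarz step itself: each coefficient is the component of the current remainder
  along the next unit vector. Passing to the next remainder is thus an orthogonal projection, and
  Pythagoras gives the norm identities that follow.\<close>

lemma inner_kremainder:
  assumes "f \<in> L2 M" shows "L2_inner M (kremainder M f N) (circ (int N)) = kcoeff M f N"
proof -
  have "L2_inner M (kremainder M f N) (circ (int N))
      = L2_inner M f (circ (int N)) - (\<Sum>n<N. kcoeff M f n * L2_inner M (circ (int n)) (circ (int N)))"
    unfolding kremainder_def[abs_def]
    by (subst L2_inner_diff_left) (auto simp: L2_inner_sum_left L2_inner_scale_left assms L2_scale intro!: L2_sum)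
  also have "(\<Sum>n<N. kcoeff M f n * L2_inner M (circ (int n)) (circ (int N)))
      = (\<Sum>n<N. kcoeff M f n * moment M (N - n))"
    by (intro sum.cong) (auto simp: inner_circ moment_def of_nat_diff)
  finally show ?thesis unfolding kcoeff_def by (subst kaczmarz.simps)
qed

lemma kremainder_norm_Suc:
  assumes f: "f \<in> L2 M"
  shows "(L2_norm M (kremainder M f (Suc N)))\<^sup>2 = (L2_norm M (kremainder M f N))\<^sup>2 - (norm (kcoeff M f N))\<^sup>2"
  unfolding kremainder_Suc[abs_def]
  by (subst L2_norm_diff_sq)
    (simp_all add: kremainder_L2 f L2_scale L2_inner_scale_right inner_kremainder L2_norm_scale circ_norm
      mult.commute[of "cnj _"] cmod_power2 flip: power2_eq_square)

lemma kremainder_norm: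
  assumes f: "f \<in> L2 M"
  shows "(L2_norm M (kremainder M f N))\<^sup>2 = (L2_norm M f)\<^sup>2 - (\<Sum>n<N. (norm (kcoeff M f n))\<^sup>2)"
  by (induction N) (simp_all add: kremainder_norm_Suc f)

lemma kremainder_norm_le:
  assumes f: "f \<in> L2 M" shows "L2_norm M (kremainder M f N) \<le> L2_norm M f"
  by (rule power2_le_imp_le) (simp_all add: kremainder_norm f sum_nonneg)

lemma kcoeff_Bessel:
  assumes f: "f \<in> L2 M" shows "(\<Sum>n<N. (norm (kcoeff M f n))\<^sup>2) \<le> (L2_norm M f)\<^sup>2"
  using kremainder_norm[OF f, of N] zero_le_power2[of "L2_norm M (kremainder M f N)"] by linarith

section \<open>Functions recovered by the algorithm\<close>

definition effective :: "(real \<Rightarrow> complex) \<Rightarrow> bool" where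
  "effective f \<longleftrightarrow> (\<lambda>N. L2_norm M (kremainder M f N)) \<longlonglongrightarrow> 0"

lemma effective_add:
  assumes "f \<in> L2 M" "g \<in> L2 M" "effective f" "effective g"
  shows "effective (\<lambda>x. f x + g x)"
  unfolding effective_def kremainder_add[OF assms(1,2), abs_def]
  by (rule Lim_null_comparison[OF _ tendsto_add_zero[OF assms(3,4)[unfolded effective_def]]])
    (use assms in \<open>auto intro!: always_eventually L2_norm_triangle kremainder_L2\<close>)

lemma effective_scale: "effective f \<Longrightarrow> effective (\<lambda>x. c * f x)"
  unfolding effective_def kremainder_scale[abs_def] L2_norm_scale
  using tendsto_mult_left[of "\<lambda>N. L2_norm M (kremainder M f N)" 0 sequentially "norm c"] by simp

text \<open>For every \<open>N\<close> the remainder is linear in the function and does not increase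
  norms, so an approximation error stays equally small after any number of steps.\<close>

lemma effective_lim:
  assumes u: "\<And>k :: nat. u k \<in> L2 M" "\<And>k. effective (u k)" and f: "f \<in> L2 M"
    and lim: "(\<lambda>k. L2_norm M (\<lambda>x. u k x - f x)) \<longlonglongrightarrow> 0"
  shows "effective f"
  unfolding effective_def
proof (rule tendstoI)
  fix e :: real assume "e > 0"
  then obtain k where k: "L2_norm M (\<lambda>x. u k x - f x) < e / 2"
    using order_tendstoD(2)[OF lim, of "e / 2"] by (auto simp: eventually_sequentially)
  have fu: "(\<lambda>x. f x - u k x) \<in> L2 M" by (intro L2_diff f u)
  have le: "L2_norm M (kremainder M f N) \<le> L2_norm M (\<lambda>x. u k x - f x) + L2_norm M (kremainder M (u k) N)" for N
  proof -
    have eq: "kremainder M f N = (\<lambda>x. kremainder M (\<lambda>x. f x - u k x) N x + kremainder M (u k) N x)"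
      by (rule ext) (use kremainder_add[OF fu u(1)[of k], of N] in simp)
    have "L2_norm M (kremainder M f N)
        \<le> L2_norm M (kremainder M (\<lambda>x. f x - u k x) N) + L2_norm M (kremainder M (u k) N)"
      unfolding eq by (rule L2_norm_triangle[OF kremainder_L2[OF fu] kremainder_L2[OF u(1)[of k]]])
    also have "L2_norm M (kremainder M (\<lambda>x. f x - u k x) N) \<le> L2_norm M (\<lambda>x. u k x - f x)"
      using kremainder_norm_le[OF fu] by (simp add: L2_norm_minus_commute[of _ f])
    finally show ?thesis by simp
  qed
  have "eventually (\<lambda>N. L2_norm M (kremainder M (u k) N) < e / 2) sequentially"
    using order_tendstoD(2)[OF u(2)[unfolded effective_def], of "e / 2"] \<open>e > 0\<close> by simp
  then show "eventually (\<lambda>N. dist (L2_norm M (kremainder M f N)) 0 < e) sequentially"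
  proof eventually_elim
    case (elim N)
    with le[of N] k have "L2_norm M (kremainder M f N) < e" by linarith
    then show ?case by (simp add: dist_norm)
  qed
qed

text \<open>Multiplication by \<open>circ 1\<close> preserves norms and moves each e_n to e_(n+1).
  After its first step, the algorithm for \<open>f\<close> is therefore the rotated algorithm for
  \<open>?g\<close>: the remainder of \<open>f\<close> after N + 1 steps is \<open>circ 1\<close>
  times that of \<open>?g\<close> after N steps.\<close>

lemma effective_shift_iff:
  assumes f: "f \<in> L2 M"
  shows "effective f \<longleftrightarrow> effective (\<lambda>x. circ (-1) x * (f x - L2_inner M f (circ 0)))"
    (is "_ \<longleftrightarrow> effective ?g")
proof -
  have coeff: "kcoeff M f (Suc n) = kcoeff M ?g n" for n
  proof -
    have "L2_inner M ?g (circ (int n)) = L2_inner M f (circ (int (Suc n))) - L2_inner M f (circ 0) * moment M (Suc n)" for n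
    proof -
      have "L2_inner M ?g (circ (int n)) = L2_inner M (\<lambda>x. f x - L2_inner M f (circ 0) * circ 0 x) (circ (int (Suc n)))"
        unfolding L2_inner_def using circ_mult[of "-1" _ "- int n"]
        by (intro Bochner_Integration.integral_cong) (simp_all add: mult_ac)
      also have "\<dots> = L2_inner M f (circ (int (Suc n))) - L2_inner M f (circ 0) * L2_inner M (circ 0) (circ (int (Suc n)))"
        by (subst L2_inner_diff_left) (simp_all only: f L2_scale circ_L2 L2_inner_scale_left)
      finally show ?thesis by (simp add: inner_circ moment_def del: circ_0)
    qed
    then show ?thesis unfolding kcoeff_def kaczmarz_Suc by (simp del: of_nat_Suc)
  qed
  have c0: "kcoeff M f 0 = L2_inner M f (circ 0)"
    unfolding kcoeff_def by (subst kaczmarz.simps) simp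
  have rem: "kremainder M f (Suc N) x = circ 1 x * kremainder M ?g N x" for N x
  proof -
    have e: "circ 1 x * circ (-1) x = 1" by (simp add: circ_mult)
    have "circ 1 x * kremainder M ?g N x = (circ 1 x * circ (-1) x) * (f x - L2_inner M f (circ 0))
        - (\<Sum>n<N. kcoeff M f (Suc n) * (circ 1 x * circ (int n) x))"
      by (simp add: kremainder_def coeff right_diff_distrib sum_distrib_left mult_ac)
    also have "\<dots> = kremainder M f (Suc N) x"
      unfolding e kremainder_def sum.lessThan_Suc_shift by (simp add: c0 circ_mult add_ac)
    finally show ?thesis ..
  qed
  have "L2_norm M (kremainder M f (Suc N)) = L2_norm M (kremainder M ?g N)" for N
    unfolding L2_norm_def rem norm_mult by simp
  then show ?thesis
    unfolding effective_def
    using filterlim_sequentially_Suc[of "\<lambda>N. L2_norm M (kremainder M f N)"] by simp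
qed

text \<open>For f = e_k the shifted function \<open>h\<close> is e_(k-1) minus a multiple of e_-1.
  Given effectivity of e_-1, that of e_k and of e_(k-1) are therefore equivalent, and it spreads
  from k = -1 in both directions.\<close>

lemma effective_all:
  assumes "effective (circ (-1))" and "f \<in> L2 M"
  shows "effective f"
  using assms(2)
proof (induction rule: L2_trig_induct)
  case (mode k)
  have step: "effective (circ k) \<longleftrightarrow> effective (circ (k - 1))" for k
  proof -
    define c where "c = L2_inner M (circ k) (circ 0)"
    define h where "h x = circ (k - 1) x + (- c) * circ (-1) x" for x
    have h: "h \<in> L2 M" unfolding h_def[abs_def] by (intro L2_add L2_scale circ_L2)
    have "circ (-1) x * (circ k x - c) = h x" for x
      using circ_mult[of "-1" x k] by (simp add: h_def algebra_simps)
    then have "effective (circ k) \<longleftrightarrow> effective h"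
      using effective_shift_iff[OF circ_L2[of k]] by (simp add: c_def[symmetric] fun_eq_iff[symmetric])
    also have "\<dots> \<longleftrightarrow> effective (circ (k - 1))"
    proof
      assume "effective h"
      then have "effective (\<lambda>x. h x + c * circ (-1) x)"
        by (intro effective_add h L2_scale circ_L2 effective_scale assms)
      then show "effective (circ (k - 1))" by (simp add: h_def)
    next
      assume "effective (circ (k - 1))"
      then show "effective h"
        unfolding h_def[abs_def] by (intro effective_add L2_scale circ_L2 effective_scale assms)
    qed
    finally show ?thesis .
  qed
  show ?case
  proof (induction k rule: int_induct[where k = "-1"])
    case base
    then show ?case by (rule assms)
  next
    case (step1 i)
    then show ?case using step[of "i + 1"] by simp
  next
    case (step2 i)
    then show ?case using step[of i] by simp
  qed
qed (auto intro: effective_add effective_scale effective_lim)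


lemma moment_le: "norm (moment M n) \<le> 1"
  unfolding moment_def using integral_norm_bound[of M "circ (- int n)"] by (simp add: prob_space)

end

text \<open>Partial sums are uniformly bounded and converge pointwise, hence in norm, and their
  norms are known. It serves the geometric series behind the Poisson kernel and the generating
  function of the coefficients at radius below one.\<close>

lemma summable_trig_series:
  fixes a :: "nat \<Rightarrow> complex"
  assumes a: "summable (\<lambda>n. norm (a n))"
  shows "(\<lambda>\<theta>. \<Sum>n. a n * circ (int n) \<theta>) \<in> L2 unit_lebesgue"
    and "(\<lambda>n. (norm (a n))\<^sup>2) sums (L2_norm unit_lebesgue (\<lambda>\<theta>. \<Sum>n. a n * circ (int n) \<theta>))\<^sup>2"
proof -
  let ?u = "\<lambda>N \<theta>. \<Sum>n<N. a n * circ (int n) \<theta>"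
  let ?f = "\<lambda>\<theta>. \<Sum>n. a n * circ (int n) \<theta>"
  have s: "summable (\<lambda>n. norm (a n * circ (int n) \<theta>))" for \<theta> using a by (simp add: norm_mult)
  have fm: "?f \<in> borel_measurable unit_lebesgue" by (intro borel_measurable_suminf) simp
  have fb: "norm (?f \<theta>) \<le> (\<Sum>n. norm (a n))" for \<theta>
    using summable_norm[OF s[of \<theta>]] by (simp add: norm_mult)
  show f: "?f \<in> L2 unit_lebesgue" by (rule lebesgue.L2_bounded[OF fm fb])
  have u: "?u N \<in> L2 unit_lebesgue" for N by (intro L2_sum L2_scale) simp
  have "(\<lambda>N. L2_norm unit_lebesgue (\<lambda>\<theta>. ?u N \<theta> - ?f \<theta>)) \<longlonglongrightarrow> 0"
  proof (rule L2_norm_dominated_convergence[OF L2_measurable[OF u] fm])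
    show "(\<lambda>\<theta>. complex_of_real (\<Sum>n. norm (a n))) \<in> L2 unit_lebesgue"
      by (rule lebesgue.L2_bounded[where B = "norm (complex_of_real (\<Sum>n. norm (a n)))"]) auto
    show "AE \<theta> in unit_lebesgue. (\<lambda>N. ?u N \<theta>) \<longlonglongrightarrow> ?f \<theta>"
      using summable_LIMSEQ[OF summable_norm_cancel[OF s]] by simp
    have "norm (?u N \<theta>) \<le> (\<Sum>n. norm (a n))" for N \<theta>
    proof -
      have "norm (?u N \<theta>) \<le> (\<Sum>n<N. norm (a n))" by (rule sum_norm_le) (simp add: norm_mult)
      also have "\<dots> \<le> (\<Sum>n. norm (a n))" by (rule sum_le_suminf[OF a]) auto
      finally show ?thesis .
    qed
    then show "AE \<theta> in unit_lebesgue. norm (?u N \<theta>) \<le> norm (complex_of_real (\<Sum>n. norm (a n)))" for N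
      unfolding norm_of_real by (intro AE_I2) (rule order_trans[OF _ abs_ge_self])
  qed
  then have "(\<lambda>N. (L2_norm unit_lebesgue (?u N))\<^sup>2) \<longlonglongrightarrow> (L2_norm unit_lebesgue ?f)\<^sup>2"
    by (intro tendsto_power L2_tendsto_norm u f)
  moreover have "(L2_norm unit_lebesgue (?u N))\<^sup>2 = (\<Sum>n<N. (norm (a n))\<^sup>2)" for N
    using L2_norm_trig_sum[of "int ` {..<N}" "\<lambda>n. a (nat n)"] by (simp add: sum.reindex)
  ultimately show "(\<lambda>n. (norm (a n))\<^sup>2) sums (L2_norm unit_lebesgue ?f)\<^sup>2"
    by (simp add: sums_def)
qed

section \<open>The Poisson kernel\<close>

definition poisson :: "real \<Rightarrow> real \<Rightarrow> real \<Rightarrow> real" where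
  "poisson r \<theta> x = (1 - r\<^sup>2) / (norm (1 - of_real r * circ 1 \<theta> * circ (-1) x))\<^sup>2"

lemma poisson_nonneg: "0 < r \<Longrightarrow> r < 1 \<Longrightarrow> 0 \<le> poisson r \<theta> x"
  by (simp add: poisson_def power_le_one)

lemma poisson_measurable [measurable]:
  "(\<lambda>p. poisson r (fst p) (snd p)) \<in> borel_measurable (borel \<Otimes>\<^sub>M borel)"
  unfolding poisson_def by measurable

text \<open>Multiplication by \<open>circ 1 x\<close>, of modulus one, exhibits the denominator of
  the kernel as a distance between two points of the plane.\<close>

lemma norm_circ_ratio: "norm (1 - of_real r * circ 1 \<theta> * circ (-1) x) = norm (circ 1 x - of_real r * circ 1 \<theta>)"
proof -
  have "circ 1 x * (1 - of_real r * circ 1 \<theta> * circ (-1) x) = circ 1 x - of_real r * circ 1 \<theta> * (circ 1 x * circ (-1) x)"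
    by (simp add: algebra_simps)
  also have "circ 1 x * circ (-1) x = 1" by (simp add: circ_mult)
  finally show ?thesis by (metis mult.right_neutral norm_circ norm_mult mult_1)
qed

lemma circ_power: "circ 1 x ^ n = circ (int n) x" "circ (-1) x ^ n = circ (- int n) x"
  by (induction n) (simp_all add: circ_mult)

lemma one_minus_circ_nonzero:
  assumes "0 < r" "r < 1" shows "1 - of_real r * circ 1 \<theta> * circ (-1) x \<noteq> 0"
proof
  assume "1 - of_real r * circ 1 \<theta> * circ (-1) x = 0"
  then have "norm (of_real r * circ 1 \<theta> * circ (-1) x) = norm (1 :: complex)" by simp
  with assms show False by (simp add: norm_mult)
qed

text \<open>For \<open>u\<close> of modulus \<open>r\<close> the kernel is the real part of (1 + u)
  / (1 - u) = 2 / (1 - u) - 1. This links Poisson integrals to the Cauchy transform.\<close>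

lemma poisson_geometric:
  assumes "0 < r" "r < 1"
  shows "poisson r \<theta> x = 2 * Re (1 / (1 - of_real r * circ 1 \<theta> * circ (-1) x)) - 1"
proof -
  define u where "u = of_real r * circ 1 \<theta> * circ (-1) x"
  have "norm u = r" using assms by (simp add: u_def norm_mult)
  then have r: "r\<^sup>2 = (Re u)\<^sup>2 + (Im u)\<^sup>2" by (simp flip: cmod_power2)
  have "1 - u \<noteq> 0" unfolding u_def by (rule one_minus_circ_nonzero[OF assms])
  then have "(norm (1 - u))\<^sup>2 \<noteq> 0" by simp
  then have ne: "(1 - Re u)\<^sup>2 + (Im u)\<^sup>2 \<noteq> 0" by (simp add: cmod_power2)
  have "poisson r \<theta> x = (1 - ((Re u)\<^sup>2 + (Im u)\<^sup>2)) / ((1 - Re u)\<^sup>2 + (Im u)\<^sup>2)"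
    unfolding poisson_def u_def[symmetric] r by (simp add: cmod_power2)
  also have "\<dots> = 2 * ((1 - Re u) / ((1 - Re u)\<^sup>2 + (Im u)\<^sup>2)) - 1"
    using ne by (simp add: field_simps power2_eq_square)
  also have "(1 - Re u) / ((1 - Re u)\<^sup>2 + (Im u)\<^sup>2) = Re (1 / (1 - u))"
    by (simp add: Re_divide)
  finally show ?thesis unfolding u_def .
qed

text \<open>The kernel is 1 - r^2 times the squared modulus of a geometric series in
  \<open>\<theta>\<close> with coefficients of modulus \<open>r ^ n\<close>, whose squared norm is
  the sum of r^(2n), that is 1 / (1 - r^2).\<close>

lemma nn_integral_poisson:
  assumes r: "0 < r" "r < 1"
  shows "(\<integral>\<^sup>+\<theta>. ennreal (poisson r \<theta> x) \<partial>unit_lebesgue) = 1"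
proof -
  define a where "a n = of_real r ^ n * circ (- int n) x" for n
  have na: "norm (a n) = r ^ n" for n using r by (simp add: a_def norm_mult norm_power)
  have a: "summable (\<lambda>n. norm (a n))" unfolding na using r by (intro summable_geometric) simp
  have f: "(\<Sum>n. a n * circ (int n) \<theta>) = 1 / (1 - of_real r * circ 1 \<theta> * circ (-1) x)" for \<theta>
  proof -
    have "a n * circ (int n) \<theta> = (of_real r * circ 1 \<theta> * circ (-1) x) ^ n" for n
      by (simp add: a_def power_mult_distrib circ_power)
    then show ?thesis using r by (simp add: suminf_geometric norm_mult)
  qed
  have "(\<lambda>n. (r\<^sup>2) ^ n) sums (L2_norm unit_lebesgue (\<lambda>\<theta>. \<Sum>n. a n * circ (int n) \<theta>))\<^sup>2"
    using summable_trig_series(2)[OF a] unfolding na by (simp add: power_mult[symmetric] mult.commute)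
  moreover have "(\<lambda>n. (r\<^sup>2) ^ n) sums (1 / (1 - r\<^sup>2))"
    using r by (intro geometric_sums) (simp add: power_less_one_iff abs_square_less_1)
  ultimately have norm: "(L2_norm unit_lebesgue (\<lambda>\<theta>. \<Sum>n. a n * circ (int n) \<theta>))\<^sup>2 = 1 / (1 - r\<^sup>2)"
    using sums_unique2 by blast
  have r2: "1 - r\<^sup>2 > 0" using r by (simp add: power_less_one_iff)
  have "(\<integral>\<^sup>+\<theta>. ennreal (poisson r \<theta> x) \<partial>unit_lebesgue)
      = (\<integral>\<^sup>+\<theta>. ennreal (1 - r\<^sup>2) * ennreal ((norm (\<Sum>n. a n * circ (int n) \<theta>))\<^sup>2) \<partial>unit_lebesgue)"
    unfolding f using r2
    by (intro nn_integral_cong) (simp add: poisson_def norm_divide power_divide flip: ennreal_mult)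
  also have "\<dots> = ennreal (1 - r\<^sup>2) * (\<integral>\<^sup>+\<theta>. ennreal ((norm (\<Sum>n. a n * circ (int n) \<theta>))\<^sup>2) \<partial>unit_lebesgue)"
    using L2_measurable[OF summable_trig_series(1)[OF a]] by (intro nn_integral_cmult) measurable
  also have "\<dots> = ennreal (1 - r\<^sup>2) * ennreal (1 / (1 - r\<^sup>2))"
    by (simp only: L2_nn_integral[OF summable_trig_series(1)[OF a]] norm)
  also have "\<dots> = 1" using r2 by (simp flip: ennreal_mult)
  finally show ?thesis .
qed

context circle_prob
begin

lemma poisson_measurable_M [measurable]: "(\<lambda>p. poisson r (fst p) (snd p)) \<in> borel_measurable (unit_lebesgue \<Otimes>\<^sub>M M)"
proof -
  have "(\<lambda>p. (fst p, snd p)) \<in> unit_lebesgue \<Otimes>\<^sub>M M \<rightarrow>\<^sub>M borel \<Otimes>\<^sub>M borel"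
  proof (rule measurable_Pair)
    show "fst \<in> unit_lebesgue \<Otimes>\<^sub>M M \<rightarrow>\<^sub>M borel"
      by (rule measurable_compose[OF measurable_fst]) (simp add: measurable_restrict_space1)
    show "snd \<in> unit_lebesgue \<Otimes>\<^sub>M M \<rightarrow>\<^sub>M borel"
      by (rule measurable_compose[OF measurable_snd]) (intro borel_measurable_M, simp)
  qed
  from measurable_compose[OF this poisson_measurable] show ?thesis by simp
qed

lemma poisson_measurable_snd [measurable]: "poisson r \<theta> \<in> borel_measurable M"
proof -
  have "(\<lambda>x. poisson r \<theta> x) \<in> borel_measurable borel" unfolding poisson_def by measurable
  then show ?thesis by (rule borel_measurable_M)
qed

lemma poisson_le:
  assumes r: "0 < r" "r < 1" shows "poisson r \<theta> x \<le> (1 - r\<^sup>2) / (1 - r)\<^sup>2"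
proof -
  have "1 - r \<le> norm (1 - of_real r * circ 1 \<theta> * circ (-1) x)"
    using norm_triangle_ineq2[of 1 "of_real r * circ 1 \<theta> * circ (-1) x"] r by (simp add: norm_mult)
  then have "(1 - r)\<^sup>2 \<le> (norm (1 - of_real r * circ 1 \<theta> * circ (-1) x))\<^sup>2"
    using r by (intro power_mono) auto
  then show ?thesis
    unfolding poisson_def using r
    by (intro divide_left_mono mult_pos_pos) (auto simp: power_le_one one_minus_circ_nonzero)
qed

lemma poisson_integrable:
  assumes r: "0 < r" "r < 1" shows "integrable M (poisson r \<theta>)"
  using poisson_le[OF r] poisson_nonneg[OF r]
  by (intro integrable_const_bound[where B = "(1 - r\<^sup>2) / (1 - r)\<^sup>2"]) auto

section \<open>Generating functions and boundary behaviour for singular measures\<close>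

lemma cauchy_transform_sums:
  assumes r: "0 < r" "r < 1"
  shows "(\<lambda>n. moment M n * (of_real r * circ 1 \<theta>) ^ n) sums (\<integral>x. 1 / (1 - of_real r * circ 1 \<theta> * circ (-1) x) \<partial>M)"
proof -
  define z where "z = of_real r * circ 1 \<theta>"
  have z: "norm z = r" using r by (simp add: z_def norm_mult)
  define f where "f n x = z ^ n * circ (- int n) x" for n x
  have nf: "norm (f n x) = r ^ n" for n x by (simp add: f_def norm_mult norm_power z)
  have s: "summable (\<lambda>n. norm (f n x))" for x unfolding nf using r by (intro summable_geometric) simp
  have fi: "integrable M (f n)" for n unfolding f_def[abs_def] by simp
  have int: "(\<integral>x. f n x \<partial>M) = moment M n * z ^ n" for n by (simp add: f_def moment_def)
  have sum: "(\<Sum>n. f n x) = 1 / (1 - z * circ (-1) x)" for x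
  proof -
    have "f n x = (z * circ (-1) x) ^ n" for n by (simp add: f_def power_mult_distrib circ_power)
    then show ?thesis using r z by (simp add: suminf_geometric norm_mult)
  qed
  have si: "summable (\<lambda>n. \<integral>x. norm (f n x) \<partial>M)" unfolding nf using r by (simp add: prob_space summable_geometric)
  have "(\<lambda>n. \<integral>x. f n x \<partial>M) sums (\<integral>x. (\<Sum>n. f n x) \<partial>M)"
    by (rule sums_integral[OF fi _ si]) (simp add: s)
  then show ?thesis unfolding int sum z_def .
qed

text \<open>As the moment of index 0 is 1, the coefficient of index \<open>n\<close> is the last
  term of the sum, and the recursion becomes a convolution. For generating functions it says that z
  B C = C - 1.\<close>

lemma kcoeff_circ_minus_one:
  "(\<Sum>i\<le>n. kcoeff M (circ (-1)) i * moment M (n - i)) = moment M (Suc n)"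
proof -
  have "L2_inner M (circ (-1)) (circ (int n)) = moment M (Suc n)"
    by (simp add: inner_circ moment_def algebra_simps)
  then have "kcoeff M (circ (-1)) n = moment M (Suc n) - (\<Sum>i<n. kcoeff M (circ (-1)) i * moment M (n - i))"
    unfolding kcoeff_def by (subst kaczmarz.simps) simp
  then show ?thesis by (simp add: moment_0 flip: lessThan_Suc_atMost)
qed

lemma kcoeff_le: "norm (kcoeff M (circ k) n) \<le> 1"
proof -
  have "(norm (kcoeff M (circ k) n))\<^sup>2 \<le> (\<Sum>i<Suc n. (norm (kcoeff M (circ k) i))\<^sup>2)"
    by (rule member_le_sum) auto
  also have "\<dots> \<le> 1" using kcoeff_Bessel[OF circ_L2, of k "Suc n"] by (simp only: circ_norm) simp
  finally show ?thesis by (simp add: abs_square_le_1)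
qed

lemma summable_bounded_power:
  assumes "\<And>n. norm (a n) \<le> 1" "norm (z :: complex) < 1" shows "summable (\<lambda>n. norm (a n * z ^ n))"
  by (rule summable_comparison_test'[OF summable_geometric[of "norm z"]])
    (use assms in \<open>auto simp: norm_mult norm_power intro!: mult_left_le_one_le\<close>)

text \<open>
  With \<open>C\<close> the Cauchy transform of the measure and \<open>B\<close> the generating function of the coefficients,
  \<open>z B = 1 - 1 / C\<close>, whence \<open>\<bar>z B\<bar>\<^sup>2 = 1 - (2 Re C - 1) / \<bar>C\<bar>\<^sup>2\<close>, where \<open>2 Re C - 1\<close> is the Poisson integral
  and \<open>\<bar>C\<bar> \<ge> Re C \<ge> 1/2\<close>.
\<close>

lemma kcoeff_generating_function_bound:
  assumes r: "0 < r" "r < 1"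
  shows "1 - 4 * (\<integral>x. poisson r \<theta> x \<partial>M)
    \<le> (norm (\<Sum>n. kcoeff M (circ (-1)) n * (of_real r * circ 1 \<theta>) ^ n))\<^sup>2"
proof -
  define z where "z = of_real r * circ 1 \<theta>"
  define C where "C = (\<integral>x. 1 / (1 - z * circ (-1) x) \<partial>M)"
  define B where "B = (\<Sum>n. kcoeff M (circ (-1)) n * z ^ n)"
  define P where "P = (\<integral>x. poisson r \<theta> x \<partial>M)"
  have z: "norm z = r" using r by (simp add: z_def norm_mult)
  have Cs: "(\<lambda>n. moment M n * z ^ n) sums C" using cauchy_transform_sums[OF r] by (simp add: C_def z_def)
  have "(\<lambda>k. \<Sum>i\<le>k. (kcoeff M (circ (-1)) i * z ^ i) * (moment M (k - i) * z ^ (k - i))) sums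
      (B * (\<Sum>n. moment M n * z ^ n))"
    unfolding B_def using r z
    by (intro Cauchy_product_sums summable_bounded_power kcoeff_le moment_le) auto
  moreover have "(\<Sum>i\<le>k. (kcoeff M (circ (-1)) i * z ^ i) * (moment M (k - i) * z ^ (k - i))) = moment M (Suc k) * z ^ k" for k
  proof -
    have "(\<Sum>i\<le>k. (kcoeff M (circ (-1)) i * z ^ i) * (moment M (k - i) * z ^ (k - i)))
        = (\<Sum>i\<le>k. (kcoeff M (circ (-1)) i * moment M (k - i)) * (z ^ i * z ^ (k - i)))"
      by (simp only: mult_ac)
    also have "\<dots> = (\<Sum>i\<le>k. (kcoeff M (circ (-1)) i * moment M (k - i)) * z ^ k)"
      by (intro sum.cong) (simp_all flip: power_add)
    finally show ?thesis by (simp add: kcoeff_circ_minus_one flip: sum_distrib_right)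
  qed
  ultimately have "(\<lambda>k. moment M (Suc k) * z ^ k) sums (B * C)"
    using sums_unique[OF Cs] by simp
  then have "(\<lambda>k. z * (moment M (Suc k) * z ^ k)) sums (z * (B * C))" by (rule sums_mult)
  then have "(\<lambda>k. moment M (Suc k) * z ^ Suc k) sums (z * (B * C))" by (simp add: mult_ac)
  moreover have "(\<lambda>k. moment M (Suc k) * z ^ Suc k) sums (C - moment M 0 * z ^ 0)"
    using Cs by (subst sums_Suc_iff) simp
  ultimately have "z * (B * C) = C - moment M 0 * z ^ 0" by (rule sums_unique2)
  then have zBC: "z * (B * C) = C - 1" by (simp add: moment_0)
  have Ci: "integrable M (\<lambda>x. 1 / (1 - z * circ (-1) x))"
  proof (rule integrable_const_bound[where B = "1 / (1 - r)"])
    have "1 - r \<le> norm (1 - z * circ (-1) x)" for x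
      using norm_triangle_ineq2[of 1 "z * circ (-1) x"] r z by (simp add: norm_mult)
    then show "AE x in M. norm (1 / (1 - z * circ (-1) x)) \<le> 1 / (1 - r)"
      unfolding norm_divide norm_one using r by (intro AE_I2 frac_le) auto
  qed measurable
  have "P = (\<integral>x. 2 * Re (1 / (1 - z * circ (-1) x)) - 1 \<partial>M)"
    unfolding P_def poisson_geometric[OF r] z_def ..
  also have "\<dots> = 2 * Re C - 1"
    unfolding C_def using Ci by (simp add: integrable_Re prob_space del: Re_divide flip: integral_Re)
  finally have P: "P = 2 * Re C - 1" .
  have P0: "P \<ge> 0" unfolding P_def by (intro integral_nonneg_AE AE_I2 poisson_nonneg r)
  have C1: "(norm C)\<^sup>2 \<ge> 1 / 4"
  proof -
    have "(1/2)\<^sup>2 \<le> (Re C)\<^sup>2" using P P0 by (intro power_mono) auto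
    then show ?thesis by (simp add: cmod_power2 power_divide add_increasing2)
  qed
  have "r\<^sup>2 * (norm B)\<^sup>2 * (norm C)\<^sup>2 = (norm (C - 1))\<^sup>2"
    using arg_cong[OF zBC, of "\<lambda>w. (norm w)\<^sup>2"] by (simp add: norm_mult power_mult_distrib z mult_ac)
  also have "\<dots> = (norm C)\<^sup>2 - P"
    unfolding P cmod_power2 by (simp add: power2_eq_square algebra_simps)
  finally have eq: "r\<^sup>2 * (norm B)\<^sup>2 * (norm C)\<^sup>2 = (norm C)\<^sup>2 - P" .
  \<comment> \<open>Here the constant 4 arises: \<open>C1\<close> gives
    \<open>P \<le> 4 * P * (norm C)\<^sup>2\<close>. The factor \<open>(norm C)\<^sup>2\<close> is
    kept on both sides in place of a division.\<close>
  have "(1 - 4 * P) * (norm C)\<^sup>2 \<le> (norm C)\<^sup>2 - P"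
    using mult_left_mono[OF C1 P0] by (simp add: algebra_simps)
  then have "1 - 4 * P \<le> r\<^sup>2 * (norm B)\<^sup>2"
    unfolding eq[symmetric] by (rule mult_right_le_imp_le) (use C1 in linarith)
  also have "\<dots> \<le> (norm B)\<^sup>2"
    using r by (intro mult_left_le_one_le) (auto simp: power_le_one)
  finally show ?thesis unfolding P_def B_def z_def .
qed

text \<open>The point of the circle given by \<open>\<theta>\<close> has positive distance
  \<open>\<delta>\<close> from the image of \<open>K\<close>. For \<open>x\<close> in
  \<open>K\<close> the denominator of the kernel thus stays away from zero while its numerator 1 -
  r^2 tends to zero.\<close>

lemma poisson_compact_tendsto_0:
  assumes K: "compact K" "K \<subseteq> {0..<1}" and \<theta>: "\<theta> \<in> {0..<1}" "\<theta> \<notin> K"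
  shows "(\<lambda>k. \<integral>x. indicator K x * poisson (1 - inverse (real (k + 2))) \<theta> x \<partial>M) \<longlonglongrightarrow> 0"
proof -
  \<comment> \<open>The offset 2 makes \<open>r k\<close> strictly positive from
    \<open>k = 0\<close> on.\<close>
  define r where "r k = 1 - inverse (real (k + 2))" for k
  have r: "0 < r k" "r k < 1" for k by (auto simp: r_def field_simps)
  have r1: "r \<longlonglongrightarrow> 1"
    unfolding r_def[abs_def]
    using tendsto_diff[OF tendsto_const LIMSEQ_ignore_initial_segment[OF LIMSEQ_inverse_real_of_nat, of 1], of 1]
    by (simp add: add.commute)
  have "circ 1 \<theta> \<notin> circ 1 ` K" using \<theta> K(2) circ_inj by blast
  moreover have "closed (circ 1 ` K)"
    by (intro compact_imp_closed compact_continuous_image continuous_on_circ K)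
  ultimately obtain \<delta> where \<delta>: "\<delta> > 0" "\<And>x. x \<in> K \<Longrightarrow> \<delta> \<le> dist (circ 1 \<theta>) (circ 1 x)"
    using separate_point_closed[of "circ 1 ` K" "circ 1 \<theta>"] by blast
  have KM: "K \<in> sets M" using K by (auto simp: sets_M_iff borel_compact)
  have "eventually (\<lambda>k. 1 - r k < \<delta> / 2) sequentially"
    using order_tendstoD(1)[OF r1, of "1 - \<delta> / 2"] \<delta>(1) by (auto elim: eventually_mono)
  then have "eventually (\<lambda>k. norm (\<integral>x. indicator K x * poisson (r k) \<theta> x \<partial>M) \<le> (1 - (r k)\<^sup>2) * (4 / \<delta>\<^sup>2)) sequentially"
  proof eventually_elim
    case (elim k)
    have r2: "(r k)\<^sup>2 \<le> 1" using r[of k] by (simp add: power_le_one)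
    have le: "norm (indicator K x * poisson (r k) \<theta> x) \<le> (1 - (r k)\<^sup>2) * (4 / \<delta>\<^sup>2)" for x
    proof (cases "x \<in> K")
      case True
      have "\<delta> \<le> norm (circ 1 x - circ 1 \<theta>)"
        using \<delta>(2)[OF True] by (simp add: dist_norm norm_minus_commute)
      also have "circ 1 x - circ 1 \<theta> = (circ 1 x - of_real (r k) * circ 1 \<theta>) - of_real (1 - r k) * circ 1 \<theta>"
        by (simp add: algebra_simps)
      also have "norm \<dots> \<le> norm (circ 1 x - of_real (r k) * circ 1 \<theta>) + (1 - r k)"
        using norm_triangle_ineq4[of "circ 1 x - of_real (r k) * circ 1 \<theta>" "of_real (1 - r k) * circ 1 \<theta>"] r[of k]
        by (simp only: norm_mult norm_of_real norm_circ mult_1_right abs_of_nonneg diff_ge_0_iff_ge less_imp_le)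
      finally have "\<delta> / 2 \<le> norm (1 - of_real (r k) * circ 1 \<theta> * circ (-1) x)"
        unfolding norm_circ_ratio using elim by simp
      then have "(\<delta> / 2)\<^sup>2 \<le> (norm (1 - of_real (r k) * circ 1 \<theta> * circ (-1) x))\<^sup>2"
        using \<delta>(1) by (intro power_mono) auto
      then have "poisson (r k) \<theta> x \<le> (1 - (r k)\<^sup>2) / (\<delta> / 2)\<^sup>2"
        unfolding poisson_def using r2 \<delta>(1)
        by (intro divide_left_mono mult_pos_pos) (auto simp: one_minus_circ_nonzero r)
      then show ?thesis using True poisson_nonneg[OF r, of k \<theta> x] by (simp add: power_divide)
    next
      case False
      then show ?thesis using r2 by simp
    qed
    have "norm (\<integral>x. indicator K x * poisson (r k) \<theta> x \<partial>M) \<le> (\<integral>x. norm (indicator K x * poisson (r k) \<theta> x) \<partial>M)"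
      by (rule integral_norm_bound)
    also have "\<dots> \<le> (\<integral>x. (1 - (r k)\<^sup>2) * (4 / \<delta>\<^sup>2) \<partial>M)"
      by (rule integral_mono_AE') (use le r2 in auto)
    finally show ?case by (simp add: prob_space)
  qed
  moreover have "(\<lambda>k. (1 - (r k)\<^sup>2) * (4 / \<delta>\<^sup>2)) \<longlonglongrightarrow> 0"
    using tendsto_mult_right[OF tendsto_diff[OF tendsto_const tendsto_power[OF r1]], of 1 2 "4 / \<delta>\<^sup>2"] by simp
  ultimately show ?thesis
    unfolding r_def[symmetric] by (rule Lim_null_comparison)
qed

text \<open>Bessel's inequality gives at most one. Conversely, integrating the generating function
  bound over \<open>\<theta>\<close> bounds 1 by the sum plus 4 times the integral of the Poisson
  integral. That integral is 1 at every radius, so the bound must be truncated: on a compact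
  Lebesgue-null \<open>K\<close> carrying all but mass \<open>e\<close>, the Poisson integral tends
  to zero almost everywhere, and a cut at 1 permits dominated convergence; the mass off
  \<open>K\<close> contributes at most \<open>4 * e\<close> by Tonelli.\<close>

lemma kcoeff_circ_minus_one_norm:
  assumes sing: "mutually_singular M unit_lebesgue"
  shows "(\<lambda>n. (norm (kcoeff M (circ (-1)) n))\<^sup>2) sums 1"
proof -
  define \<beta> where "\<beta> = kcoeff M (circ (-1))"
  have \<beta>1: "norm (\<beta> n) \<le> 1" for n unfolding \<beta>_def by (rule kcoeff_le)
  have bessel: "(\<Sum>n<N. (norm (\<beta> n))\<^sup>2) \<le> 1" for N
    using kcoeff_Bessel[OF circ_L2, of "-1" N] by (simp only: circ_norm \<beta>_def) simp
  have sb: "summable (\<lambda>n. (norm (\<beta> n))\<^sup>2)"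
    using bessel by (intro bounded_imp_summable[where B = 1]) (simp_all del: sum.lessThan_Suc flip: lessThan_Suc_atMost)
  define S where "S = (\<Sum>n. (norm (\<beta> n))\<^sup>2)"
  have S0: "S \<ge> 0" unfolding S_def by (rule suminf_nonneg[OF sb]) auto
  have S1: "S \<le> 1" unfolding S_def by (rule suminf_le_const[OF sb]) (use bessel in auto)
  obtain A where A: "A \<in> sets M" "emeasure M A = 0" "emeasure unit_lebesgue (space unit_lebesgue - A) = 0"
    using sing by (auto simp: mutually_singular_def)
  have spaces: "space unit_lebesgue = {0..<1}" by (simp add: space_restrict_space)
  have sf: "sigma_finite_measure M" by (rule sigma_finite_measure_axioms)
  interpret pair_sigma_finite unit_lebesgue M
    by (intro pair_sigma_finite.intro lebesgue.sigma_finite_measure_axioms sigma_finite_measure_axioms)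
  define r where "r k = 1 - inverse (real (k + 2))" for k
  have r: "0 < r k" "r k < 1" for k by (auto simp: r_def field_simps)

  have "1 \<le> S + 4 * e" if e: "e > 0" for e
  proof -
    \<comment> \<open>The complement of \<open>A\<close> carries \<open>M\<close> and is
      Lebesgue-null; \<open>K\<close> inherits the nullity and loses mass less than
      \<open>e\<close>.\<close>
    obtain K where K: "compact K" "K \<subseteq> space M - A" "measure M (space M - A - K) < e"
      using inner_regular_compact[OF sets.compl_sets[OF A(1)] e] by blast
    have K01: "K \<subseteq> {0..<1}" using K(2) by (auto simp: space_M)
    have KM [measurable]: "K \<in> sets M" using K01 K(1) by (auto simp: sets_M_iff borel_compact)
    have "measure M (space M - K) = measure M (space M - A - K)"
    proof (rule measure_eq_AE)
      have "AE x in M. x \<notin> A" using A by (intro AE_not_in) (auto simp: null_sets_def)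
      then show "AE x in M. x \<in> space M - K \<longleftrightarrow> x \<in> space M - A - K" by eventually_elim auto
    qed (use A in auto)
    with K(3) have small: "measure M (space M - K) < e" by simp
    have "emeasure unit_lebesgue K \<le> emeasure unit_lebesgue (space unit_lebesgue - A)"
    proof (rule emeasure_mono)
      have "space M - A \<in> sets M" using A(1) by (rule sets.compl_sets)
      then show "space unit_lebesgue - A \<in> sets unit_lebesgue"
        by (simp only: space_M spaces lebesgue.sets_M sets_M)
    qed (use K(2) in \<open>auto simp: space_M spaces\<close>)
    then have "K \<in> null_sets unit_lebesgue"
      using A(3) KM by (auto simp: null_sets_def lebesgue.sets_M sets_M)
    then have notK: "AE \<theta> in unit_lebesgue. \<theta> \<notin> K" by (rule AE_not_in)
    define PK where "PK k \<theta> = (\<integral>x. indicator K x * poisson (r k) \<theta> x \<partial>M)" for k \<theta>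
    define PC where "PC k \<theta> = (\<integral>\<^sup>+x. indicator (space M - K) x * ennreal (poisson (r k) \<theta> x) \<partial>M)" for k \<theta>
    define B where "B k \<theta> = (\<Sum>n. \<beta> n * of_real (r k) ^ n * circ (int n) \<theta>)" for k \<theta>
    have as: "summable (\<lambda>n. norm (\<beta> n * of_real (r k) ^ n))" for k
      using r[of k] \<beta>1 by (intro summable_bounded_power) auto
    have BL2: "B k \<in> L2 unit_lebesgue" for k unfolding B_def[abs_def] by (rule summable_trig_series(1)[OF as])
    have [measurable]: "B k \<in> borel_measurable unit_lebesgue" for k using BL2 by (rule L2_measurable)
    have [measurable]: "(\<lambda>p. poisson (r k) (fst p) (snd p)) \<in> borel_measurable (unit_lebesgue \<Otimes>\<^sub>M M)" for k
      by (rule poisson_measurable_M)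
    have [measurable]: "PK k \<in> borel_measurable unit_lebesgue" for k
      unfolding PK_def[abs_def]
      by (rule sigma_finite_measure.borel_measurable_lebesgue_integral[OF sf]) (simp add: case_prod_unfold)
    have [measurable]: "PC k \<in> borel_measurable unit_lebesgue" for k
      unfolding PC_def[abs_def]
      by (rule sigma_finite_measure.borel_measurable_nn_integral[OF sf]) (simp add: case_prod_unfold)
    have PK0: "PK k \<theta> \<ge> 0" for k \<theta>
      unfolding PK_def using poisson_nonneg[OF r] by (intro integral_nonneg_AE AE_I2) auto
    have B_norm: "(\<integral>\<^sup>+\<theta>. ennreal ((norm (B k \<theta>))\<^sup>2) \<partial>unit_lebesgue) \<le> ennreal S" for k
    proof -
      have s: "(\<lambda>n. (norm (\<beta> n * of_real (r k) ^ n))\<^sup>2) sums (L2_norm unit_lebesgue (B k))\<^sup>2"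
        unfolding B_def[abs_def] by (rule summable_trig_series(2)[OF as])
      have "(norm (\<beta> n * of_real (r k) ^ n))\<^sup>2 \<le> (norm (\<beta> n))\<^sup>2" for n
      proof -
        have "norm (\<beta> n) * r k ^ n \<le> norm (\<beta> n) * 1"
          using r[of k] by (intro mult_left_mono power_le_one) auto
        then show ?thesis using r[of k] by (intro power_mono) (simp_all add: norm_mult norm_power)
      qed
      then have "(L2_norm unit_lebesgue (B k))\<^sup>2 \<le> S"
        unfolding S_def by (rule sums_le[OF _ s summable_sums[OF sb]])
      then show ?thesis unfolding L2_nn_integral[OF BL2] by (rule ennreal_leI)
    qed
    have PC_int: "(\<integral>\<^sup>+\<theta>. PC k \<theta> \<partial>unit_lebesgue) \<le> ennreal e" for k
    proof -
      have "(\<integral>\<^sup>+\<theta>. PC k \<theta> \<partial>unit_lebesgue)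
          = (\<integral>\<^sup>+x. \<integral>\<^sup>+\<theta>. indicator (space M - K) x * ennreal (poisson (r k) \<theta> x) \<partial>unit_lebesgue \<partial>M)"
        unfolding PC_def by (rule Fubini'[symmetric]) (simp add: case_prod_unfold)
      also have "\<dots> = (\<integral>\<^sup>+x. indicator (space M - K) x \<partial>M)"
      proof (rule nn_integral_cong)
        fix x assume x: "x \<in> space M"
        have "(\<lambda>\<theta>. poisson (r k) \<theta> x) \<in> borel_measurable borel" unfolding poisson_def by measurable
        then have "(\<lambda>\<theta>. ennreal (poisson (r k) \<theta> x)) \<in> borel_measurable unit_lebesgue"
          by (intro measurable_compose[OF _ measurable_ennreal] lebesgue.borel_measurable_M)
        then show "(\<integral>\<^sup>+\<theta>. indicator (space M - K) x * ennreal (poisson (r k) \<theta> x) \<partial>unit_lebesgue) = indicator (space M - K) x"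
          by (simp add: nn_integral_cmult nn_integral_poisson r)
      qed
      also have "\<dots> = ennreal (measure M (space M - K))"
        using KM by (simp add: emeasure_eq_measure)
      finally show ?thesis using small by (simp add: ennreal_leI)
    qed
    \<comment> \<open>If \<open>4 * PK k \<theta>\<close> is at least 1, the cut term alone
      suffices; otherwise nothing is cut and the generating function bound applies.
      \<open>PC\<close> must not be cut, since its integral over \<open>\<theta>\<close> is what
      Tonelli controls.\<close>
    have pointwise: "1 \<le> ennreal ((norm (B k \<theta>))\<^sup>2) + ennreal (min 1 (4 * PK k \<theta>)) + 4 * PC k \<theta>" for k \<theta>
    proof -
      have Kc: "integrable M (\<lambda>x. indicator (space M - K) x * poisson (r k) \<theta> x)"
        using integrable_mult_indicator[OF _ poisson_integrable[OF r, of k \<theta>], of "space M - K"] KM by simp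
      have Ki: "integrable M (\<lambda>x. indicator K x * poisson (r k) \<theta> x)"
        using integrable_mult_indicator[OF KM poisson_integrable[OF r, of k \<theta>]] by simp
      define q where "q = (\<integral>x. indicator (space M - K) x * poisson (r k) \<theta> x \<partial>M)"
      have q0: "q \<ge> 0"
        unfolding q_def using poisson_nonneg[OF r] by (intro integral_nonneg_AE AE_I2) auto
      have PCq: "PC k \<theta> = ennreal q"
        unfolding PC_def q_def using poisson_nonneg[OF r]
        by (subst nn_integral_eq_integral[OF Kc, symmetric]) (auto intro!: nn_integral_cong simp: indicator_def)
      have "(\<integral>x. poisson (r k) \<theta> x \<partial>M)
          = (\<integral>x. indicator K x * poisson (r k) \<theta> x + indicator (space M - K) x * poisson (r k) \<theta> x \<partial>M)"
        by (intro Bochner_Integration.integral_cong) (auto simp: indicator_def)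
      also have "\<dots> = PK k \<theta> + q" unfolding PK_def q_def by (rule Bochner_Integration.integral_add[OF Ki Kc])
      finally have P: "(\<integral>x. poisson (r k) \<theta> x \<partial>M) = PK k \<theta> + q" .
      have "(\<Sum>n. kcoeff M (circ (-1)) n * (of_real (r k) * circ 1 \<theta>) ^ n) = B k \<theta>"
        by (simp add: B_def \<beta>_def power_mult_distrib circ_power mult_ac)
      then have "1 - 4 * (PK k \<theta> + q) \<le> (norm (B k \<theta>))\<^sup>2"
        using kcoeff_generating_function_bound[OF r, of k \<theta>] by (simp add: P)
      then have "1 \<le> (norm (B k \<theta>))\<^sup>2 + min 1 (4 * PK k \<theta>) + 4 * q"
        using q0 PK0[of k \<theta>] zero_le_power2[of "norm (B k \<theta>)"] by (auto simp: min_def)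
      then have "ennreal 1 \<le> ennreal ((norm (B k \<theta>))\<^sup>2 + min 1 (4 * PK k \<theta>) + 4 * q)" by (rule ennreal_leI)
      also have "\<dots> = ennreal ((norm (B k \<theta>))\<^sup>2) + ennreal (min 1 (4 * PK k \<theta>)) + 4 * ennreal q"
        using q0 PK0[of k \<theta>] by (simp add: ennreal_plus ennreal_mult)
      finally show ?thesis by (simp add: PCq)
    qed
    define m where "m k = (\<integral>\<theta>. min 1 (4 * PK k \<theta>) \<partial>unit_lebesgue)" for k
    have m0: "m k \<ge> 0" for k unfolding m_def using PK0 by (intro integral_nonneg_AE AE_I2) auto
    have le: "1 \<le> S + m k + 4 * e" for k
    proof -
      have mi: "integrable unit_lebesgue (\<lambda>\<theta>. min 1 (4 * PK k \<theta>))"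
        by (rule lebesgue.integrable_const_bound[where B = 1]) (use PK0 in auto)
      have "1 = emeasure unit_lebesgue (space unit_lebesgue)"
        by (simp add: emeasure_restrict_space space_restrict_space)
      also have "\<dots> = (\<integral>\<^sup>+\<theta>. 1 \<partial>unit_lebesgue)" by simp
      also have "\<dots> \<le> (\<integral>\<^sup>+\<theta>. ennreal ((norm (B k \<theta>))\<^sup>2) + ennreal (min 1 (4 * PK k \<theta>)) + 4 * PC k \<theta> \<partial>unit_lebesgue)"
        by (intro nn_integral_mono pointwise)
      also have "\<dots> = (\<integral>\<^sup>+\<theta>. ennreal ((norm (B k \<theta>))\<^sup>2) \<partial>unit_lebesgue)
          + (\<integral>\<^sup>+\<theta>. ennreal (min 1 (4 * PK k \<theta>)) \<partial>unit_lebesgue) + 4 * (\<integral>\<^sup>+\<theta>. PC k \<theta> \<partial>unit_lebesgue)"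
      proof -
        have [measurable]: "(\<lambda>\<theta>. ennreal ((norm (B k \<theta>))\<^sup>2)) \<in> borel_measurable unit_lebesgue"
          "(\<lambda>\<theta>. ennreal (min 1 (4 * PK k \<theta>))) \<in> borel_measurable unit_lebesgue"
          "(\<lambda>\<theta>. 4 * PC k \<theta>) \<in> borel_measurable unit_lebesgue"
          by measurable
        have PCm: "PC k \<in> borel_measurable unit_lebesgue" by measurable
        have "(\<integral>\<^sup>+\<theta>. ennreal ((norm (B k \<theta>))\<^sup>2) + ennreal (min 1 (4 * PK k \<theta>)) + 4 * PC k \<theta> \<partial>unit_lebesgue)
          = (\<integral>\<^sup>+\<theta>. ennreal ((norm (B k \<theta>))\<^sup>2) + ennreal (min 1 (4 * PK k \<theta>)) \<partial>unit_lebesgue) + (\<integral>\<^sup>+\<theta>. 4 * PC k \<theta> \<partial>unit_lebesgue)"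
          by (rule nn_integral_add) measurable
        also have "(\<integral>\<^sup>+\<theta>. ennreal ((norm (B k \<theta>))\<^sup>2) + ennreal (min 1 (4 * PK k \<theta>)) \<partial>unit_lebesgue)
          = (\<integral>\<^sup>+\<theta>. ennreal ((norm (B k \<theta>))\<^sup>2) \<partial>unit_lebesgue) + (\<integral>\<^sup>+\<theta>. ennreal (min 1 (4 * PK k \<theta>)) \<partial>unit_lebesgue)"
          by (rule nn_integral_add) measurable
        finally show ?thesis
          unfolding nn_integral_cmult[OF PCm] .
      qed
      also have "(\<integral>\<^sup>+\<theta>. ennreal (min 1 (4 * PK k \<theta>)) \<partial>unit_lebesgue) = ennreal (m k)"
        unfolding m_def using PK0 by (intro nn_integral_eq_integral mi) auto
      also have "(\<integral>\<^sup>+\<theta>. ennreal ((norm (B k \<theta>))\<^sup>2) \<partial>unit_lebesgue) + ennreal (m k) + 4 * (\<integral>\<^sup>+\<theta>. PC k \<theta> \<partial>unit_lebesgue)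
          \<le> ennreal S + ennreal (m k) + 4 * ennreal e"
        by (intro add_mono mult_left_mono B_norm PC_int) auto
      also have "\<dots> = ennreal (S + m k + 4 * e)"
        using S0 m0[of k] e by (simp add: ennreal_plus ennreal_mult)
      finally show ?thesis by (simp only: ennreal_ge_1)
    qed
    have "m \<longlonglongrightarrow> (\<integral>\<theta>. 0 \<partial>unit_lebesgue)"
      unfolding m_def[abs_def]
    proof (rule integral_dominated_convergence[where w = "\<lambda>_. 1"])
      show "AE \<theta> in unit_lebesgue. (\<lambda>k. min 1 (4 * PK k \<theta>)) \<longlonglongrightarrow> 0"
        using notK AE_space
      proof eventually_elim
        case (elim \<theta>)
        have "(\<lambda>k. PK k \<theta>) \<longlonglongrightarrow> 0"
          using poisson_compact_tendsto_0[OF K(1) K01, of \<theta>] elim by (simp add: PK_def r_def spaces)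
        then have "(\<lambda>k. min 1 (4 * PK k \<theta>)) \<longlonglongrightarrow> min 1 (4 * 0)" by (intro tendsto_intros)
        then show ?case by simp
      qed
    qed (use PK0 in auto)
    then have "(\<lambda>k. S + m k + 4 * e) \<longlonglongrightarrow> S + 0 + 4 * e" by (intro tendsto_intros) simp
    then show ?thesis using le by (intro LIMSEQ_le_const[where X = "\<lambda>k. S + m k + 4 * e"]) auto
  qed
  note * = this
  have "1 \<le> S"
  proof (rule field_le_epsilon)
    fix e :: real assume "e > 0"
    then show "1 \<le> S + e" using *[of "e / 4"] by simp
  qed
  with S1 have "S = 1" by simp
  with summable_sums[OF sb] show ?thesis by (simp add: S_def \<beta>_def)
qed

theorem kaczmarz_effective:
  assumes sing: "mutually_singular M unit_lebesgue" and f: "f \<in> L2 M"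
  shows "(\<lambda>N. L2_norm M (kremainder M f N)) \<longlonglongrightarrow> 0"
proof -
  have "(\<lambda>N. sqrt (1 - (\<Sum>n<N. (norm (kcoeff M (circ (-1)) n))\<^sup>2))) \<longlonglongrightarrow> sqrt (1 - 1)"
    using kcoeff_circ_minus_one_norm[OF sing] by (intro tendsto_intros) (simp add: sums_def)
  moreover have "sqrt (1 - (\<Sum>n<N. (norm (kcoeff M (circ (-1)) n))\<^sup>2)) = L2_norm M (kremainder M (circ (-1)) N)" for N
    using kremainder_norm[OF circ_L2, of "-1" N] by (simp add: circ_norm real_sqrt_unique)
  ultimately have "effective (circ (-1))" by (simp add: effective_def)
  from effective_all[OF this f] show ?thesis by (simp add: effective_def)
qed

end

section \<open>Slices of a measure on the square\<close>

lemma kaczmarz_measurable: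
  assumes a: "\<And>n. (\<lambda>y. a y n) \<in> borel_measurable N" and b: "\<And>n. (\<lambda>y. b y n) \<in> borel_measurable N"
  shows "(\<lambda>y. kaczmarz (a y) (b y) n) \<in> borel_measurable N"
proof (induction n rule: less_induct)
  case (less n)
  have "(\<lambda>y. a y n - (\<Sum>i<n. kaczmarz (a y) (b y) i * b y (n - i))) \<in> borel_measurable N"
    using less a b by (intro borel_measurable_diff borel_measurable_sum borel_measurable_times) auto
  then show ?case by (subst kaczmarz.simps)
qed

lemma completion_ex_borel_measurable_complex:
  fixes g :: "'a \<Rightarrow> complex"
  assumes "g \<in> borel_measurable (completion M)"
  obtains g' where "g' \<in> borel_measurable M" "AE x in M. g x = g' x"
proof -
  obtain r where [measurable]: "r \<in> borel_measurable M" and r: "AE x in M. Re (g x) = r x"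
    using completion_ex_borel_measurable_real[of "\<lambda>x. Re (g x)" M] assms by auto
  obtain i where [measurable]: "i \<in> borel_measurable M" and i: "AE x in M. Im (g x) = i x"
    using completion_ex_borel_measurable_real[of "\<lambda>x. Im (g x)" M] assms by auto
  show ?thesis
  proof (rule that)
    show "(\<lambda>x. of_real (r x) + \<i> * of_real (i x)) \<in> borel_measurable M" by measurable
    show "AE x in M. g x = of_real (r x) + \<i> * of_real (i x)"
      using r i by eventually_elim (simp add: complex_eq_iff)
  qed
qed

lemma fourier_mode_circ: "fourier_mode n m z = circ (int n) (fst z) * circ m (snd z)"
  by (simp add: fourier_mode_def case_prod_unfold circ_def cis_conv_exp mult_exp_exp algebra_simps)

section \<open>Integration along the slices\<close>

locale singular_fibered_measure = prob_space \<mu> for \<mu> :: "(real \<times> real) measure" +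
  fixes \<rho> :: "real \<Rightarrow> real measure"
  assumes sets_mu [measurable_cong]: "sets \<mu> = sets unit_square_borel"
    and disintegration: "rokhlin_disintegration \<mu> \<rho>"
    and singular: "y_singular_fibered \<mu> \<rho>"
begin

abbreviation marginal :: "real measure" ("\<nu>") where "\<nu> \<equiv> y_marginal \<mu>"

lemma space_mu: "space \<mu> = {0..<1} \<times> {0..<1}"
  using sets_eq_imp_space_eq[OF sets_mu] by (simp add: space_restrict_space)

lemma measurable_mu_borel: "f \<in> borel_measurable borel \<Longrightarrow> f \<in> borel_measurable \<mu>"
  by (subst measurable_cong_sets[OF sets_mu refl]) (rule measurable_restrict_space1)

lemma measurable_snd_marginal [measurable]: "snd \<in> \<mu> \<rightarrow>\<^sub>M unit_borel"
  by (rule measurable_restrict_space2)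
    (auto simp: space_mu intro!: measurable_mu_borel borel_measurable_continuous_onI continuous_intros)

lemma measurable_circ_fst [measurable]: "(\<lambda>z. circ n (fst z)) \<in> borel_measurable \<mu>"
  by (intro measurable_mu_borel borel_measurable_continuous_onI continuous_on_compose2[OF continuous_on_circ[of UNIV]]
      continuous_intros) auto

sublocale marginal: circle_prob \<nu>
proof (intro circle_prob.intro circle_measure.intro circle_measure_axioms.intro)
  show "prob_space \<nu>" unfolding y_marginal_def by (rule prob_space_distr) measurable
  then show "finite_measure \<nu>" by (rule prob_space.finite_measure)
  show "sets \<nu> = sets unit_borel" by (simp add: y_marginal_def)
qed

lemma fiber: "y \<in> {0..<1} \<Longrightarrow> circle_prob (\<rho> y)"
  using disintegration unfolding rokhlin_disintegration_def
  by (auto intro!: circle_prob.intro circle_measure.intro circle_measure_axioms.intro prob_space.finite_measure)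

lemma AE_fiber: "AE y in \<nu>. circle_prob (\<rho> y) \<and> mutually_singular (\<rho> y) unit_lebesgue"
  using singular[unfolded y_singular_fibered_def] AE_space[of \<nu>]
  by eventually_elim (auto simp: marginal.space_M intro: fiber)

lemma section_measurable:
  assumes f: "f \<in> borel_measurable \<mu>" and y: "y \<in> {0..<1}"
  shows "(\<lambda>x. f (x, y)) \<in> borel_measurable (\<rho> y)"
proof (rule measurable_compose[OF _ f])
  interpret F: circle_prob "\<rho> y" by (rule fiber[OF y])
  have "(\<lambda>x. (x, y)) \<in> \<rho> y \<rightarrow>\<^sub>M unit_square_borel"
    by (rule measurable_restrict_space2)
      (use y in \<open>auto simp: F.space_M intro!: F.borel_measurable_M borel_measurable_continuous_onI continuous_intros\<close>)
  then show "(\<lambda>x. (x, y)) \<in> \<rho> y \<rightarrow>\<^sub>M \<mu>"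
    by (simp add: measurable_cong_sets[OF refl sets_mu])
qed

lemma disintegrate:
  fixes f :: "real \<times> real \<Rightarrow> complex"
  assumes "integrable \<mu> f"
  shows "AE y in \<nu>. integrable (\<rho> y) (\<lambda>x. f (x, y))"
    and "integrable (completion \<nu>) (\<lambda>y. \<integral>x. f (x, y) \<partial>\<rho> y)"
    and "(\<integral>z. f z \<partial>\<mu>) = (\<integral>y. (\<integral>x. f (x, y) \<partial>\<rho> y) \<partial>completion \<nu>)"
  using disintegration assms unfolding rokhlin_disintegration_def by blast+

text \<open>The disintegration is formulated for complex integrands, so it is applied to the squared
  modulus viewed as a complex function, and the real conclusions are read off.\<close>

lemma fiber_L2:
  assumes f: "f \<in> L2 \<mu>"
  shows "AE y in \<nu>. (\<lambda>x. f (x, y)) \<in> L2 (\<rho> y)"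
    and "integrable (completion \<nu>) (\<lambda>y. (L2_norm (\<rho> y) (\<lambda>x. f (x, y)))\<^sup>2)"
    and "(L2_norm \<mu> f)\<^sup>2 = (\<integral>y. (L2_norm (\<rho> y) (\<lambda>x. f (x, y)))\<^sup>2 \<partial>completion \<nu>)"
proof -
  have int: "integrable \<mu> (\<lambda>z. complex_of_real ((norm (f z))\<^sup>2))"
    using L2_integrable[OF f] by (rule integrable_of_real)
  have real_int: "integrable M g" if "integrable M (\<lambda>x. complex_of_real (g x))" for M :: "real measure" and g
    using integrable_Re[OF that] by simp
  show "AE y in \<nu>. (\<lambda>x. f (x, y)) \<in> L2 (\<rho> y)"
    using disintegrate(1)[OF int] AE_space[of \<nu>]
  proof eventually_elim
    case (elim y)
    then show ?case
      by (intro L2I section_measurable L2_measurable[OF f] real_int) (auto simp: marginal.space_M)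
  qed
  show "integrable (completion \<nu>) (\<lambda>y. (L2_norm (\<rho> y) (\<lambda>x. f (x, y)))\<^sup>2)"
    unfolding L2_norm_sq by (rule real_int) (use disintegrate(2)[OF int] in \<open>simp only: integral_complex_of_real\<close>)
  have "complex_of_real ((L2_norm \<mu> f)\<^sup>2)
      = complex_of_real (\<integral>y. (L2_norm (\<rho> y) (\<lambda>x. f (x, y)))\<^sup>2 \<partial>completion \<nu>)"
    unfolding L2_norm_sq using disintegrate(3)[OF int] by (simp only: integral_complex_of_real)
  then show "(L2_norm \<mu> f)\<^sup>2 = (\<integral>y. (L2_norm (\<rho> y) (\<lambda>x. f (x, y)))\<^sup>2 \<partial>completion \<nu>)"
    by (simp only: of_real_eq_iff)
qed

definition fiber_coeff :: "nat \<Rightarrow> (real \<times> real \<Rightarrow> complex) \<Rightarrow> real \<Rightarrow> complex" where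
  "fiber_coeff n f y = kcoeff (\<rho> y) (\<lambda>x. f (x, y)) n"

lemma circ_fst_L2: "(\<lambda>z. circ n (fst z)) \<in> L2 \<mu>"
  by (rule L2_bounded[where B = 1]) auto

text \<open>Each coefficient is a polynomial in finitely many slice integrals, and these depend on
  \<open>y\<close> measurably only for the completion.\<close>

lemma fiber_coeff_measurable:
  assumes f: "f \<in> L2 \<mu>"
  shows "fiber_coeff n f \<in> borel_measurable (completion \<nu>)"
  unfolding fiber_coeff_def[abs_def] kcoeff_def
proof (rule kaczmarz_measurable)
  fix n
  have "integrable (completion \<nu>) (\<lambda>y. \<integral>x. f (x, y) * cnj (circ (int n) (fst (x, y))) \<partial>\<rho> y)"
    by (intro disintegrate L2_integrable_mult_cnj f circ_fst_L2)
  then show "(\<lambda>y. L2_inner (\<rho> y) (\<lambda>x. f (x, y)) (circ (int n))) \<in> borel_measurable (completion \<nu>)"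
    by (simp add: L2_inner_def borel_measurable_integrable)
  have "integrable \<mu> (\<lambda>z. circ (- int n) (fst z))"
    by (rule integrable_const_bound[where B = 1]) auto
  from disintegrate(2)[OF this] show "(\<lambda>y. moment (\<rho> y) n) \<in> borel_measurable (completion \<nu>)"
    by (simp add: moment_def borel_measurable_integrable)
qed

lemma fiber_coeff_add:
  assumes "f \<in> L2 \<mu>" "g \<in> L2 \<mu>"
  shows "AE y in \<nu>. fiber_coeff n (\<lambda>z. f z + g z) y = fiber_coeff n f y + fiber_coeff n g y"
  using fiber_L2(1)[OF assms(1)] fiber_L2(1)[OF assms(2)] AE_fiber
  by eventually_elim (simp add: fiber_coeff_def circle_prob.kcoeff_add)

lemma fiber_coeff_scale:
  "AE y in \<nu>. fiber_coeff n (\<lambda>z. c * f z) y = c * fiber_coeff n f y"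
  using AE_fiber by eventually_elim (simp add: fiber_coeff_def circle_prob.kcoeff_scale)

lemma fiber_remainder:
  assumes f: "f \<in> L2 \<mu>"
  shows "AE y in \<nu>. \<forall>N. (L2_norm (\<rho> y) (kremainder (\<rho> y) (\<lambda>x. f (x, y)) N))\<^sup>2
      = (L2_norm (\<rho> y) (\<lambda>x. f (x, y)))\<^sup>2 - (\<Sum>n<N. (norm (fiber_coeff n f y))\<^sup>2)"
    and "AE y in \<nu>. (\<lambda>N. L2_norm (\<rho> y) (kremainder (\<rho> y) (\<lambda>x. f (x, y)) N)) \<longlonglongrightarrow> 0"
  using fiber_L2(1)[OF f] AE_fiber
  by (eventually_elim, simp add: fiber_coeff_def circle_prob.kremainder_norm circle_prob.kaczmarz_effective)+

lemma fiber_Parseval: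
  assumes f: "f \<in> L2 \<mu>"
  shows "AE y in \<nu>. (\<lambda>n. (norm (fiber_coeff n f y))\<^sup>2) sums (L2_norm (\<rho> y) (\<lambda>x. f (x, y)))\<^sup>2"
  using fiber_remainder[OF f]
proof eventually_elim
  case (elim y)
  have "(\<lambda>N. (L2_norm (\<rho> y) (\<lambda>x. f (x, y)))\<^sup>2 - (L2_norm (\<rho> y) (kremainder (\<rho> y) (\<lambda>x. f (x, y)) N))\<^sup>2)
      \<longlonglongrightarrow> (L2_norm (\<rho> y) (\<lambda>x. f (x, y)))\<^sup>2 - 0\<^sup>2"
    by (intro tendsto_intros elim(2))
  then show ?case using elim(1) by (simp add: sums_def)
qed

text \<open>Parseval's identity on almost every slice, integrated over \<open>y\<close>; this
  isometry is the source of both the upper and the lower norm bound of the coefficient map.\<close>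

lemma fiber_coeff_norm_sum:
  assumes f: "f \<in> L2 \<mu>"
  shows "(\<Sum>n. \<integral>\<^sup>+y. ennreal ((norm (fiber_coeff n f y))\<^sup>2) \<partial>completion \<nu>) = ennreal ((L2_norm \<mu> f)\<^sup>2)"
proof -
  have [measurable]: "fiber_coeff n f \<in> borel_measurable (completion \<nu>)" for n
    by (rule fiber_coeff_measurable[OF f])
  have "(\<Sum>n. \<integral>\<^sup>+y. ennreal ((norm (fiber_coeff n f y))\<^sup>2) \<partial>completion \<nu>)
      = (\<integral>\<^sup>+y. (\<Sum>n. ennreal ((norm (fiber_coeff n f y))\<^sup>2)) \<partial>completion \<nu>)"
    by (rule nn_integral_suminf[symmetric]) measurable
  also have "\<dots> = (\<integral>\<^sup>+y. ennreal ((L2_norm (\<rho> y) (\<lambda>x. f (x, y)))\<^sup>2) \<partial>completion \<nu>)"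
    by (rule nn_integral_cong_AE, use AE_completion[OF fiber_Parseval[OF f]] in eventually_elim)
      (rule suminf_ennreal_eq, simp_all)
  also have "\<dots> = ennreal ((L2_norm \<mu> f)\<^sup>2)"
    unfolding fiber_L2(3)[OF f] by (intro nn_integral_eq_integral fiber_L2 f) auto
  finally show ?thesis .
qed

text \<open>Formulated for arbitrary versions \<open>k n\<close> of the slice coefficients, so that
  Borel versions can be inserted. Slicewise the error is the Kaczmarz remainder, which tends to zero
  and is dominated by the slice norm of \<open>f\<close>.\<close>

lemma fiber_series_remainder:
  assumes f: "f \<in> L2 \<mu>"
    and k: "\<And>n. (\<lambda>z. k n (snd z) * circ (int n) (fst z)) \<in> L2 \<mu>" "\<And>n. AE y in \<nu>. k n y = fiber_coeff n f y"
  shows "(\<lambda>N. L2_norm \<mu> (\<lambda>z. (\<Sum>n<N. k n (snd z) * circ (int n) (fst z)) - f z)) \<longlonglongrightarrow> 0"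
proof -
  define R where "R N z = (\<Sum>n<N. k n (snd z) * circ (int n) (fst z)) - f z" for N z
  have R: "R N \<in> L2 \<mu>" for N unfolding R_def[abs_def] by (intro L2_diff L2_sum k f)
  have AEk: "AE y in \<nu>. \<forall>n. k n y = fiber_coeff n f y" using k(2) by (simp add: AE_all_countable)
  have eq: "AE y in \<nu>. \<forall>N. (L2_norm (\<rho> y) (\<lambda>x. R N (x, y)))\<^sup>2
      = (L2_norm (\<rho> y) (kremainder (\<rho> y) (\<lambda>x. f (x, y)) N))\<^sup>2"
    using AEk
  proof eventually_elim
    case (elim y)
    have "R N (x, y) = - kremainder (\<rho> y) (\<lambda>x. f (x, y)) N x" for N x
      by (simp add: R_def kremainder_def elim fiber_coeff_def)
    then show ?case by (simp add: L2_norm_uminus)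
  qed
  have "(\<lambda>N. \<integral>y. (L2_norm (\<rho> y) (\<lambda>x. R N (x, y)))\<^sup>2 \<partial>completion \<nu>) \<longlonglongrightarrow> (\<integral>y. 0 \<partial>completion \<nu>)"
  proof (rule integral_dominated_convergence)
    show "integrable (completion \<nu>) (\<lambda>y. (L2_norm (\<rho> y) (\<lambda>x. f (x, y)))\<^sup>2)" by (rule fiber_L2[OF f])
    show "(\<lambda>y. (L2_norm (\<rho> y) (\<lambda>x. R N (x, y)))\<^sup>2) \<in> borel_measurable (completion \<nu>)" for N
      using fiber_L2(2)[OF R] by (rule borel_measurable_integrable)
    show "AE y in completion \<nu>. (\<lambda>N. (L2_norm (\<rho> y) (\<lambda>x. R N (x, y)))\<^sup>2) \<longlonglongrightarrow> 0"
      using AE_completion[OF eq] AE_completion[OF fiber_remainder(2)[OF f]]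
    proof eventually_elim
      case (elim y)
      from tendsto_power[OF elim(2), of 2] show ?case by (simp add: elim(1))
    qed
    show "AE y in completion \<nu>. norm ((L2_norm (\<rho> y) (\<lambda>x. R N (x, y)))\<^sup>2) \<le> (L2_norm (\<rho> y) (\<lambda>x. f (x, y)))\<^sup>2" for N
      using AE_completion[OF eq] AE_completion[OF fiber_remainder(1)[OF f]]
    proof eventually_elim
      case (elim y)
      have "(L2_norm (\<rho> y) (\<lambda>x. R N (x, y)))\<^sup>2
          = (L2_norm (\<rho> y) (\<lambda>x. f (x, y)))\<^sup>2 - (\<Sum>n<N. (norm (fiber_coeff n f y))\<^sup>2)"
        using elim by metis
      also have "\<dots> \<le> (L2_norm (\<rho> y) (\<lambda>x. f (x, y)))\<^sup>2" by (simp add: sum_nonneg)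
      finally show ?case by simp
    qed
  qed auto
  then have "(\<lambda>N. sqrt ((L2_norm \<mu> (R N))\<^sup>2)) \<longlonglongrightarrow> sqrt 0"
    unfolding fiber_L2(3)[OF R] by (intro tendsto_real_sqrt) simp
  then show ?thesis by (simp add: R_def[abs_def])
qed

end

section \<open>The expansion\<close>

lemma nn_integral_count_space_nat_int:
  fixes F :: "nat \<Rightarrow> int \<Rightarrow> ennreal"
  shows "(\<integral>\<^sup>+z. (case z of (n, m) \<Rightarrow> F n m) \<partial>count_space UNIV) = (\<Sum>n. \<integral>\<^sup>+m. F n m \<partial>count_space UNIV)"
proof -
  interpret sigma_finite_measure "count_space (UNIV :: int set)"
    by (rule sigma_finite_measure_count_space)
  have "(\<integral>\<^sup>+z. (case z of (n, m) \<Rightarrow> F n m) \<partial>count_space UNIV)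
      = (\<integral>\<^sup>+z. (case z of (n, m) \<Rightarrow> F n m) \<partial>(count_space UNIV \<Otimes>\<^sub>M count_space UNIV))"
    by (rule nn_integral_count_space_prod_eq[symmetric])
  also have "\<dots> = (\<integral>\<^sup>+n. \<integral>\<^sup>+m. F n m \<partial>count_space UNIV \<partial>count_space UNIV)"
    by (subst nn_integral_fst[symmetric]) (simp_all add: pair_measure_countable)
  finally show ?thesis by (simp add: nn_integral_count_space_nat)
qed

text \<open>The density obeys its bounds only almost everywhere for the marginal. Setting it to zero
  wherever they fail changes it on a null set of the marginal only, so integrals against the
  marginal are kept while the bounds hold at every point.\<close>

lemma essentially_equivalent_weight:
  assumes "essentially_equivalent_lebesgue \<nu>"
  obtains w :: "real \<Rightarrow> real" and lo hi :: real
  where "w \<in> borel_measurable unit_lebesgue" "0 < lo" "0 < hi" "\<And>y. w y = 0 \<or> lo \<le> w y \<and> w y \<le> hi"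
    "\<And>g. g \<in> borel_measurable unit_lebesgue \<Longrightarrow> (\<integral>\<^sup>+y. g y \<partial>\<nu>) = (\<integral>\<^sup>+y. ennreal (w y) * g y \<partial>unit_lebesgue)"
proof -
  define D where "D = RN_deriv unit_lebesgue \<nu>"
  define h where "h y = enn2real (D y)" for y
  have [measurable]: "D \<in> borel_measurable unit_lebesgue" unfolding D_def by (rule borel_measurable_RN_deriv)
  then have [measurable]: "h \<in> borel_measurable unit_lebesgue" unfolding h_def[abs_def] by measurable
  have ac: "absolutely_continuous unit_lebesgue \<nu>" and sets: "sets \<nu> = sets unit_lebesgue"
    and fin: "finite_measure \<nu>"
    using assms by (auto simp: essentially_equivalent_lebesgue_def lebesgue.sets_M)
  have "h \<in> L_infinity \<nu> \<and> (\<lambda>y. 1 / h y) \<in> L_infinity \<nu>"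
    using assms unfolding essentially_equivalent_lebesgue_def h_def[abs_def] D_def Let_def by blast
  then obtain C C' where C: "AE y in \<nu>. \<bar>h y\<bar> \<le> C" "AE y in \<nu>. \<bar>1 / h y\<bar> \<le> C'"
    by (auto simp: L_infinity_def)
  have RN: "(\<integral>\<^sup>+y. g y \<partial>\<nu>) = (\<integral>\<^sup>+y. D y * g y \<partial>unit_lebesgue)" if "g \<in> borel_measurable unit_lebesgue" for g
    unfolding D_def by (rule lebesgue.RN_deriv_nn_integral[OF ac sets that])
  have "AE y in unit_lebesgue. D y \<noteq> \<infinity>"
    unfolding D_def using fin
    by (intro lebesgue.RN_deriv_finite ac sets finite_measure.sigma_finite_measure)
  then have Dfin: "AE y in \<nu>. D y \<noteq> \<infinity>"
    by (rule absolutely_continuous_AE[OF sets ac])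
  \<comment> \<open>At a zero of \<open>h\<close> the quotient \<open>1 / h y\<close> is 0 by
    convention, so its bound does not exclude zeros. Integrating the indicator \<open>z\<close> of
    the zero set against the density shows that this set is null for \<open>\<nu>\<close>.\<close>
  define z :: "real \<Rightarrow> ennreal" where "z y = (if D y = 0 then 1 else 0)" for y
  have zm: "z \<in> borel_measurable unit_lebesgue" unfolding z_def[abs_def] by measurable
  have "(\<integral>\<^sup>+y. z y \<partial>\<nu>) = (\<integral>\<^sup>+y. D y * z y \<partial>unit_lebesgue)"
    by (rule RN[OF zm])
  also have "\<dots> = (\<integral>\<^sup>+y. 0 \<partial>unit_lebesgue)" by (intro nn_integral_cong) (auto simp: z_def)
  finally have "AE y in \<nu>. z y = 0"
    using zm by (simp add: nn_integral_0_iff_AE measurable_cong_sets[OF sets refl])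
  then have Dpos: "AE y in \<nu>. D y \<noteq> 0" by eventually_elim (auto simp: z_def split: if_splits)
  \<comment> \<open>The maxima make both bounds positive, whatever the signs of \<open>C\<close> and
    \<open>C'\<close>.\<close>
  define lo where "lo = 1 / max C' 1"
  define hi where "hi = max C 1"
  define w where "w y = (if lo \<le> h y \<and> h y \<le> hi then h y else 0)" for y
  have lo: "lo > 0" and hi: "hi > 0" by (auto simp: lo_def hi_def)
  have [measurable]: "w \<in> borel_measurable unit_lebesgue" unfolding w_def[abs_def] by measurable
  have wpos: "AE y in \<nu>. w y \<noteq> 0"
    using C Dfin Dpos
  proof eventually_elim
    case (elim y)
    then have h: "h y > 0" by (simp add: h_def enn2real_positive_iff top.not_eq_extremum zero_less_iff_neq_zero)
    have "1 / h y \<le> max C' 1" using elim(2) h by (simp add: le_max_iff_disj)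
    then have "lo \<le> h y" using h by (simp add: lo_def field_simps)
    moreover have "h y \<le> hi" using elim(1) h by (simp add: hi_def)
    ultimately show ?case using h by (simp add: w_def)
  qed
  show ?thesis
  proof (rule that[of w lo hi])
    fix g :: "real \<Rightarrow> ennreal" assume [measurable]: "g \<in> borel_measurable unit_lebesgue"
    have "(\<integral>\<^sup>+y. g y \<partial>\<nu>) = (\<integral>\<^sup>+y. indicator {y. w y \<noteq> 0} y * g y \<partial>\<nu>)"
      by (rule nn_integral_cong_AE, use wpos in eventually_elim) simp
    also have "\<dots> = (\<integral>\<^sup>+y. D y * (indicator {y. w y \<noteq> 0} y * g y) \<partial>unit_lebesgue)"
      by (rule RN) measurable
    also have "\<dots> = (\<integral>\<^sup>+y. ennreal (w y) * g y \<partial>unit_lebesgue)"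
    proof (rule nn_integral_cong)
      fix y
      have "D y = ennreal (w y)" if "w y \<noteq> 0"
      proof -
        have "h y > 0" "w y = h y" using that lo by (auto simp: w_def split: if_splits)
        moreover from this have "D y < top" by (simp add: h_def enn2real_positive_iff)
        ultimately show ?thesis by (simp add: h_def)
      qed
      then show "D y * (indicator {y. w y \<noteq> 0} y * g y) = ennreal (w y) * g y"
        by (cases "w y = 0") (auto simp: indicator_def)
    qed
    finally show "(\<integral>\<^sup>+y. g y \<partial>\<nu>) = (\<integral>\<^sup>+y. ennreal (w y) * g y \<partial>unit_lebesgue)" .
  qed (use lo hi in \<open>auto simp: w_def\<close>)
qed

text \<open>\<open>w\<close> is a version of the density of the marginal, set to zero where its bounds fail.\<close>

locale singular_fibered_weighted = singular_fibered_measure \<mu> \<rho> for \<mu> \<rho> +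
  fixes w :: "real \<Rightarrow> real" and lo hi :: real
  assumes w_measurable [measurable]: "w \<in> borel_measurable unit_lebesgue"
    and lo_pos: "0 < lo" and hi_pos: "0 < hi"
    and w_bounds: "\<And>y. w y = 0 \<or> lo \<le> w y \<and> w y \<le> hi"
    and nn_integral_marginal: "\<And>g. g \<in> borel_measurable unit_lebesgue \<Longrightarrow>
      (\<integral>\<^sup>+y. g y \<partial>y_marginal \<mu>) = (\<integral>\<^sup>+y. ennreal (w y) * g y \<partial>unit_lebesgue)"
begin

section \<open>Comparison of the marginal with Lebesgue measure\<close>

lemma sets_nu_lebesgue: "sets \<nu> = sets unit_lebesgue"
  by (simp only: marginal.sets_M lebesgue.sets_M)

lemma borel_nu_iff: "g \<in> borel_measurable \<nu> \<longleftrightarrow> g \<in> borel_measurable unit_lebesgue"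
  by (simp only: measurable_cong_sets[OF sets_nu_lebesgue refl])

lemma nn_integral_marginal_le:
  assumes "g \<in> borel_measurable unit_lebesgue"
  shows "(\<integral>\<^sup>+y. g y \<partial>\<nu>) \<le> ennreal hi * (\<integral>\<^sup>+y. g y \<partial>unit_lebesgue)"
proof -
  have w: "w y \<le> hi" for y using w_bounds[of y] hi_pos by auto
  show ?thesis
    unfolding nn_integral_marginal[OF assms] nn_integral_cmult[OF assms, symmetric]
    by (intro nn_integral_mono mult_right_mono ennreal_leI w) simp
qed

text \<open>Where the weight vanishes, Lebesgue measure still counts \<open>g\<close> but the
  marginal does not; hence the second hypothesis.\<close>

lemma nn_integral_marginal_ge:
  assumes "g \<in> borel_measurable unit_lebesgue" "\<And>y. w y = 0 \<Longrightarrow> g y = 0"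
  shows "ennreal lo * (\<integral>\<^sup>+y. g y \<partial>unit_lebesgue) \<le> (\<integral>\<^sup>+y. g y \<partial>\<nu>)"
proof -
  have "ennreal lo * g y \<le> ennreal (w y) * g y" for y
  proof (cases "w y = 0")
    case False
    with w_bounds[of y] show ?thesis by (intro mult_right_mono ennreal_leI) auto
  qed (simp add: assms(2))
  then show ?thesis
    unfolding nn_integral_marginal[OF assms(1)] nn_integral_cmult[OF assms(1), symmetric]
    by (intro nn_integral_mono)
qed

lemma AE_weight_nonzero: "AE y in \<nu>. w y \<noteq> 0"
proof -
  define z :: "real \<Rightarrow> ennreal" where "z y = (if w y = 0 then 1 else 0)" for y
  have zm: "z \<in> borel_measurable unit_lebesgue" unfolding z_def[abs_def] by measurable
  have "(\<integral>\<^sup>+y. z y \<partial>\<nu>) = (\<integral>\<^sup>+y. ennreal (w y) * z y \<partial>unit_lebesgue)"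
    by (rule nn_integral_marginal[OF zm])
  also have "\<dots> = (\<integral>\<^sup>+y. 0 \<partial>unit_lebesgue)" by (intro nn_integral_cong) (auto simp: z_def)
  finally have "AE y in \<nu>. z y = 0"
    using zm by (simp add: nn_integral_0_iff_AE borel_nu_iff)
  then show ?thesis by eventually_elim (auto simp: z_def split: if_splits)
qed

text \<open>The comparison above, applied to the modulus of the difference. It lets
  almost-everywhere identities between slice coefficients reach their Fourier coefficients.\<close>

lemma AE_marginal_lebesgue:
  fixes k k' :: "real \<Rightarrow> complex"
  assumes [measurable]: "k \<in> borel_measurable unit_lebesgue" "k' \<in> borel_measurable unit_lebesgue"
    and zero: "\<And>y. w y = 0 \<Longrightarrow> k y = 0" "\<And>y. w y = 0 \<Longrightarrow> k' y = 0" and eq: "AE y in \<nu>. k y = k' y"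
  shows "AE y in unit_lebesgue. k y = k' y"
proof -
  have "ennreal lo * (\<integral>\<^sup>+y. ennreal (norm (k y - k' y)) \<partial>unit_lebesgue) \<le> (\<integral>\<^sup>+y. ennreal (norm (k y - k' y)) \<partial>\<nu>)"
    by (rule nn_integral_marginal_ge) (simp_all add: zero)
  also have "\<dots> = (\<integral>\<^sup>+y. 0 \<partial>\<nu>)"
    by (rule nn_integral_cong_AE, use eq in eventually_elim) simp
  finally have "(\<integral>\<^sup>+y. ennreal (norm (k y - k' y)) \<partial>unit_lebesgue) = 0"
    using lo_pos by simp
  then show ?thesis by (subst (asm) nn_integral_0_iff_AE) auto
qed

text \<open>\<open>fiber_coeff\<close> is measurable only for the completion, so a Borel version is
  chosen. Its vanishing where \<open>w\<close> does makes the choice unique up to Lebesgue null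
  sets.\<close>

definition slice_coeff :: "nat \<Rightarrow> (real \<times> real \<Rightarrow> complex) \<Rightarrow> real \<Rightarrow> complex" where
  "slice_coeff n f = (SOME k. k \<in> borel_measurable unit_lebesgue \<and> (\<forall>y. w y = 0 \<longrightarrow> k y = 0) \<and>
    (AE y in \<nu>. k y = fiber_coeff n f y))"

lemma slice_coeff:
  assumes f: "f \<in> L2 \<mu>"
  shows "slice_coeff n f \<in> borel_measurable unit_lebesgue" "w y = 0 \<Longrightarrow> slice_coeff n f y = 0"
    "AE y in \<nu>. slice_coeff n f y = fiber_coeff n f y"
proof -
  obtain g where "g \<in> borel_measurable \<nu>" and g: "AE y in \<nu>. fiber_coeff n f y = g y"
    using completion_ex_borel_measurable_complex[OF fiber_coeff_measurable[OF f]] by blast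
  then have [measurable]: "g \<in> borel_measurable unit_lebesgue" by (simp only: borel_nu_iff)
  have "AE y in \<nu>. (if w y = 0 then 0 else g y) = fiber_coeff n f y"
    using g AE_weight_nonzero by eventually_elim simp
  moreover have "(\<lambda>y. if w y = 0 then 0 else g y) \<in> borel_measurable unit_lebesgue" by measurable
  ultimately have "(\<lambda>y. if w y = 0 then 0 else g y) \<in> borel_measurable unit_lebesgue \<and>
      (\<forall>y. w y = 0 \<longrightarrow> (if w y = 0 then 0 else g y) = 0) \<and>
      (AE y in \<nu>. (if w y = 0 then 0 else g y) = fiber_coeff n f y)"
    by simp
  from someI[where P = "\<lambda>k. k \<in> borel_measurable unit_lebesgue \<and> (\<forall>y. w y = 0 \<longrightarrow> k y = 0) \<and>
    (AE y in \<nu>. k y = fiber_coeff n f y)", OF this]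
  show "slice_coeff n f \<in> borel_measurable unit_lebesgue" "w y = 0 \<Longrightarrow> slice_coeff n f y = 0"
    "AE y in \<nu>. slice_coeff n f y = fiber_coeff n f y"
    unfolding slice_coeff_def by blast+
qed

lemma slice_coeff_nn_integral:
  assumes f: "f \<in> L2 \<mu>"
  shows "(\<integral>\<^sup>+y. ennreal ((norm (slice_coeff n f y))\<^sup>2) \<partial>\<nu>)
    = (\<integral>\<^sup>+y. ennreal ((norm (fiber_coeff n f y))\<^sup>2) \<partial>completion \<nu>)"
  unfolding nn_integral_completion
  by (rule nn_integral_cong_AE, use slice_coeff(3)[OF f, of n] in eventually_elim) simp

lemma slice_coeff_sum_le:
  assumes f: "f \<in> L2 \<mu>"
  shows "ennreal lo * (\<Sum>n. \<integral>\<^sup>+y. ennreal ((norm (slice_coeff n f y))\<^sup>2) \<partial>unit_lebesgue) \<le> ennreal ((L2_norm \<mu> f)\<^sup>2)"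
proof -
  have [measurable]: "slice_coeff n f \<in> borel_measurable unit_lebesgue" for n by (rule slice_coeff[OF f])
  have "ennreal lo * (\<Sum>n. \<integral>\<^sup>+y. ennreal ((norm (slice_coeff n f y))\<^sup>2) \<partial>unit_lebesgue)
      = (\<Sum>n. ennreal lo * (\<integral>\<^sup>+y. ennreal ((norm (slice_coeff n f y))\<^sup>2) \<partial>unit_lebesgue))"
    by simp
  also have "\<dots> \<le> (\<Sum>n. \<integral>\<^sup>+y. ennreal ((norm (slice_coeff n f y))\<^sup>2) \<partial>\<nu>)"
    by (intro suminf_le nn_integral_marginal_ge) (auto simp: slice_coeff[OF f])
  also have "\<dots> = ennreal ((L2_norm \<mu> f)\<^sup>2)"
    unfolding slice_coeff_nn_integral[OF f] by (rule fiber_coeff_norm_sum[OF f])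
  finally show ?thesis .
qed

lemma slice_coeff_sum_ge:
  assumes f: "f \<in> L2 \<mu>"
  shows "ennreal ((L2_norm \<mu> f)\<^sup>2) \<le> ennreal hi * (\<Sum>n. \<integral>\<^sup>+y. ennreal ((norm (slice_coeff n f y))\<^sup>2) \<partial>unit_lebesgue)"
proof -
  have [measurable]: "slice_coeff n f \<in> borel_measurable unit_lebesgue" for n by (rule slice_coeff[OF f])
  have "ennreal ((L2_norm \<mu> f)\<^sup>2) = (\<Sum>n. \<integral>\<^sup>+y. ennreal ((norm (slice_coeff n f y))\<^sup>2) \<partial>\<nu>)"
    unfolding slice_coeff_nn_integral[OF f] by (rule fiber_coeff_norm_sum[OF f, symmetric])
  also have "\<dots> \<le> (\<Sum>n. ennreal hi * (\<integral>\<^sup>+y. ennreal ((norm (slice_coeff n f y))\<^sup>2) \<partial>unit_lebesgue))"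
    by (intro suminf_le nn_integral_marginal_le) auto
  finally show ?thesis by simp
qed

lemma slice_coeff_L2:
  assumes f: "f \<in> L2 \<mu>"
  shows "slice_coeff n f \<in> L2 unit_lebesgue"
proof (rule L2_I_nn_integral[OF slice_coeff(1)[OF f]])
  let ?F = "\<lambda>n. \<integral>\<^sup>+y. ennreal ((norm (slice_coeff n f y))\<^sup>2) \<partial>unit_lebesgue"
  have "ennreal lo * (\<Sum>n. ?F n) < \<infinity>"
    using slice_coeff_sum_le[OF f] by (rule le_less_trans) simp
  then have "(\<Sum>n. ?F n) < \<infinity>" using lo_pos by (auto simp: ennreal_mult_less_top)
  moreover have "?F n \<le> (\<Sum>n. ?F n)" using sum_le_suminf[of ?F "{n}"] by simp
  ultimately show "?F n < \<infinity>" by (rule le_less_trans[rotated])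
qed

section \<open>The coefficient map and its bounds\<close>

definition expansion_coeff :: "nat \<Rightarrow> int \<Rightarrow> (real \<times> real \<Rightarrow> complex) \<Rightarrow> complex" where
  "expansion_coeff n m f = fourier_coeff (slice_coeff n f) m"

text \<open>The chosen slice coefficients are additive only almost everywhere for the marginal; by
  their vanishing with \<open>w\<close> also almost everywhere for Lebesgue measure, and Fourier
  coefficients do not see the exceptional set.\<close>

lemma expansion_coeff_add:
  assumes f: "f \<in> L2 \<mu>" and g: "g \<in> L2 \<mu>"
  shows "expansion_coeff n m (\<lambda>z. f z + g z) = expansion_coeff n m f + expansion_coeff n m g"
proof -
  have fg: "(\<lambda>z. f z + g z) \<in> L2 \<mu>" by (rule L2_add[OF f g])
  note [measurable] = slice_coeff(1)[OF f] slice_coeff(1)[OF g] slice_coeff(1)[OF fg]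
  have "AE y in \<nu>. slice_coeff n (\<lambda>z. f z + g z) y = slice_coeff n f y + slice_coeff n g y"
    using slice_coeff(3)[OF f, of n] slice_coeff(3)[OF g, of n] slice_coeff(3)[OF fg, of n]
      fiber_coeff_add[OF f g, of n]
    by eventually_elim simp
  then have "AE y in unit_lebesgue. slice_coeff n (\<lambda>z. f z + g z) y = slice_coeff n f y + slice_coeff n g y"
    by (intro AE_marginal_lebesgue) (simp_all add: slice_coeff[OF f] slice_coeff[OF g] slice_coeff[OF fg])
  then have "expansion_coeff n m (\<lambda>z. f z + g z) = L2_inner unit_lebesgue (\<lambda>y. slice_coeff n f y + slice_coeff n g y) (circ m)"
    unfolding expansion_coeff_def fourier_coeff_def
    by (intro L2_inner_cong_AE L2_add slice_coeff_L2 f g fg lebesgue.circ_L2)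
  then show ?thesis
    by (simp add: L2_inner_add_left slice_coeff_L2 f g expansion_coeff_def fourier_coeff_def)
qed

lemma expansion_coeff_scale:
  assumes f: "f \<in> L2 \<mu>"
  shows "expansion_coeff n m (\<lambda>z. c * f z) = c * expansion_coeff n m f"
proof -
  have cf: "(\<lambda>z. c * f z) \<in> L2 \<mu>" by (rule L2_scale[OF f])
  note [measurable] = slice_coeff(1)[OF f] slice_coeff(1)[OF cf]
  have "AE y in \<nu>. slice_coeff n (\<lambda>z. c * f z) y = c * slice_coeff n f y"
    using slice_coeff(3)[OF f, of n] slice_coeff(3)[OF cf, of n] fiber_coeff_scale[of n c f]
    by eventually_elim simp
  then have "AE y in unit_lebesgue. slice_coeff n (\<lambda>z. c * f z) y = c * slice_coeff n f y"
    by (intro AE_marginal_lebesgue) (simp_all add: slice_coeff[OF f] slice_coeff[OF cf])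
  then have "expansion_coeff n m (\<lambda>z. c * f z) = L2_inner unit_lebesgue (\<lambda>y. c * slice_coeff n f y) (circ m)"
    unfolding expansion_coeff_def fourier_coeff_def
    by (intro L2_inner_cong_AE L2_scale slice_coeff_L2 f cf lebesgue.circ_L2)
  then show ?thesis
    by (simp add: L2_inner_scale_left expansion_coeff_def fourier_coeff_def)
qed

lemma expansion_coeff_norm_sum:
  assumes f: "f \<in> L2 \<mu>"
  shows "(\<integral>\<^sup>+z. ennreal ((norm (case z of (n, m) \<Rightarrow> expansion_coeff n m f))\<^sup>2) \<partial>index_measure)
    = (\<Sum>n. \<integral>\<^sup>+y. ennreal ((norm (slice_coeff n f y))\<^sup>2) \<partial>unit_lebesgue)"
proof -
  have "(\<integral>\<^sup>+z. ennreal ((norm (case z of (n, m) \<Rightarrow> expansion_coeff n m f))\<^sup>2) \<partial>index_measure)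
      = (\<integral>\<^sup>+z. (case z of (n, m) \<Rightarrow> ennreal ((norm (expansion_coeff n m f))\<^sup>2)) \<partial>index_measure)"
    by (intro nn_integral_cong) auto
  then show ?thesis
    by (simp only: nn_integral_count_space_nat_int expansion_coeff_def fourier_Parseval[OF slice_coeff_L2[OF f]])
qed

lemma expansion_coeff_L2:
  assumes f: "f \<in> L2 \<mu>"
  shows "(\<lambda>(n, m). expansion_coeff n m f) \<in> L2 index_measure"
proof (rule L2_I_nn_integral)
  have "ennreal lo * (\<integral>\<^sup>+z. ennreal ((norm (case z of (n, m) \<Rightarrow> expansion_coeff n m f))\<^sup>2) \<partial>index_measure) < \<infinity>"
    unfolding expansion_coeff_norm_sum[OF f] using slice_coeff_sum_le[OF f] by (rule le_less_trans) simp
  then show "(\<integral>\<^sup>+z. ennreal ((norm (case z of (n, m) \<Rightarrow> expansion_coeff n m f))\<^sup>2) \<partial>index_measure) < \<infinity>"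
    using lo_pos by (auto simp: ennreal_mult_less_top)
qed simp

text \<open>By Parseval in \<open>y\<close> the squared norm of the coefficients is a sum of
  Lebesgue integrals, and by \<open>fiber_coeff_norm_sum\<close> that of \<open>f\<close> is the
  same sum with the marginal. The two differ by factors between \<open>lo\<close> and
  \<open>hi\<close>.\<close>

lemma expansion_coeff_norm_bounds:
  assumes f: "f \<in> L2 \<mu>"
  shows "L2_norm index_measure (\<lambda>(n, m). expansion_coeff n m f) \<le> 1 / sqrt lo * L2_norm \<mu> f"
    and "L2_norm \<mu> f \<le> sqrt hi * L2_norm index_measure (\<lambda>(n, m). expansion_coeff n m f)"
proof -
  let ?V = "L2_norm index_measure (\<lambda>(n, m). expansion_coeff n m f)"
  have V: "(\<Sum>n. \<integral>\<^sup>+y. ennreal ((norm (slice_coeff n f y))\<^sup>2) \<partial>unit_lebesgue) = ennreal (?V\<^sup>2)"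
    using expansion_coeff_norm_sum[OF f] L2_nn_integral[OF expansion_coeff_L2[OF f]] by simp
  have "lo * ?V\<^sup>2 \<le> (L2_norm \<mu> f)\<^sup>2"
    using slice_coeff_sum_le[OF f] lo_pos unfolding V by (simp flip: ennreal_mult)
  then have "sqrt (lo * ?V\<^sup>2) \<le> sqrt ((L2_norm \<mu> f)\<^sup>2)" by (rule real_sqrt_le_mono)
  then show "?V \<le> 1 / sqrt lo * L2_norm \<mu> f"
    using lo_pos by (simp add: real_sqrt_mult field_simps)
  have "(L2_norm \<mu> f)\<^sup>2 \<le> hi * ?V\<^sup>2"
    using slice_coeff_sum_ge[OF f] hi_pos unfolding V by (simp flip: ennreal_mult)
  then have "sqrt ((L2_norm \<mu> f)\<^sup>2) \<le> sqrt (hi * ?V\<^sup>2)" by (rule real_sqrt_le_mono)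
  then show "L2_norm \<mu> f \<le> sqrt hi * ?V"
    using hi_pos by (simp add: real_sqrt_mult)
qed

lemma expansion_coeff_norm_le:
  assumes f: "f \<in> L2 \<mu>"
  shows "norm (expansion_coeff n m f) \<le> 1 / sqrt lo * L2_norm \<mu> f"
proof -
  let ?V = "L2_norm index_measure (\<lambda>(n, m). expansion_coeff n m f)"
  have "ennreal ((norm (expansion_coeff n m f))\<^sup>2) = (\<integral>\<^sup>+z. ennreal ((norm (expansion_coeff n m f))\<^sup>2) * indicator {(n, m)} z \<partial>index_measure)"
    by (simp add: nn_integral_cmult)
  also have "\<dots> \<le> (\<integral>\<^sup>+z. ennreal ((norm (case z of (n, m) \<Rightarrow> expansion_coeff n m f))\<^sup>2) \<partial>index_measure)"
    by (intro nn_integral_mono) (auto simp: indicator_def)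
  also have "\<dots> = ennreal (?V\<^sup>2)" by (rule L2_nn_integral[OF expansion_coeff_L2[OF f]])
  finally have "(norm (expansion_coeff n m f))\<^sup>2 \<le> ?V\<^sup>2" by simp
  then have "norm (expansion_coeff n m f) \<le> ?V" by (rule power2_le_imp_le) simp
  also have "\<dots> \<le> 1 / sqrt lo * L2_norm \<mu> f" by (rule expansion_coeff_norm_bounds[OF f])
  finally show ?thesis .
qed

lemma expansion_coeff_diff:
  assumes "f \<in> L2 \<mu>" "g \<in> L2 \<mu>"
  shows "expansion_coeff n m (\<lambda>z. f z - g z) = expansion_coeff n m f - expansion_coeff n m g"
  using expansion_coeff_add[OF assms(1) L2_uminus[OF assms(2)], of n m] expansion_coeff_scale[OF assms(2), of n m "- 1"] by simp

text \<open>Deduced from linearity and boundedness: the difference has norm zero, hence zero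
  coefficients. The chosen slice coefficients of \<open>f\<close> and \<open>g\<close> are thus
  never compared directly.\<close>

lemma expansion_coeff_cong_AE:
  assumes fg: "f \<in> L2 \<mu>" "g \<in> L2 \<mu>" and eq: "AE z in \<mu>. f z = g z"
  shows "expansion_coeff n m f = expansion_coeff n m g"
proof -
  have "L2_norm \<mu> (\<lambda>z. f z - g z) = 0"
    using eq by (subst L2_norm_eq_0_iff[OF L2_diff[OF fg]]) simp
  then show ?thesis using expansion_coeff_norm_le[OF L2_diff[OF fg], of n m] by (simp add: expansion_coeff_diff fg)
qed

lemma expansion_coeff_continuous: "continuous_linear_functional \<mu> (expansion_coeff n m)"
  unfolding continuous_linear_functional_def
proof (intro conjI ballI allI impI)
  fix f and \<epsilon> :: real assume f: "f \<in> L2 \<mu>" and \<epsilon>: "\<epsilon> > 0"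
  show "\<exists>\<delta>>0. \<forall>g\<in>L2 \<mu>. L2_norm \<mu> (\<lambda>x. g x - f x) < \<delta> \<longrightarrow> norm (expansion_coeff n m g - expansion_coeff n m f) < \<epsilon>"
  proof (intro exI[of _ "\<epsilon> * sqrt lo"] conjI ballI impI)
    fix g assume g: "g \<in> L2 \<mu>" and less: "L2_norm \<mu> (\<lambda>x. g x - f x) < \<epsilon> * sqrt lo"
    have "norm (expansion_coeff n m g - expansion_coeff n m f) \<le> 1 / sqrt lo * L2_norm \<mu> (\<lambda>x. g x - f x)"
      using expansion_coeff_norm_le[OF L2_diff[OF g f], of n m] by (simp add: expansion_coeff_diff f g)
    also have "\<dots> < \<epsilon>" using less lo_pos by (simp add: field_simps)
    finally show "norm (expansion_coeff n m g - expansion_coeff n m f) < \<epsilon>" .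
  qed (use \<epsilon> lo_pos in simp)
qed (auto intro: expansion_coeff_add expansion_coeff_scale expansion_coeff_cong_AE)

lemma expansion_coeff_left_inverse: "has_bounded_left_inverse \<mu> index_measure (\<lambda>f (n, m). expansion_coeff n m f)"
proof (rule has_bounded_left_inverseI)
  show "bounded_linear_L2 \<mu> index_measure (\<lambda>f (n, m). expansion_coeff n m f)"
    unfolding bounded_linear_L2_def
  proof (intro conjI ballI allI impI exI[of _ "1 / sqrt lo"])
    fix f g assume fg: "f \<in> L2 \<mu>" "g \<in> L2 \<mu>"
    show "AE z in index_measure. (case z of (n, m) \<Rightarrow> expansion_coeff n m f) = (case z of (n, m) \<Rightarrow> expansion_coeff n m g)"
      if "AE z in \<mu>. f z = g z"
      using expansion_coeff_cong_AE[OF fg that] by (auto split: prod.split)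
    show "AE z in index_measure. (case z of (n, m) \<Rightarrow> expansion_coeff n m (\<lambda>x. f x + g x))
        = (case z of (n, m) \<Rightarrow> expansion_coeff n m f) + (case z of (n, m) \<Rightarrow> expansion_coeff n m g)"
      by (auto simp: expansion_coeff_add[OF fg] split: prod.split)
  next
    show "L2_norm index_measure (\<lambda>(n, m). expansion_coeff n m f) \<le> 1 / sqrt lo * L2_norm \<mu> f" if "f \<in> L2 \<mu>" for f
      by (rule expansion_coeff_norm_bounds[OF that])
  qed (auto simp: expansion_coeff_L2 expansion_coeff_scale split: prod.split)
  show "L2_norm \<mu> f \<le> sqrt hi * L2_norm index_measure (\<lambda>(n, m). expansion_coeff n m f)" if "f \<in> L2 \<mu>" for f
    by (rule expansion_coeff_norm_bounds[OF that])
qed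

section \<open>Convergence of the double series\<close>

lemma tensor_norm:
  assumes [measurable]: "k \<in> borel_measurable unit_lebesgue"
  shows "(\<integral>\<^sup>+z. ennreal ((norm (k (snd z) * circ n (fst z)))\<^sup>2) \<partial>\<mu>) = (\<integral>\<^sup>+y. ennreal ((norm (k y))\<^sup>2) \<partial>\<nu>)"
proof -
  have "(\<integral>\<^sup>+y. ennreal ((norm (k y))\<^sup>2) \<partial>\<nu>) = (\<integral>\<^sup>+z. ennreal ((norm (k (snd z)))\<^sup>2) \<partial>\<mu>)"
    unfolding y_marginal_def
    by (rule nn_integral_distr[OF measurable_snd_marginal])
      (simp add: measurable_cong_sets[OF lebesgue.sets_M[symmetric] refl])
  then show ?thesis by (simp add: norm_mult)
qed

text \<open>The factor \<open>circ n\<close> has modulus one, so only the marginal enters, and its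
  density is at most \<open>hi\<close>. Convergence in \<open>y\<close> with respect to Lebesgue
  measure thereby becomes convergence on the square.\<close>

lemma tensor_L2:
  assumes k: "k \<in> L2 unit_lebesgue"
  shows "(\<lambda>z. k (snd z) * circ n (fst z)) \<in> L2 \<mu>"
    and "L2_norm \<mu> (\<lambda>z. k (snd z) * circ n (fst z)) \<le> sqrt hi * L2_norm unit_lebesgue k"
proof -
  have km [measurable]: "k \<in> borel_measurable unit_lebesgue" using k by (rule L2_measurable)
  have "(\<lambda>z. k (snd z)) \<in> borel_measurable \<mu>"
    by (rule measurable_compose[OF measurable_snd_marginal])
      (simp add: measurable_cong_sets[OF lebesgue.sets_M[symmetric] refl] km)
  then have m: "(\<lambda>z. k (snd z) * circ n (fst z)) \<in> borel_measurable \<mu>" by measurable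
  have le: "(\<integral>\<^sup>+z. ennreal ((norm (k (snd z) * circ n (fst z)))\<^sup>2) \<partial>\<mu>) \<le> ennreal (hi * (L2_norm unit_lebesgue k)\<^sup>2)"
    unfolding tensor_norm[OF km]
    using nn_integral_marginal_le[of "\<lambda>y. ennreal ((norm (k y))\<^sup>2)"] hi_pos
    by (simp add: L2_nn_integral[OF k] ennreal_mult)
  show L2: "(\<lambda>z. k (snd z) * circ n (fst z)) \<in> L2 \<mu>"
    by (rule L2_I_nn_integral[OF m le_less_trans[OF le]]) simp
  have "(L2_norm \<mu> (\<lambda>z. k (snd z) * circ n (fst z)))\<^sup>2 \<le> hi * (L2_norm unit_lebesgue k)\<^sup>2"
    using le hi_pos unfolding L2_nn_integral[OF L2] by (subst (asm) ennreal_le_iff) auto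
  then show "L2_norm \<mu> (\<lambda>z. k (snd z) * circ n (fst z)) \<le> sqrt hi * L2_norm unit_lebesgue k"
    using real_sqrt_le_mono hi_pos by (fastforce simp: real_sqrt_mult)
qed

text \<open>The inner sum over \<open>m\<close> is the Fourier series of the slice coefficient times
  \<open>circ n\<close> in \<open>x\<close>, and converges to \<open>?g n\<close> by the bound on
  tensors. The outer sum over \<open>n\<close> is then the Kaczmarz series on the slices, taken in
  its given order.\<close>

lemma expansion_coeff_expansion:
  assumes f: "f \<in> L2 \<mu>"
  shows "fourier_expansion \<mu> (\<lambda>n m. expansion_coeff n m f) f"
  unfolding fourier_expansion_def
proof (intro exI conjI allI)
  let ?g = "\<lambda>n z. slice_coeff n f (snd z) * circ (int n) (fst z)"
  have g: "?g n \<in> L2 \<mu>" for n by (rule tensor_L2[OF slice_coeff_L2[OF f]])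
  show "L2_sums \<mu> ?g f"
    unfolding L2_sums_def L2_tendsto_def
    using fiber_series_remainder[OF f g slice_coeff(3)[OF f]] by (auto intro: L2_sum g f)
  fix n
  have k: "slice_coeff n f \<in> L2 unit_lebesgue" by (rule slice_coeff_L2[OF f])
  let ?S = "\<lambda>A y. \<Sum>m\<in>A. expansion_coeff n m f * circ m y"
  have S: "?S A \<in> L2 unit_lebesgue" for A by (intro L2_sum L2_scale) simp
  have mode: "(\<Sum>m\<in>A. expansion_coeff n m f * fourier_mode n m z) = ?S A (snd z) * circ (int n) (fst z)" for A z
    by (simp add: fourier_mode_circ sum_distrib_left sum_distrib_right mult_ac)
  have "L2_norm \<mu> (\<lambda>z. (\<Sum>m\<in>A. expansion_coeff n m f * fourier_mode n m z) - ?g n z)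
      \<le> sqrt hi * L2_norm unit_lebesgue (\<lambda>y. slice_coeff n f y - ?S A y)" for A
    using tensor_L2(2)[OF L2_diff[OF S k], of A "int n"]
    by (simp add: mode left_diff_distrib L2_norm_minus_commute[of unit_lebesgue "slice_coeff n f"])
  moreover have "((\<lambda>(p, q). sqrt hi * L2_norm unit_lebesgue (\<lambda>y. slice_coeff n f y - ?S {- int p..int q} y)) \<longlongrightarrow> 0)
      (sequentially \<times>\<^sub>F sequentially)"
    using tendsto_mult_left[OF fourier_bisum_convergence[OF k], of "sqrt hi"]
    by (simp add: expansion_coeff_def case_prod_unfold)
  ultimately show "L2_bisums \<mu> (\<lambda>m z. expansion_coeff n m f * fourier_mode n m z) (?g n)"
    unfolding L2_bisums_def L2_tendsto_def
    by (intro conjI allI g, simp only: case_prod_unfold mode, intro tensor_L2 S,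
        elim Lim_null_comparison[rotated]) (auto intro!: always_eventually)
qed

end

theorem theorem4:
  fixes \<mu> :: "(real \<times> real) measure" and \<rho> :: "real \<Rightarrow> real measure"
  assumes "prob_space \<mu>"
    and "sets \<mu> = sets unit_square_borel"
    and "rokhlin_disintegration \<mu> \<rho>"
    and "y_singular_fibered \<mu> \<rho>"
    and "essentially_equivalent_lebesgue (y_marginal \<mu>)"
  shows "\<exists>d :: nat \<Rightarrow> int \<Rightarrow> (real \<times> real \<Rightarrow> complex) \<Rightarrow> complex.
           (\<forall>f\<in>L2 \<mu>. fourier_expansion \<mu> (\<lambda>n m. d n m f) f) \<and>
           (\<forall>n m. continuous_linear_functional \<mu> (d n m)) \<and>
           (\<forall>f\<in>L2 \<mu>. (\<lambda>(n, m). d n m f) \<in> L2 index_measure) \<and>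
           has_bounded_left_inverse \<mu> index_measure (\<lambda>f (n, m). d n m f)"
proof -
  obtain w lo hi where w: "w \<in> borel_measurable unit_lebesgue" "0 < lo" "0 < hi"
    "\<And>y. w y = 0 \<or> lo \<le> w y \<and> w y \<le> hi"
    "\<And>g. g \<in> borel_measurable unit_lebesgue \<Longrightarrow>
      (\<integral>\<^sup>+y. g y \<partial>y_marginal \<mu>) = (\<integral>\<^sup>+y. ennreal (w y) * g y \<partial>unit_lebesgue)"
    by (rule essentially_equivalent_weight[OF assms(5)]) (rule that)
  interpret singular_fibered_weighted \<mu> \<rho> w lo hi
    by (intro singular_fibered_weighted.intro singular_fibered_measure.intro
        singular_fibered_measure_axioms.intro singular_fibered_weighted_axioms.intro assms w)
  show ?thesis
    by (intro exI[of _ expansion_coeff] conjI ballI allI expansion_coeff_expansion expansion_coeff_continuous expansion_coeff_L2 expansion_coeff_left_inverse)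
qed

end
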